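(* Let $S\in\mathcal B_T^r(H)$. Then $S^*\in\mathcal B_T^r(H)$ and $|S|_{\rm ord}\in\mathcal B_T^r(H)_+=\mathcal B_T(H)_+$, and $$|S|_{\rm ord}^{*}\,|S|_{\rm ord}-S^*S=2\bigl((S^* )^+S^-+(S^* )^-S^+\bigr).$$ In particular, $$S^*S\le_o|S|_{\rm ord}^{*}\,|S|_{\rm ord}.$$ Moreover, equality $S^*S=|S|_{\rm ord}^{*}|S|_{\rm ord}$ holds if and only if $(S^* )^+S^-=0$ and $(S^* )^-S^+=0$.
   Context: Setting. All spaces are real. $E$ is a Dedekind complete Riesz space with weak order unit $e$. $T:E\to E$ is a conditional expectation operator, i.e. a positive order-continuous linear projection whose range is a Dedekind complete Riesz subspace and which maps weak order units to weak order units; it satisfies $Te=e$ and is strictly positive ($x\ge 0$ and $Tx=0$ imply $x=0$). $E^u$ is the universal completion of $E$, with its $f$-algebra multiplication having unit $e$. $L^1(T)\subseteq E^u$ is the natural domain of $T$: the set of differences $f_1-f_2$ with $f_i\in E^u_+$ such that there is a net $(f_\alpha)$ in $E_+$ with $f_\alpha\uparrow f_i$ in $E^u$ and $(Tf_\alpha)$ bounded above in $E^u$; $T$ is extended to $L^1(T)$ by $Tf_i=\sup_\alpha Tf_\alpha$, and the extension, still denoted $T$, is again a strictly positive conditional expectation on $L^1(T)$ with $Te=e$. $A:=R(T)$ is the range of the (extended) $T$; it is a Dedekind complete unital Archimedean $f$-algebra with unit $e$, and $T(az)=aT(z)$ for $a\in A$ whenever the products are defined. $H:=L^2(T)=\{x\in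 L^1(T):x^2\in L^1(T)\}$ with the inherited order is a Dedekind complete Riesz space and an $A$-module. For $x,y\in H$, $\langle x,y\rangle_T:=T(xy)\in A$ and $\|x\|_{T,2}:=(T(x^2))^{1/2}\in A_+$ (the positive square root in $A$). Definitions. $\mathcal B_T(H)$ is the set of $A$-linear (additive and $A$-homogeneous) maps $S:H\to H$ that are $T$-strongly bounded: there is $k\in A_+$ with $\|Sx\|_{T,2}\le k\|x\|_{T,2}$ for all $x\in H$. For $S\in\mathcal B_T(H)$, the adjoint $S^*$ is the unique operator in $\mathcal B_T(H)$ with $\langle Sx,y\rangle_T=\langle x,S^*y\rangle_T$ for all $x,y\in H$ (it always exists). An operator $S$ on $H$ is order positive ($S\ge_o0$) if $x\ge0$ implies $Sx\ge0$; $R\le_oQ$ means $Q-R\ge_o0$. $\mathcal B_T(H)_+$ is the set of order-positive operators in $\mathcal B_T(H)$, and $\mathcal B_T^r(H):=\mathcal B_T(H)_+-\mathcal B_T(H)_+$ (the $T$-regular operators), with the order $\le_o$. For an order-bounded operator $S$ on $H$, $|S|_{\rm ord}$ is the Riesz--Kantorovich modulus, $|S|_{\rm ord}x=\sup\{|Su|:|u|\le x\}$ for $x\in H_+$, and $S^+=\tfrac12(|S|_{\rm ord}+S)$, $S^-=\tfrac12(|S|_{\rm ord}-S)$ (every $T$-regular operator is order bounded). *)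

theory Defs
  imports "HOL-Analysis.Analysis" "HOL-Library.Lattice_Algebras" "HOL-Library.Lub_Glb"
begin

section \<open>Universally complete Riesz spaces with an \<open>f\<close>-algebra multiplication\<close>

text \<open>
  Dedekind completeness is inherited from \<^class>\<open>conditionally_complete_lattice\<close>. In its presence a
  set has a supremum as soon as it is nonempty and bounded above, so lateral completeness (every
  disjoint set of positive elements has a supremum) reduces to an order bound.
\<close>

class universally_complete_riesz_space =
  lattice_ab_group_add_abs + ordered_real_vector + conditionally_complete_lattice +
  assumes disjoint_bdd_above:
    "(\<And>x. x \<in> D \<Longrightarrow> 0 \<le> x) \<Longrightarrow> (\<And>x y. x \<in> D \<Longrightarrow> y \<in> D \<Longrightarrow> x \<noteq> y \<Longrightarrow> inf x y = 0)
      \<Longrightarrow> bdd_above D"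

text \<open>
  An \<open>f\<close>-algebra with multiplicative unit \<^term>\<open>1\<close>. Commutativity is not assumed, and
  \<^class>\<open>monoid_mult\<close> is used rather than \<^class>\<open>ring_1\<close> so that the zero space is not excluded.
\<close>

class unital_f_algebra = lattice_ring + ordered_real_vector + real_algebra + monoid_mult +
  assumes f_algebra_right: "inf a b = 0 \<Longrightarrow> 0 \<le> c \<Longrightarrow> inf (a * c) b = 0"
    and f_algebra_left: "inf a b = 0 \<Longrightarrow> 0 \<le> c \<Longrightarrow> inf (c * a) b = 0"

class universally_complete_f_algebra = universally_complete_riesz_space + unital_f_algebra


section \<open>Riesz subspaces and conditional expectations\<close>

definition riesz_subspace :: "'u::universally_complete_riesz_space set \<Rightarrow> bool" where
  "riesz_subspace E \<longleftrightarrow> subspace E \<and> (\<forall>x\<in>E. \<forall>y\<in>E. sup x y \<in> E \<and> inf x y \<in> E)"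

text \<open>Completeness of \<open>E\<close> in its own order: the supremum is relative to \<open>E\<close>.\<close>

definition dedekind_complete :: "'u::order set \<Rightarrow> bool" where
  "dedekind_complete E \<longleftrightarrow>
     (\<forall>D. D \<subseteq> E \<longrightarrow> D \<noteq> {} \<longrightarrow> (\<exists>u. isUb E D u) \<longrightarrow> (\<exists>s. isLub E D s))"

text \<open>
  A Riesz space \<open>E\<close> is regarded as a subset of its universal completion, which is the whole type:
  a universally complete Riesz space in which \<open>E\<close> is an order dense Riesz subspace.
\<close>

definition order_dense :: "'u::universally_complete_riesz_space set \<Rightarrow> bool" where
  "order_dense E \<longleftrightarrow> (\<forall>u>0. \<exists>x\<in>E. 0 < x \<and> x \<le> u)"

definition weak_order_unit :: "'u::universally_complete_riesz_space set \<Rightarrow> 'u \<Rightarrow> bool" where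
  "weak_order_unit E w \<longleftrightarrow> w \<in> E \<and> 0 \<le> w \<and> (\<forall>x\<in>E. inf \<bar>x\<bar> w = 0 \<longrightarrow> x = 0)"

text \<open>
  Monotone nets are represented by the directed sets of their values; a directed set is a monotone
  net indexed by itself.
\<close>

definition upward_directed :: "'u::order set \<Rightarrow> bool" where
  "upward_directed D \<longleftrightarrow> D \<noteq> {} \<and> (\<forall>x\<in>D. \<forall>y\<in>D. \<exists>z\<in>D. x \<le> z \<and> y \<le> z)"

definition downward_directed :: "'u::order set \<Rightarrow> bool" where
  "downward_directed D \<longleftrightarrow> D \<noteq> {} \<and> (\<forall>x\<in>D. \<forall>y\<in>D. \<exists>z\<in>D. z \<le> x \<and> z \<le> y)"

definition inf_zero_in :: "'u::{order,zero} set \<Rightarrow> 'u set \<Rightarrow> bool" where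
  "inf_zero_in E D \<longleftrightarrow> 0 \<in> E \<and> (\<forall>x\<in>D. 0 \<le> x) \<and> (\<forall>l\<in>E. (\<forall>x\<in>D. l \<le> x) \<longrightarrow> l \<le> 0)"

text \<open>For positive operators; the infima are taken in \<open>E\<close>.\<close>

definition order_continuous_on ::
    "'u::universally_complete_riesz_space set \<Rightarrow> ('u \<Rightarrow> 'u) \<Rightarrow> bool" where
  "order_continuous_on E T \<longleftrightarrow>
     (\<forall>D. D \<subseteq> E \<longrightarrow> downward_directed D \<longrightarrow> inf_zero_in E D \<longrightarrow> inf_zero_in E (T ` D))"

text \<open>Values of \<open>T\<close> outside \<open>E\<close> are irrelevant here and in everything that follows.\<close>

definition conditional_expectation ::
    "'u::universally_complete_riesz_space set \<Rightarrow> ('u \<Rightarrow> 'u) \<Rightarrow> bool" where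
  "conditional_expectation E T \<longleftrightarrow>
     T \<in> E \<rightarrow> E \<and>
     (\<forall>x\<in>E. \<forall>y\<in>E. T (x + y) = T x + T y) \<and>
     (\<forall>c. \<forall>x\<in>E. T (c *\<^sub>R x) = c *\<^sub>R T x) \<and>
     (\<forall>x\<in>E. 0 \<le> x \<longrightarrow> 0 \<le> T x) \<and>
     order_continuous_on E T \<and>
     (\<forall>x\<in>E. T (T x) = T x) \<and>
     riesz_subspace (T ` E) \<and> dedekind_complete (T ` E) \<and>
     (\<forall>w. weak_order_unit E w \<longrightarrow> weak_order_unit E (T w))"

definition strictly_positive_on ::
    "'u::universally_complete_riesz_space set \<Rightarrow> ('u \<Rightarrow> 'u) \<Rightarrow> bool" where
  "strictly_positive_on E T \<longleftrightarrow> (\<forall>x\<in>E. 0 \<le> x \<longrightarrow> T x = 0 \<longrightarrow> x = 0)"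


section \<open>The natural domain and \<open>L\<^sup>2(T)\<close>\<close>

definition approximates ::
    "'u::universally_complete_riesz_space set \<Rightarrow> ('u \<Rightarrow> 'u) \<Rightarrow> 'u set \<Rightarrow> 'u \<Rightarrow> bool" where
  "approximates E T D f \<longleftrightarrow>
     D \<subseteq> {x \<in> E. 0 \<le> x} \<and> upward_directed D \<and> isLub UNIV D f \<and> bdd_above (T ` D)"

definition L1 :: "'u::universally_complete_riesz_space set \<Rightarrow> ('u \<Rightarrow> 'u) \<Rightarrow> 'u set" where
  "L1 E T = {f1 - f2 | f1 f2. (\<exists>D. approximates E T D f1) \<and> (\<exists>D. approximates E T D f2)}"

text \<open>\<open>T(f1 - f2) = Tf1 - Tf2\<close>; the value depends neither on the decomposition nor on the nets.\<close>

definition cond_ext :: "'u::universally_complete_riesz_space set \<Rightarrow> ('u \<Rightarrow> 'u) \<Rightarrow> 'u \<Rightarrow> 'u" where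
  "cond_ext E T f = (THE t. \<exists>f1 f2 D1 D2. approximates E T D1 f1 \<and> approximates E T D2 f2 \<and>
     f = f1 - f2 \<and> t = Sup (T ` D1) - Sup (T ` D2))"

definition range_alg :: "'u::universally_complete_riesz_space set \<Rightarrow> ('u \<Rightarrow> 'u) \<Rightarrow> 'u set" where
  "range_alg E T = cond_ext E T ` L1 E T"

definition L2 :: "'u::universally_complete_f_algebra set \<Rightarrow> ('u \<Rightarrow> 'u) \<Rightarrow> 'u set" where
  "L2 E T = {x \<in> L1 E T. x\<^sup>2 \<in> L1 E T}"

definition inner_T ::
    "'u::universally_complete_f_algebra set \<Rightarrow> ('u \<Rightarrow> 'u) \<Rightarrow> 'u \<Rightarrow> 'u \<Rightarrow> 'u" where
  "inner_T E T x y = cond_ext E T (x * y)"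

definition norm_T :: "'u::universally_complete_f_algebra set \<Rightarrow> ('u \<Rightarrow> 'u) \<Rightarrow> 'u \<Rightarrow> 'u" where
  "norm_T E T x = (THE r. r \<in> range_alg E T \<and> 0 \<le> r \<and> r\<^sup>2 = cond_ext E T (x\<^sup>2))"


section \<open>Operators on \<open>L\<^sup>2(T)\<close>\<close>

text \<open>
  An operator on \<open>H = L\<^sup>2(T)\<close> is an extensional function \<open>H \<rightarrow>\<^sub>E H\<close>, so that two operators are equal
  iff they agree on \<open>H\<close>.
\<close>

definition bounded_ops ::
    "'u::universally_complete_f_algebra set \<Rightarrow> ('u \<Rightarrow> 'u) \<Rightarrow> ('u \<Rightarrow> 'u) set" where
  "bounded_ops E T = {S \<in> L2 E T \<rightarrow>\<^sub>E L2 E T.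
     (\<forall>x\<in>L2 E T. \<forall>y\<in>L2 E T. S (x + y) = S x + S y) \<and>
     (\<forall>a\<in>range_alg E T. \<forall>x\<in>L2 E T. S (a * x) = a * S x) \<and>
     (\<exists>k\<in>range_alg E T. 0 \<le> k \<and> (\<forall>x\<in>L2 E T. norm_T E T (S x) \<le> k * norm_T E T x))}"

definition adj ::
    "'u::universally_complete_f_algebra set \<Rightarrow> ('u \<Rightarrow> 'u) \<Rightarrow> ('u \<Rightarrow> 'u) \<Rightarrow> 'u \<Rightarrow> 'u" where
  "adj E T S = (THE R. R \<in> bounded_ops E T \<and>
     (\<forall>x\<in>L2 E T. \<forall>y\<in>L2 E T. inner_T E T (S x) y = inner_T E T x (R y)))"

definition order_positive :: "'u::universally_complete_riesz_space set \<Rightarrow> ('u \<Rightarrow> 'u) \<Rightarrow> bool" where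
  "order_positive H S \<longleftrightarrow> (\<forall>x\<in>H. 0 \<le> x \<longrightarrow> 0 \<le> S x)"

definition op_le ::
    "'u::universally_complete_riesz_space set \<Rightarrow> ('u \<Rightarrow> 'u) \<Rightarrow> ('u \<Rightarrow> 'u) \<Rightarrow> bool" where
  "op_le H R Q \<longleftrightarrow> order_positive H (\<lambda>x. Q x - R x)"

definition positive_ops ::
    "'u::universally_complete_f_algebra set \<Rightarrow> ('u \<Rightarrow> 'u) \<Rightarrow> ('u \<Rightarrow> 'u) set" where
  "positive_ops E T = {S \<in> bounded_ops E T. order_positive (L2 E T) S}"

definition regular_ops ::
    "'u::universally_complete_f_algebra set \<Rightarrow> ('u \<Rightarrow> 'u) \<Rightarrow> ('u \<Rightarrow> 'u) set" where
  "regular_ops E T =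
     {\<lambda>x\<in>L2 E T. R x - Q x | R Q. R \<in> positive_ops E T \<and> Q \<in> positive_ops E T}"

definition positive_regular_ops ::
    "'u::universally_complete_f_algebra set \<Rightarrow> ('u \<Rightarrow> 'u) \<Rightarrow> ('u \<Rightarrow> 'u) set" where
  "positive_regular_ops E T = {S \<in> regular_ops E T. order_positive (L2 E T) S}"

text \<open>
  The Riesz--Kantorovich formula gives the modulus on the positive cone, with the supremum taken
  in \<open>H\<close>; it is extended to \<open>H\<close> by \<open>x = x\<^sup>+ - x\<^sup>-\<close>.
\<close>

definition modulus_cone ::
    "'u::universally_complete_riesz_space set \<Rightarrow> ('u \<Rightarrow> 'u) \<Rightarrow> 'u \<Rightarrow> 'u" where
  "modulus_cone H S x = (THE s. isLub H {\<bar>S u\<bar> | u. u \<in> H \<and> \<bar>u\<bar> \<le> x} s)"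

definition op_modulus ::
    "'u::universally_complete_riesz_space set \<Rightarrow> ('u \<Rightarrow> 'u) \<Rightarrow> 'u \<Rightarrow> 'u" where
  "op_modulus H S = (\<lambda>x\<in>H. modulus_cone H S (sup x 0) - modulus_cone H S (sup (- x) 0))"

definition op_pos_part ::
    "'u::universally_complete_riesz_space set \<Rightarrow> ('u \<Rightarrow> 'u) \<Rightarrow> 'u \<Rightarrow> 'u" where
  "op_pos_part H S = (\<lambda>x\<in>H. (1/2) *\<^sub>R (op_modulus H S x + S x))"

definition op_neg_part ::
    "'u::universally_complete_riesz_space set \<Rightarrow> ('u \<Rightarrow> 'u) \<Rightarrow> 'u \<Rightarrow> 'u" where
  "op_neg_part H S = (\<lambda>x\<in>H. (1/2) *\<^sub>R (op_modulus H S x - S x))"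

end

theory Submission
  imports Defs
begin

text \<open>
  Write \<open>S = S\<^sup>+ - S\<^sup>-\<close> and \<open>|S| = S\<^sup>+ + S\<^sup>-\<close>. Once \<open>|S\<^sup>*| = |S|\<^sup>*\<close> is known, \<open>(S\<^sup>*)\<^sup>+\<close> and \<open>(S\<^sup>*)\<^sup>-\<close> are the
  adjoints of \<open>S\<^sup>+\<close> and \<open>S\<^sup>-\<close>, and the identity follows by expanding both products; its right-hand
  side is a sum of two positive operators, which vanishes iff both do.

  The substance is the existence of adjoints. A space that is Dedekind complete and order dense in
  its universal completion is an ideal there, so \<open>T\<close> extends to \<open>L\<^sup>1(T)\<close> with a monotone convergence
  theorem, and lateral completeness gives a Levi property for \<open>L\<^sup>1(T)\<close>. A positive functional
  \<open>x \<mapsto> T(Sx \<cdot> y)\<close> is then represented by a maximal element, found by Zorn's lemma, among the \<open>h\<close> with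
  \<open>T(x h) \<le> T(Sx \<cdot> y)\<close>, in the manner of the Radon--Nikodym theorem.

  Commutativity of the multiplication, the averaging property of \<open>T\<close> and \<open>A\<close>-homogeneity of the
  modulus all come from one fact: two positive band preserving operators that agree at \<open>1\<close> are equal.
\<close>

section \<open>Suprema in lattice-ordered groups\<close>

text \<open>Values of \<open>\<tau>\<close> lie in a partially ordered algebra, so the failure of an
  inequality yields no reverse inequality. Case distinctions are made by multiplying with
  \<open>support (pprt t)\<close>, the component of 1 on which t is positive; it belongs to
  \<open>A\<close> whenever t does, and then passes through \<open>\<tau>\<close> and every A-linear
  map. Elements of \<open>L\<close> and \<open>A\<close> need not lie below multiples of 1.
  Identities are therefore proved for bounded elements first and carried over along the truncations
  \<open>inf z (real n *\<^sub>R 1)\<close>, which calls for order continuity of each map involved.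
  For the functional x \<mapsto> T(Sx y) this continuity is a consequence of T-strong boundedness;
  the same bound keeps the suprema formed in the Zorn argument inside \<open>H\<close>.\<close>

abbreviation has_sup :: "'a::order set \<Rightarrow> 'a \<Rightarrow> bool" where
  "has_sup \<equiv> isLub UNIV"

lemma has_sup_iff: "has_sup D s \<longleftrightarrow> (\<forall>x\<in>D. x \<le> s) \<and> (\<forall>z. (\<forall>x\<in>D. x \<le> z) \<longrightarrow> s \<le> z)"
  by (auto simp: isLub_def leastP_def isUb_def setle_def setge_def)

lemma has_supI: "(\<And>x. x \<in> D \<Longrightarrow> x \<le> s) \<Longrightarrow> (\<And>z. (\<And>x. x \<in> D \<Longrightarrow> x \<le> z) \<Longrightarrow> s \<le> z) \<Longrightarrow> has_sup D s"
  by (auto simp: has_sup_iff)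

lemma has_sup_upper: "has_sup D s \<Longrightarrow> x \<in> D \<Longrightarrow> x \<le> s"
  by (auto simp: has_sup_iff)

lemma has_sup_least: "has_sup D s \<Longrightarrow> (\<And>x. x \<in> D \<Longrightarrow> x \<le> z) \<Longrightarrow> s \<le> z"
  by (auto simp: has_sup_iff)

lemma has_sup_unique: "has_sup D s \<Longrightarrow> has_sup D t \<Longrightarrow> s = t"
  by (meson has_sup_least has_sup_upper order_antisym)

lemma has_sup_Sup:
  fixes D :: "'a::conditionally_complete_lattice set"
  assumes "D \<noteq> {}" "\<And>x. x \<in> D \<Longrightarrow> x \<le> b"
  shows "has_sup D (Sup D)"
  using assms by (intro has_supI cSup_upper cSup_least) (auto simp: bdd_above_def)

lemma has_sup_diff:
  fixes s :: "'a::ordered_ab_group_add"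
  assumes "has_sup D s" "\<And>x. x \<in> D \<Longrightarrow> l \<le> s - x"
  shows "l \<le> 0"
proof -
  have "s \<le> s - l"
    using assms by (intro has_sup_least[OF assms(1)]) (auto simp: algebra_simps)
  then show ?thesis by (simp add: algebra_simps)
qed

text \<open>Together with the preceding lemma this reads a supremum as \<open>s - D\<close>
  decreasing to 0. In applications the lower bound \<open>l\<close> is replaced by
  \<open>pprt l\<close>, with which inequalities may be multiplied.\<close>

lemma has_sup_diffI:
  fixes s :: "'a::ordered_ab_group_add"
  assumes "\<And>x. x \<in> D \<Longrightarrow> x \<le> s" "\<And>l. (\<And>x. x \<in> D \<Longrightarrow> l \<le> s - x) \<Longrightarrow> l \<le> 0"
  shows "has_sup D s"
proof (rule has_supI)
  fix z assume z: "\<And>x. x \<in> D \<Longrightarrow> x \<le> z"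
  have "s - z \<le> 0" by (rule assms(2)) (use z in \<open>auto simp: algebra_simps\<close>)
  then show "s \<le> z" by simp
qed (use assms in auto)

text \<open>Infinite distributivity comes from \<open>x + d = sup d x + inf d x\<close>: it
  expresses x through \<open>inf d x\<close> and a term bounded by \<open>sup d s\<close>.\<close>

lemma has_sup_inf:
  fixes s :: "'a::lattice_ab_group_add"
  assumes "has_sup D s"
  shows "has_sup (inf d ` D) (inf d s)"
proof (rule has_supI)
  fix z assume z: "\<And>x. x \<in> inf d ` D \<Longrightarrow> x \<le> z"
  have "s \<le> z - d + sup d s"
  proof (rule has_sup_least[OF assms])
    fix x assume x: "x \<in> D"
    have "x + d = sup d x + inf d x" using add_eq_inf_sup[of d x] by (simp add: add.commute)
    also have "\<dots> \<le> sup d s + z"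
      using z x has_sup_upper[OF assms x] by (intro add_mono sup_mono) auto
    finally show "x \<le> z - d + sup d s" by (simp add: algebra_simps)
  qed
  then show "inf d s \<le> z" using add_eq_inf_sup[of d s] by (simp add: algebra_simps)
qed (use has_sup_upper[OF assms] in \<open>auto intro: le_infI2\<close>)

lemma has_sup_add_sets:
  fixes s t :: "'a::ordered_ab_group_add"
  assumes "has_sup C s" "has_sup D t"
  shows "has_sup {x + y | x y. x \<in> C \<and> y \<in> D} (s + t)"
proof (rule has_supI)
  fix z assume z: "\<And>x. x \<in> {x + y | x y. x \<in> C \<and> y \<in> D} \<Longrightarrow> x \<le> z"
  have "s \<le> z - t"
  proof (rule has_sup_least[OF assms(1)])
    fix x assume x: "x \<in> C"
    have "t \<le> z - x"
      by (rule has_sup_least[OF assms(2)]) (use x z in \<open>fastforce simp: algebra_simps\<close>)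
    then show "x \<le> z - t" by (simp add: algebra_simps)
  qed
  then show "s + t \<le> z" by (simp add: algebra_simps)
qed (use assms has_sup_upper in \<open>auto intro!: add_mono\<close>)

lemma has_sup_scaleR:
  fixes s :: "'a::ordered_real_vector"
  assumes "has_sup D s" "0 < c"
  shows "has_sup ((*\<^sub>R) c ` D) (c *\<^sub>R s)"
proof (rule has_supI)
  fix z assume z: "\<And>x. x \<in> (*\<^sub>R) c ` D \<Longrightarrow> x \<le> z"
  have "s \<le> z /\<^sub>R c"
    using z \<open>0 < c\<close> by (intro has_sup_least[OF assms(1)]) (auto simp: pos_le_divideR_eq)
  then show "c *\<^sub>R s \<le> z" using \<open>0 < c\<close> by (simp add: pos_le_divideR_eq)
qed (use assms has_sup_upper in \<open>auto intro!: scaleR_left_mono\<close>)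

section \<open>Positive parts, disjointness, decomposition and the Archimedean property\<close>

lemma pprt_minus_pprt: "(x::'a::lattice_ab_group_add) = pprt x - pprt (- x)"
  using prts[of x] by (simp add: pprt_neg)

lemma abs_eq_pprt_add: "\<bar>x::'a::lattice_ab_group_add_abs\<bar> = pprt x + pprt (- x)"
  by (simp add: abs_prts pprt_neg)

lemma inf_pprt_pprt: "inf (pprt x) (pprt (- x)) = (0::'a::lattice_ab_group_add)"
proof -
  have "inf (pprt x) (pprt (- x)) = pprt (-x) + inf (pprt x - pprt (- x)) 0"
    by (simp add: add_inf_distrib_left)
  also have "\<dots> = pprt (-x) + nprt x" using pprt_minus_pprt[of x] by (simp add: nprt_def)
  finally show ?thesis by (simp add: pprt_neg)
qed

lemma le_pprt: "(x::'a::lattice_ab_group_add) \<le> pprt x"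
  by (simp add: pprt_def)

lemma pprt_leI: "(x::'a::lattice_ab_group_add) \<le> y \<Longrightarrow> 0 \<le> y \<Longrightarrow> pprt x \<le> y"
  by (simp add: pprt_def)

lemma diff_inf_eq_pprt: "(x::'a::lattice_ab_group_add) - inf x y = pprt (x - y)"
  by (simp add: pprt_def diff_inf_eq_sup add_sup_distrib_left sup_commute)

lemma pprt_le_abs: "pprt (x::'a::lattice_ab_group_add_abs) \<le> \<bar>x\<bar>" "pprt (- x) \<le> \<bar>x\<bar>"
  by (simp_all add: abs_eq_pprt_add)

lemma inf_add_eq_zero:
  fixes a b r :: "'a::lattice_ab_group_add"
  assumes "inf a r = 0" "inf b r = 0"
  shows "inf (a + b) r = 0"
proof (rule antisym)
  have pos: "0 \<le> a" "0 \<le> b" "0 \<le> r" using assms by (metis inf.cobounded1 inf.cobounded2)+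
  let ?z = "inf (a + b) r"
  have "?z - b \<le> a" by (metis diff_le_eq inf.cobounded1)
  moreover have "?z - b \<le> r" using pos
    by (metis add_increasing2 diff_le_eq inf.cobounded2)
  ultimately have "?z \<le> b" using assms(1) by (metis diff_le_0_iff_le inf.bounded_iff)
  then show "?z \<le> 0" using assms(2) by (metis inf.bounded_iff inf.cobounded2)
  show "0 \<le> ?z" using pos by simp
qed

lemma inf_eq_zero_mono:
  fixes a b c d :: "'a::{lattice_ab_group_add}"
  assumes "inf b d = 0" "0 \<le> a" "a \<le> b" "0 \<le> c" "c \<le> d"
  shows "inf a c = 0"
  using assms by (metis inf.bounded_iff inf_mono order_antisym)

lemma riesz_decomposition:
  fixes d x y :: "'a::lattice_ab_group_add"
  assumes "0 \<le> d" "d \<le> x + y" "0 \<le> x" "0 \<le> y"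
  obtains d1 d2 where "d = d1 + d2" "0 \<le> d1" "d1 \<le> x" "d1 \<le> d" "0 \<le> d2" "d2 \<le> y" "d2 \<le> d"
proof
  show "d = inf d x + (d - inf d x)" by (simp only: add_diff_eq add_diff_cancel_left')
  show "d - inf d x \<le> y" unfolding diff_inf_eq_pprt
    using assms by (intro pprt_leI) (simp_all add: algebra_simps)
  have "0 \<le> inf d x" using assms by simp
  then show "0 \<le> inf d x" "d - inf d x \<le> d" by (simp_all only: diff_le_eq le_add_same_cancel1)
  show "0 \<le> d - inf d x" by (simp only: diff_inf_eq_pprt zero_le_pprt)
qed simp_all

lemma riesz_decomposition_abs:
  fixes u x y :: "'a::lattice_ab_group_add_abs"
  assumes "\<bar>u\<bar> \<le> x + y" "0 \<le> x" "0 \<le> y"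
  obtains u1 u2 where "u = u1 + u2" "\<bar>u1\<bar> \<le> x" "\<bar>u2\<bar> \<le> y"
proof
  \<comment> \<open>\<open>u\<close> clipped to the interval from \<open>- x\<close> to
    \<open>x\<close>; the remainder equals \<open>inf (u + x) (pprt (u - x))\<close>, from which
    both bounds by \<open>y\<close> are read off.\<close>
  let ?v = "sup (- x) (inf u x)"
  have u: "u \<le> x + y" "- u \<le> x + y" using assms by (auto simp: abs_le_iff)
  show "u = ?v + (u - ?v)" by (simp only: add_diff_eq add_diff_cancel_left')
  have "- x \<le> ?v" "?v \<le> x" using assms(2) order_trans[of "- x" 0 x] by (auto)
  then show "\<bar>?v\<bar> \<le> x" by (simp add: abs_le_iff minus_le_iff)
  have e: "u - ?v = inf (u + x) (pprt (u - x))"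
    by (simp only: diff_sup_eq_inf minus_minus add_inf_distrib_left add_uminus_conv_diff diff_inf_eq_pprt)
  have "- (u + x) \<le> y" using u by (simp add: algebra_simps)
  then have "- y \<le> u + x" by (metis minus_le_iff)
  moreover have "- y \<le> pprt (u - x)" using assms(3)
    by (meson dual_order.trans neg_le_0_iff_le zero_le_pprt)
  ultimately have "- y \<le> u - ?v" unfolding e by simp
  moreover have "u - ?v \<le> y" unfolding e
    by (rule le_infI2) (use u assms in \<open>auto intro!: pprt_leI simp: algebra_simps\<close>)
  ultimately show "\<bar>u - ?v\<bar> \<le> y" by (metis abs_leI minus_le_iff)
qed

text \<open>The supremum of all multiples of \<open>x\<close> still dominates them after
  \<open>x\<close> is subtracted, because each multiple has a successor.\<close>

lemma archimedean:
  fixes x y :: "'a::{conditionally_complete_lattice, ordered_real_vector}"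
  assumes "\<And>n::nat. real n *\<^sub>R x \<le> y"
  shows "x \<le> 0"
proof -
  let ?D = "range (\<lambda>n::nat. real n *\<^sub>R x)"
  have s: "has_sup ?D (Sup ?D)" by (rule has_sup_Sup[of _ y]) (use assms in auto)
  show ?thesis
  proof (rule has_sup_diff[OF s])
    fix z assume "z \<in> ?D"
    then obtain n :: nat where z: "z = real n *\<^sub>R x" by auto
    have "real (Suc n) *\<^sub>R x \<le> Sup ?D" by (rule has_sup_upper[OF s rangeI])
    then show "x \<le> Sup ?D - z" by (simp add: z algebra_simps)
  qed
qed

lemma archimedean_eps:
  fixes x y :: "'a::{conditionally_complete_lattice, ordered_real_vector}"
  assumes "\<And>e. 0 < e \<Longrightarrow> x \<le> e *\<^sub>R y" "0 \<le> y"
  shows "x \<le> 0"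
proof (rule archimedean[of _ y])
  fix n :: nat
  show "real n *\<^sub>R x \<le> y"
  proof (cases "n = 0")
    case False
    then have "x \<le> (1 / real n) *\<^sub>R y" by (intro assms) auto
    then have "real n *\<^sub>R x \<le> real n *\<^sub>R ((1 / real n) *\<^sub>R y)" by (intro scaleR_left_mono) auto
    then show ?thesis using False by simp
  qed (use assms(2) in simp)
qed

lemma scaleR_sup:
  fixes x y :: "'a::{lattice, ordered_real_vector}"
  assumes "0 < c"
  shows "c *\<^sub>R sup x y = sup (c *\<^sub>R x) (c *\<^sub>R y)"
proof (rule antisym)
  have "x \<le> sup (c *\<^sub>R x) (c *\<^sub>R y) /\<^sub>R c" "y \<le> sup (c *\<^sub>R x) (c *\<^sub>R y) /\<^sub>R c"
    using assms by (simp_all add: pos_le_divideR_eq)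
  then have "sup x y \<le> sup (c *\<^sub>R x) (c *\<^sub>R y) /\<^sub>R c" by simp
  then show "c *\<^sub>R sup x y \<le> sup (c *\<^sub>R x) (c *\<^sub>R y)" by (simp only: pos_le_divideR_eq[OF assms])
qed (use assms in \<open>auto intro!: scaleR_left_mono\<close>)

lemma abs_scaleR_lattice:
  fixes x :: "'a::{lattice_ab_group_add_abs, ordered_real_vector}"
  shows "\<bar>c *\<^sub>R x\<bar> = \<bar>c\<bar> *\<^sub>R \<bar>x\<bar>"
proof -
  have pos: "\<bar>c *\<^sub>R x\<bar> = c *\<^sub>R \<bar>x\<bar>" if "0 < c" for c and x :: 'a
    using that by (simp add: abs_lattice scaleR_sup)
  consider "0 < c" | "c = 0" | "0 < - c" by linarith
  then show ?thesis
  proof cases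
    case 3
    then show ?thesis using pos[OF 3, of x] by simp
  qed (use pos in auto)
qed

section \<open>Unital f-algebras\<close>

text \<open>The two f-algebra axioms are applied in turn, multiplying by \<open>b\<close> on the
  right and then by \<open>a\<close> on the left, until both entries of the infimum are
  \<open>a * b\<close>.\<close>

lemma disjoint_mult_zero:
  fixes a b :: "'a::unital_f_algebra"
  assumes "inf a b = 0"
  shows "a * b = 0"
proof -
  have pos: "0 \<le> a" "0 \<le> b" using assms by (metis inf.cobounded1 inf.cobounded2)+
  have "inf (a * b) b = 0" by (rule f_algebra_right[OF assms pos(2)])
  then have "inf b (a * b) = 0" by (simp add: inf_commute)
  then have "inf (a * b) (a * b) = 0" by (rule f_algebra_left[OF _ pos(1)])
  then show ?thesis by simp
qed

lemma pprt_mult_pprt_minus: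
  fixes x :: "'a::unital_f_algebra"
  shows "pprt x * pprt (- x) = 0" "pprt (- x) * pprt x = 0"
  using disjoint_mult_zero inf_pprt_pprt by (metis inf_commute)+

lemma mult_self_eq_pprt:
  fixes x :: "'a::unital_f_algebra"
  shows "x * x = pprt x * pprt x + pprt (- x) * pprt (- x)"
proof -
  have "x * x = (pprt x - pprt (- x)) * (pprt x - pprt (- x))"
    using pprt_minus_pprt[of x] by simp
  then show ?thesis by (simp add: algebra_simps pprt_mult_pprt_minus)
qed

lemma mult_self_nonneg: "0 \<le> (x::'a::unital_f_algebra) * x"
  unfolding mult_self_eq_pprt[of x] by (intro add_nonneg_nonneg mult_nonneg_nonneg) auto

lemma abs_mult_self_f: "\<bar>x\<bar> * \<bar>x\<bar> = (x::'a::unital_f_algebra) * x"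
  unfolding mult_self_eq_pprt[of x] abs_eq_pprt_add
  by (simp add: algebra_simps pprt_mult_pprt_minus)

lemma f_one_nonneg: "0 \<le> (1::'a::unital_f_algebra)"
  using mult_self_nonneg[of 1] by simp

text \<open>When the square of x vanishes, expanding the nonnegative square of
  \<open>n |x| - 1\<close> leaves \<open>2 n |x| \<le> 1\<close> for every n.\<close>

lemma mult_self_eq_0_imp:
  fixes x :: "'a::universally_complete_f_algebra"
  assumes "x * x = 0"
  shows "x = 0"
proof -
  have "\<bar>x\<bar> \<le> 0"
  proof (rule archimedean)
    fix n :: nat
    have e: "\<bar>x\<bar> * \<bar>x\<bar> = 0" using assms by (simp add: abs_mult_self_f)
    have "0 \<le> (real n *\<^sub>R \<bar>x\<bar> - 1) * (real n *\<^sub>R \<bar>x\<bar> - 1)" by (rule mult_self_nonneg)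
    also have "\<dots> = 1 - (2 * real n) *\<^sub>R \<bar>x\<bar>"
      by (simp add: algebra_simps e) (simp flip: scaleR_2 mult_2)
    finally have "(2 * real n) *\<^sub>R \<bar>x\<bar> \<le> 1" by simp
    moreover have "real n *\<^sub>R \<bar>x\<bar> \<le> (2 * real n) *\<^sub>R \<bar>x\<bar>" by (rule scaleR_right_mono) auto
    ultimately show "real n *\<^sub>R \<bar>x\<bar> \<le> 1" by order
  qed
  then show ?thesis by simp
qed

section \<open>Agreement of positive band preserving operators\<close>

lemma abs_additive_le:
  fixes F :: "'a::lattice_ab_group_add_abs \<Rightarrow> 'b::lattice_ab_group_add_abs"
  assumes V: "y \<in> V" "pprt y \<in> V" "pprt (- y) \<in> V"
    and add: "\<And>x y. x \<in> V \<Longrightarrow> y \<in> V \<Longrightarrow> F (x + y) = F x + F y"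
    and pos: "\<And>x. x \<in> V \<Longrightarrow> 0 \<le> x \<Longrightarrow> 0 \<le> F x"
  shows "\<bar>F y\<bar> \<le> F \<bar>y\<bar>"
proof -
  have p: "0 \<le> F (pprt y)" "0 \<le> F (pprt (- y))" using V pos by auto
  have "F (pprt y) = F y + F (pprt (- y))"
    using add[OF V(1,3)] pprt_minus_pprt[of y] by (metis diff_add_cancel)
  then have "F y = F (pprt y) - F (pprt (- y))" by simp
  moreover have "F \<bar>y\<bar> = F (pprt y) + F (pprt (- y))"
    using add[OF V(2,3)] by (simp add: abs_eq_pprt_add)
  ultimately show ?thesis using p by (simp add: abs_le_iff add_increasing2 diff_le_eq add.assoc)
qed

lemma riesz_subspaceD:
  assumes "riesz_subspace V"
  shows "0 \<in> V" "x \<in> V \<Longrightarrow> y \<in> V \<Longrightarrow> x + y \<in> V" "x \<in> V \<Longrightarrow> y \<in> V \<Longrightarrow> x - y \<in> V"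
    "x \<in> V \<Longrightarrow> c *\<^sub>R x \<in> V" "x \<in> V \<Longrightarrow> - x \<in> V" "x \<in> V \<Longrightarrow> y \<in> V \<Longrightarrow> sup x y \<in> V"
    "x \<in> V \<Longrightarrow> y \<in> V \<Longrightarrow> inf x y \<in> V" "x \<in> V \<Longrightarrow> pprt x \<in> V" "x \<in> V \<Longrightarrow> \<bar>x\<bar> \<in> V"
  using assms unfolding riesz_subspace_def pprt_def abs_lattice
  by (auto intro: subspace_0 subspace_add subspace_diff subspace_scale subspace_neg)

text \<open>Values may leave \<open>V\<close>; disjointness is tested only against elements of
  \<open>V\<close>. For \<open>V = A\<close> this admits
  \<open>\<lambda>a. op_modulus H S (a * x)\<close>, whose values lie in \<open>H\<close>.\<close>

definition local_operator :: "'a::universally_complete_f_algebra set \<Rightarrow> ('a \<Rightarrow> 'a) \<Rightarrow> bool" where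
  "local_operator V F \<longleftrightarrow>
     (\<forall>x\<in>V. \<forall>y\<in>V. F (x + y) = F x + F y) \<and> (\<forall>c. \<forall>x\<in>V. F (c *\<^sub>R x) = c *\<^sub>R F x) \<and>
     (\<forall>x\<in>V. 0 \<le> x \<longrightarrow> 0 \<le> F x) \<and> (\<forall>x\<in>V. \<forall>y\<in>V. inf x y = 0 \<longrightarrow> inf (F x) y = 0)"

text \<open>Let \<open>D = F - G\<close>. Since \<open>D\<close> vanishes on constants, \<open>|D x| \<le> (F + G) |x - l 1|\<close> for every real
  \<open>l\<close>; so by locality the part of \<open>|D x|\<close> exceeding \<open>e (F + G) 1\<close> lives where \<open>|x - l 1| \<ge> e\<close>.
  As \<open>l\<close> runs through the multiples of \<open>e\<close>, this forces it to live where \<open>x\<close> is infinite.\<close>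

lemma local_operators_agree_nonneg:
  fixes x :: "'a::universally_complete_f_algebra"
  assumes V: "riesz_subspace V" "1 \<in> V"
    and F: "local_operator V F" and G: "local_operator V G" and one: "F 1 = G 1"
    and x: "x \<in> V" "0 \<le> x"
  shows "F x = G x"
proof -
  note V' = riesz_subspaceD[OF V(1)]
  let ?c = "F 1 + G 1"
  have add: "F (y + z) = F y + F z" "G (y + z) = G y + G z" if "y \<in> V" "z \<in> V" for y z
    using F G that by (auto simp: local_operator_def)
  have scale: "F (c *\<^sub>R y) = c *\<^sub>R F y" "G (c *\<^sub>R y) = c *\<^sub>R G y" if "y \<in> V" for y c
    using F G that by (auto simp: local_operator_def)
  have pos: "0 \<le> F y" "0 \<le> G y" if "y \<in> V" "0 \<le> y" for y
    using F G that by (auto simp: local_operator_def)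
  have loc: "inf (F y + G y) z = 0" if "y \<in> V" "z \<in> V" "inf y z = 0" for y z
    using F G that by (auto simp: local_operator_def intro!: inf_add_eq_zero)
  have mono: "F y \<le> F z" "G y \<le> G z" if "y \<in> V" "z \<in> V" "y \<le> z" for y z
    using pos[of "z - y"] add[of y "z - y"] that V' by auto
  have c0: "0 \<le> ?c" using pos[OF V(2) f_one_nonneg] by simp
  have est: "\<bar>F x - G x\<bar> \<le> e *\<^sub>R ?c" if e: "0 < e" for e
  proof -
    define w where "w = pprt (\<bar>F x - G x\<bar> - e *\<^sub>R ?c)"
    have w0: "0 \<le> w" by (simp add: w_def)
    have disj: "inf w (pprt (e *\<^sub>R 1 - \<bar>x - l *\<^sub>R 1\<bar>)) = 0" for l
    proof -
      let ?y = "x - l *\<^sub>R 1" and ?t = "\<bar>x - l *\<^sub>R 1\<bar>" and ?s = "pprt (\<bar>x - l *\<^sub>R 1\<bar> - e *\<^sub>R 1)"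
      have inV: "?y \<in> V" "?t \<in> V" "?s \<in> V" "e *\<^sub>R 1 \<in> V" "l *\<^sub>R 1 \<in> V"
        using x V V' by auto
      have "F x = F ?y + F (l *\<^sub>R 1)" "G x = G ?y + G (l *\<^sub>R 1)"
        using add[OF inV(1,5)] by simp_all
      then have "F x - G x = F ?y - G ?y" using V one by (simp add: scale)
      also have "\<bar>\<dots>\<bar> \<le> \<bar>F ?y\<bar> + \<bar>G ?y\<bar>" by (rule abs_triangle_ineq4)
      also have "\<dots> \<le> F ?t + G ?t"
        by (intro add_mono abs_additive_le[where V = V]) (use inV V' V'(8)[OF V'(3)[OF inV(5) x(1)]] add pos in auto)
      also have "\<dots> \<le> F (e *\<^sub>R 1 + ?s) + G (e *\<^sub>R 1 + ?s)"
      proof -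
        have "?t \<le> e *\<^sub>R 1 + ?s" using le_pprt[of "?t - e *\<^sub>R 1"] by (simp add: algebra_simps)
        then show ?thesis using inV V' by (intro add_mono mono) auto
      qed
      also have "\<dots> = e *\<^sub>R ?c + (F ?s + G ?s)"
        using inV V by (simp add: add scale algebra_simps)
      finally have "\<bar>F x - G x\<bar> - e *\<^sub>R ?c \<le> F ?s + G ?s" by (simp add: algebra_simps)
      then have w: "w \<le> F ?s + G ?s" unfolding w_def
        using pos[OF inV(3)] by (intro pprt_leI add_nonneg_nonneg) auto
      have "inf ?s (pprt (e *\<^sub>R 1 - ?t)) = 0"
        using inf_pprt_pprt[of "?t - e *\<^sub>R 1"] by simp
      then have "inf (F ?s + G ?s) (pprt (e *\<^sub>R 1 - ?t)) = 0"
        using inV V' by (intro loc) auto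
      then show ?thesis by (rule inf_eq_zero_mono) (use w w0 in auto)
    qed
    \<comment> \<open>Induction in steps of \<open>e\<close>: where x lies below (n + 1) e, it is
      within \<open>e\<close> of n e or below n e, and \<open>w\<close> is disjoint from both
      parts.\<close>
    have far: "inf w (pprt ((real n * e) *\<^sub>R 1 - x)) = 0" for n
    proof (induction n)
      case 0
      then show ?case using x(2) w0 by (simp add: inf_absorb2)
    next
      case (Suc n)
      let ?l = "(real n * e) *\<^sub>R (1::'a)"
      let ?y = "x - ?l"
      let ?b = "pprt (e *\<^sub>R 1 - \<bar>?y\<bar>) + (pprt (?l - x) + pprt (?l - x))"
      have "inf ?b w = 0"
        using disj[of "real n * e"] Suc by (intro inf_add_eq_zero) (simp_all add: inf_commute)
      moreover have "pprt ((real (Suc n) * e) *\<^sub>R 1 - x) \<le> ?b"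
      proof (rule pprt_leI)
        have "(real (Suc n) * e) *\<^sub>R 1 - x = (e *\<^sub>R 1 - \<bar>?y\<bar>) + (\<bar>?y\<bar> - ?y)"
          by (simp add: algebra_simps)
        also have "\<bar>?y\<bar> - ?y = pprt (?l - x) + pprt (?l - x)"
          using pprt_minus_pprt[of ?y] by (simp add: abs_eq_pprt_add algebra_simps)
        also have "e *\<^sub>R 1 - \<bar>?y\<bar> \<le> pprt (e *\<^sub>R 1 - \<bar>?y\<bar>)" by (rule le_pprt)
        finally show "(real (Suc n) * e) *\<^sub>R 1 - x \<le> ?b" by simp
      qed (intro add_nonneg_nonneg zero_le_pprt)
      ultimately have "inf (pprt ((real (Suc n) * e) *\<^sub>R 1 - x)) w = 0"
        by (rule inf_eq_zero_mono[OF _ zero_le_pprt _ w0 order_refl])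
      then show ?case by (simp only: inf_commute)
    qed
    \<comment> \<open>Disjointness from the positive part of n e - x gives n e w \<le> w x for all
      n, so \<open>w * x\<close> serves as the Archimedean bound.\<close>
    have "e *\<^sub>R w \<le> 0"
    proof (rule archimedean)
      fix n :: nat
      have "(real n * e) *\<^sub>R w - w * x = w * ((real n * e) *\<^sub>R 1 - x)" by (simp add: algebra_simps)
      also have "\<dots> \<le> w * pprt ((real n * e) *\<^sub>R 1 - x)"
        using w0 le_pprt by (intro mult_left_mono)
      also have "\<dots> = 0" using far by (rule disjoint_mult_zero)
      finally show "real n *\<^sub>R e *\<^sub>R w \<le> w * x" by simp
    qed
    then have "w \<le> 0" using e by (simp add: scaleR_le_0_iff)
    then show ?thesis unfolding w_def using le_pprt order_trans by fastforce
  qed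
  have "\<bar>F x - G x\<bar> \<le> 0" using est c0 by (rule archimedean_eps)
  then show ?thesis by simp
qed

lemma local_operators_agree:
  fixes x :: "'a::universally_complete_f_algebra"
  assumes V: "riesz_subspace V" "1 \<in> V"
    and F: "local_operator V F" and G: "local_operator V G" and one: "F 1 = G 1"
    and x: "x \<in> V"
  shows "F x = G x"
proof -
  note V' = riesz_subspaceD[OF V(1)]
  have e: "F (pprt x) = G (pprt x)" "F (pprt (- x)) = G (pprt (- x))"
    by (intro local_operators_agree_nonneg[OF V F G one]; use x V' in auto)+
  have "H (pprt x) = H x + H (pprt (- x))" if H: "local_operator V H" for H
  proof -
    have "H (x + pprt (- x)) = H x + H (pprt (- x))"
      using H x V' by (auto simp: local_operator_def)
    then show ?thesis using pprt_minus_pprt[of x] by (metis diff_add_cancel)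
  qed
  from this[OF F] this[OF G] show ?thesis using e by simp
qed

section \<open>Commutativity, order continuity of multiplication, and truncations\<close>

lemma f_algebra_commute: "a * b = b * (a::'a::universally_complete_f_algebra)"
proof -
  have R: "riesz_subspace (UNIV :: 'a set)" by (simp add: riesz_subspace_def)
  have pos: "a * b = b * a" if "0 \<le> a" for a :: 'a
  proof (rule local_operators_agree[OF R, where F = "\<lambda>b. a * b" and G = "\<lambda>b. b * a"])
    show "local_operator UNIV (\<lambda>b. a * b)" "local_operator UNIV (\<lambda>b. b * a)"
      using that by (auto simp: local_operator_def algebra_simps f_algebra_left f_algebra_right)
  qed auto
  have "a * b = (pprt a - pprt (- a)) * b" using pprt_minus_pprt[of a] by simp
  also have "\<dots> = b * (pprt a - pprt (- a))" by (simp add: algebra_simps pos)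
  finally show ?thesis using pprt_minus_pprt[of a] by simp
qed

instance universally_complete_f_algebra \<subseteq> comm_ring
  by standard (auto simp: f_algebra_commute algebra_simps)

instance universally_complete_f_algebra \<subseteq> comm_monoid_mult
  by standard auto

text \<open>Since \<open>a\<close> may be unbounded, the argument is localized by \<open>q\<close>,
  the positive part of n - a. There \<open>a\<close> is bounded, so \<open>q * w\<close> lies below
  a fixed multiple of every \<open>s - x\<close> and is at most 0. This leaves n w \<le> a w for all
  n.\<close>

lemma has_sup_mult:
  fixes a :: "'a::universally_complete_f_algebra"
  assumes s: "has_sup D s" and a: "0 \<le> a"
  shows "has_sup ((*) a ` D) (a * s)"
proof (rule has_sup_diffI)
  fix l assume l: "\<And>y. y \<in> (*) a ` D \<Longrightarrow> l \<le> a * s - y"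
  define w where "w = pprt l"
  have w0: "0 \<le> w" by (simp add: w_def)
  have w: "w \<le> a * (s - x)" if "x \<in> D" for x
    unfolding w_def using l[OF imageI[OF that]] has_sup_upper[OF s that] a
    by (intro pprt_leI mult_nonneg_nonneg) (auto simp: algebra_simps)
  have "w \<le> 0"
  proof (rule archimedean)
    fix n :: nat
    define q where "q = pprt (real n *\<^sub>R 1 - a)"
    have q0: "0 \<le> q" by (simp add: q_def)
    have qn: "q \<le> real n *\<^sub>R 1"
      unfolding q_def using a f_one_nonneg by (intro pprt_leI) (auto intro: scaleR_nonneg_nonneg)
    have "q * pprt (a - real n *\<^sub>R 1) = 0"
      using pprt_mult_pprt_minus(1)[of "real n *\<^sub>R 1 - a"] by (simp add: q_def)
    then have "q * (real n *\<^sub>R 1 - a) = q * q"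
      using pprt_minus_pprt[of "real n *\<^sub>R 1 - a"] by (metis diff_zero minus_diff_eq q_def right_diff_distrib)
    then have qa: "q * a = real n *\<^sub>R q - q * q" by (simp add: algebra_simps)
    also have "\<dots> \<le> real n *\<^sub>R q" by (simp add: mult_self_nonneg)
    also have "\<dots> \<le> real n *\<^sub>R real n *\<^sub>R 1" using qn by (intro scaleR_left_mono) auto
    \<comment> \<open>The added 1 keeps the scalar positive at n = 0, as
      \<open>has_sup_scaleR\<close> requires.\<close>
    also have "\<dots> \<le> (real n * real n + 1) *\<^sub>R 1"
      unfolding scaleR_scaleR by (rule scaleR_right_mono) (auto intro: f_one_nonneg)
    finally have qa: "q * a \<le> (real n * real n + 1) *\<^sub>R 1" .
    have "q * w \<le> 0"
    proof (rule has_sup_diff[OF has_sup_scaleR[OF s]])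
      show "0 < real n * real n + 1" by (simp add: add_nonneg_pos)
      fix y assume "y \<in> (*\<^sub>R) (real n * real n + 1) ` D"
      then obtain x where x: "x \<in> D" "y = (real n * real n + 1) *\<^sub>R x" by auto
      have "q * w \<le> q * (a * (s - x))" using w[OF x(1)] q0 by (rule mult_left_mono)
      also have "\<dots> = (q * a) * (s - x)" by (simp add: mult.assoc)
      also have "\<dots> \<le> ((real n * real n + 1) *\<^sub>R 1) * (s - x)"
        using qa has_sup_upper[OF s x(1)] by (intro mult_right_mono) auto
      finally show "q * w \<le> (real n * real n + 1) *\<^sub>R s - y" by (simp add: x algebra_simps)
    qed
    moreover have "(real n *\<^sub>R 1 - a) * w \<le> q * w"
      unfolding q_def by (intro mult_right_mono le_pprt w0)
    ultimately have "(real n *\<^sub>R 1 - a) * w \<le> 0" by order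
    then show "real n *\<^sub>R w \<le> a * w" by (simp add: algebra_simps)
  qed
  then show "l \<le> 0" unfolding w_def using le_pprt order_trans by blast
qed (use has_sup_upper[OF s] a in \<open>auto intro: mult_left_mono\<close>)

lemma has_sup_mult_self_le:
  fixes s :: "'a::universally_complete_f_algebra"
  assumes s: "has_sup D s" "0 \<le> s" and D: "\<And>x. x \<in> D \<Longrightarrow> 0 \<le> x"
    and b: "\<And>x y. x \<in> D \<Longrightarrow> y \<in> D \<Longrightarrow> x * y \<le> b"
  shows "s * s \<le> b"
proof (rule has_sup_least[OF has_sup_mult[OF s]])
  fix z assume "z \<in> (*) s ` D"
  then obtain x where x: "x \<in> D" "z = x * s" by (auto simp: mult.commute)
  have "x * s \<le> b"
    by (rule has_sup_least[OF has_sup_mult[OF s(1) D[OF x(1)]]]) (use b x in auto)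
  then show "z \<le> b" using x by simp
qed

text \<open>A mixed product of two members of \<open>D\<close> lies below the square of a common
  majorant in \<open>D\<close>, so the preceding lemma applies with a bound on squares
  alone.\<close>

lemma has_sup_mult_self:
  fixes s :: "'a::universally_complete_f_algebra"
  assumes s: "has_sup D s" and D: "\<And>x. x \<in> D \<Longrightarrow> 0 \<le> x" and dir: "upward_directed D"
  shows "has_sup ((\<lambda>x. x * x) ` D) (s * s)"
proof -
  obtain x0 where "x0 \<in> D" using dir by (auto simp: upward_directed_def)
  then have s0: "0 \<le> s" using D has_sup_upper[OF s] order_trans by blast
  show ?thesis
  proof (rule has_supI)
    fix z assume z: "\<And>x. x \<in> (\<lambda>x. x * x) ` D \<Longrightarrow> x \<le> z"
    show "s * s \<le> z"
    proof (rule has_sup_mult_self_le[OF s s0 D])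
      fix x y assume xy: "x \<in> D" "y \<in> D"
      then obtain v where v: "v \<in> D" "x \<le> v" "y \<le> v" using dir by (auto simp: upward_directed_def)
      have "x * y \<le> v * v" using v xy D by (intro mult_mono) auto
      also have "\<dots> \<le> z" using z v by auto
      finally show "x * y \<le> z" .
    qed
  qed (use has_sup_upper[OF s] s0 D in \<open>auto intro!: mult_mono\<close>)
qed

lemma mult_self_mono: "0 \<le> x \<Longrightarrow> x \<le> y \<Longrightarrow> x * x \<le> y * (y::'a::unital_f_algebra)"
  by (meson mult_mono order_trans)

text \<open>Let d be the positive part of x - y. Multiplying the difference of the squares by d
  gives d^2 (x + y) \<le> 0, while d \<le> x + y. Hence d^3 \<le> 0, and there are no nonzero
  nilpotents.\<close>

lemma mult_self_le_imp_le:
  fixes x y :: "'a::universally_complete_f_algebra"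
  assumes "0 \<le> x" "0 \<le> y" "x * x \<le> y * y"
  shows "x \<le> y"
proof -
  define d where "d = pprt (x - y)"
  have d0: "0 \<le> d" by (simp add: d_def)
  have "d * (x - y) = d * d"
    using pprt_mult_pprt_minus(1)[of "x - y"] pprt_minus_pprt[of "x - y"]
    by (metis d_def diff_zero right_diff_distrib)
  then have "d * d * (x + y) = d * (x - y) * (x + y)" by simp
  also have "\<dots> = d * (x * x - y * y)" by (simp add: algebra_simps)
  also have "\<dots> \<le> 0" using d0 assms(3) by (intro mult_nonneg_nonpos) auto
  finally have le: "d * d * (x + y) \<le> 0" .
  have "d \<le> x + y" unfolding d_def using assms
    by (intro pprt_leI) (auto simp: algebra_simps add_increasing2)
  then have "d * d * d \<le> d * d * (x + y)" by (intro mult_left_mono mult_self_nonneg)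
  then have "d * d * d \<le> 0" using le by order
  moreover have "0 \<le> d * d * d" by (intro mult_nonneg_nonneg d0)
  ultimately have "d * d * d = 0" by (rule antisym)
  then have "(d * d) * (d * d) = 0" by (metis mult.assoc mult_zero_left)
  then have "d = 0" by (rule mult_self_eq_0_imp[OF mult_self_eq_0_imp])
  then show ?thesis using le_pprt[of "x - y"] by (simp add: d_def)
qed

lemma two_mult_le: "x * y + x * y \<le> x * x + y * (y::'a::universally_complete_f_algebra)"
  using mult_self_nonneg[of "x - y"] by (simp add: algebra_simps)

text \<open>A positive lower bound of all remainders lives where z exceeds every n. Being disjoint
  from the positive part of n - z, it satisfies n l \<le> l z, and the product is the Archimedean
  bound.\<close>

lemma has_sup_truncations:
  fixes z :: "'a::universally_complete_f_algebra"
  shows "has_sup (range (\<lambda>n::nat. inf z (real n *\<^sub>R 1))) z"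
proof (rule has_sup_diffI)
  fix l assume l: "\<And>x. x \<in> range (\<lambda>n. inf z (real n *\<^sub>R 1)) \<Longrightarrow> l \<le> z - x"
  have "pprt l \<le> 0"
  proof (rule archimedean)
    fix n :: nat
    have "pprt l \<le> pprt (z - real n *\<^sub>R 1)"
      using l[OF rangeI, of n] unfolding diff_inf_eq_pprt by (intro pprt_leI) auto
    moreover have "inf (pprt (z - real n *\<^sub>R 1)) (pprt (real n *\<^sub>R 1 - z)) = 0"
      using inf_pprt_pprt[of "z - real n *\<^sub>R 1"] by simp
    ultimately have "inf (pprt l) (pprt (real n *\<^sub>R 1 - z)) = 0"
      by (intro inf_eq_zero_mono[where a = "pprt l" and b = "pprt (z - real n *\<^sub>R 1)"]) auto
    then have "pprt l * pprt (real n *\<^sub>R 1 - z) = 0" by (rule disjoint_mult_zero)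
    moreover have "pprt l * (real n *\<^sub>R 1 - z) \<le> pprt l * pprt (real n *\<^sub>R 1 - z)"
      by (intro mult_left_mono le_pprt) auto
    ultimately show "real n *\<^sub>R pprt l \<le> pprt l * z" by (simp add: algebra_simps)
  qed
  then show "l \<le> 0" using le_pprt order_trans by blast
qed auto

lemma truncations_mono:
  "m \<le> n \<Longrightarrow> inf z (real m *\<^sub>R 1) \<le> inf z (real n *\<^sub>R (1::'a::universally_complete_f_algebra))"
  by (intro inf_mono scaleR_right_mono f_one_nonneg) auto

lemma upward_directed_range_mono:
  fixes f :: "nat \<Rightarrow> 'a::order"
  assumes "\<And>m n. m \<le> n \<Longrightarrow> f m \<le> f n"
  shows "upward_directed (range f)"
proof -
  have "f m \<le> f (max m n) \<and> f n \<le> f (max m n)" for m n by (simp add: assms)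
  then show ?thesis unfolding upward_directed_def by blast
qed

lemma upward_directed_image:
  assumes "upward_directed D" "\<And>x y. x \<in> D \<Longrightarrow> y \<in> D \<Longrightarrow> x \<le> y \<Longrightarrow> f x \<le> f y"
  shows "upward_directed (f ` D)"
  using assms unfolding upward_directed_def by (auto; meson)

text \<open>The component of \<open>1\<close> in the band generated by \<open>w\<close>.\<close>

definition support :: "'a::universally_complete_f_algebra \<Rightarrow> 'a" where
  "support w = Sup (range (\<lambda>n::nat. inf 1 (real n *\<^sub>R w)))"

lemma has_sup_support: "has_sup (range (\<lambda>n::nat. inf 1 (real n *\<^sub>R w))) (support w)"
  unfolding support_def by (rule has_sup_Sup[where b = 1]) auto

context
  fixes w :: "'a::universally_complete_f_algebra"
  assumes w: "0 \<le> w"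
begin

lemma support_nonneg: "0 \<le> support w"
  using has_sup_upper[OF has_sup_support[of w] rangeI, of 0] f_one_nonneg[where 'a = 'a]
  by (simp add: inf_absorb2)

lemma support_le_one: "support w \<le> 1"
  by (rule has_sup_least[OF has_sup_support]) auto

lemma inf_one_le_support: "inf 1 w \<le> support w"
  using has_sup_upper[OF has_sup_support[of w] rangeI, of 1] by simp

lemma inf_support_eq_zero:
  assumes "inf w y = 0"
  shows "inf (support w) y = 0"
proof -
  have y: "0 \<le> y" using assms by (metis inf.cobounded2)
  have "inf y (support w) \<le> 0"
  proof (rule has_sup_least[OF has_sup_inf[OF has_sup_support]])
    fix x assume "x \<in> inf y ` range (\<lambda>n::nat. inf 1 (real n *\<^sub>R w))"
    then obtain n :: nat where x: "x = inf y (inf 1 (real n *\<^sub>R w))" by auto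
    have "inf (w * (real n *\<^sub>R 1)) y = 0"
      by (rule f_algebra_right[OF assms]) (auto intro: scaleR_nonneg_nonneg f_one_nonneg)
    then have "inf y (real n *\<^sub>R w) = 0" by (simp add: inf_commute)
    then show "x \<le> 0" unfolding x by (metis inf.cobounded2 inf_left_commute)
  qed
  then show ?thesis using y support_nonneg by (simp add: order_antisym inf_commute)
qed

text \<open>It suffices that \<open>inf 1 (2 *\<^sub>R support w) \<le> support w\<close>. This
  holds because doubling n w gives the multiple 2n w, which already occurs in the supremum defining
  the support.\<close>

lemma inf_support_compl: "inf (support w) (1 - support w) = 0"
proof -
  let ?p = "support w"
  have "inf 1 (2 *\<^sub>R ?p) \<le> ?p"
  proof (rule has_sup_least[OF has_sup_inf[OF has_sup_scaleR[OF has_sup_support]]])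
    fix x assume "x \<in> inf 1 ` (*\<^sub>R) 2 ` range (\<lambda>n::nat. inf 1 (real n *\<^sub>R w))"
    then obtain n :: nat where x: "x = inf 1 (2 *\<^sub>R inf 1 (real n *\<^sub>R w))" by auto
    have "2 *\<^sub>R inf 1 (real n *\<^sub>R w) \<le> 2 *\<^sub>R (real n *\<^sub>R w)" by (rule scaleR_left_mono) auto
    also have "\<dots> = real (2 * n) *\<^sub>R w" by simp
    finally have "x \<le> inf 1 (real (2 * n) *\<^sub>R w)" unfolding x by (intro inf_mono) auto
    also have "\<dots> \<le> ?p" by (rule has_sup_upper[OF has_sup_support rangeI])
    finally show "x \<le> ?p" .
  qed simp
  moreover have "inf ?p (1 - ?p) + ?p = inf 1 (2 *\<^sub>R ?p)"
    by (simp add: add_inf_distrib_right scaleR_2 inf_commute)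
  ultimately have "inf ?p (1 - ?p) + ?p \<le> ?p" by order
  then have "inf ?p (1 - ?p) \<le> 0" by (simp only: add_le_same_cancel2)
  then show ?thesis using support_nonneg support_le_one by (simp add: order_antisym)
qed

lemma support_idem: "support w * support w = support w"
  using disjoint_mult_zero[OF inf_support_compl] by (simp add: algebra_simps)

lemma support_mult_self: "support w * w = w"
proof -
  let ?p = "support w"
  have q: "0 \<le> 1 - ?p" "1 - ?p \<le> 1" using support_le_one support_nonneg by auto
  have "inf (1 - ?p) (inf 1 w) \<le> inf (1 - ?p) ?p" by (rule inf_mono[OF order_refl inf_one_le_support])
  then have "inf (1 - ?p) (inf 1 w) \<le> 0" using inf_support_compl by (simp add: inf_commute)
  then have "inf (1 - ?p) w \<le> 0" using q(2)
    by (metis inf.absorb1 inf.assoc)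
  then have "inf (1 - ?p) w = 0" using q w by (simp add: order_antisym)
  then have "(1 - ?p) * w = 0" by (rule disjoint_mult_zero)
  then show ?thesis by (simp add: algebra_simps)
qed

lemma support_mult_disjoint: "inf w y = 0 \<Longrightarrow> support w * y = 0"
  by (rule disjoint_mult_zero[OF inf_support_eq_zero])

lemma support_mono:
  assumes "w \<le> v"
  shows "support w \<le> support v"
proof (rule has_sup_least[OF has_sup_support])
  fix x assume "x \<in> range (\<lambda>n::nat. inf 1 (real n *\<^sub>R w))"
  then obtain n :: nat where "x = inf 1 (real n *\<^sub>R w)" by auto
  also have "\<dots> \<le> inf 1 (real n *\<^sub>R v)" using assms by (intro inf_mono scaleR_left_mono) auto
  also have "\<dots> \<le> support v" by (rule has_sup_upper[OF has_sup_support rangeI])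
  finally show "x \<le> support v" .
qed

end

text \<open>The localization device: multiplying by this component restricts to where
  \<open>t\<close> is positive and so stands in for a case split on its sign.\<close>

lemma support_pprt_mult: "support (pprt t) * t = pprt t"
  using support_mult_self[of "pprt t"] support_mult_disjoint[of "pprt t" "pprt (- t)"]
    inf_pprt_pprt[of t] pprt_minus_pprt[of t]
  by (metis diff_zero right_diff_distrib zero_le_pprt)

text \<open>Zorn's lemma with directed sets in place of chains, the form in which
  \<open>monotone_convergence\<close> and order continuity can be applied to find the upper
  bound.\<close>

lemma zorn_directed:
  fixes Z :: "'a::order set"
  assumes "Z \<noteq> {}"
    and "\<And>C. C \<subseteq> Z \<Longrightarrow> upward_directed C \<Longrightarrow> \<exists>u\<in>Z. \<forall>c\<in>C. c \<le> u"
  obtains m where "m \<in> Z" "\<And>z. z \<in> Z \<Longrightarrow> m \<le> z \<Longrightarrow> z = m"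
proof -
  have "\<exists>m\<in>Z. \<forall>a\<in>Z. m \<le> a \<longrightarrow> a = m"
  proof (rule predicate_Zorn)
    show "partial_order_on Z (relation_of (\<le>) Z)"
      by (rule partial_order_on_relation_ofI) auto
    fix C assume C: "C \<in> Chains (relation_of (\<le>) Z)"
    then have CZ: "C \<subseteq> Z" and lin: "\<And>x y. x \<in> C \<Longrightarrow> y \<in> C \<Longrightarrow> x \<le> y \<or> y \<le> x"
      by (auto simp: Chains_def relation_of_def)
    show "\<exists>u\<in>Z. \<forall>a\<in>C. a \<le> u"
    proof (cases "C = {}")
      case False
      then have "upward_directed C" unfolding upward_directed_def using lin by blast
      then show ?thesis using assms(2) CZ by blast
    qed (use assms(1) in auto)
  qed
  then show ?thesis using that by blast
qed

section \<open>The natural domain of a conditional expectation\<close>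

locale cond_exp =
  fixes E :: "'u::universally_complete_f_algebra set" and T :: "'u \<Rightarrow> 'u"
  assumes riesz: "riesz_subspace E" and dense: "order_dense E" and complete: "dedekind_complete E"
    and unit: "weak_order_unit E 1"
    and ce: "conditional_expectation E T" and T_one: "T 1 = 1" and strict: "strictly_positive_on E T"
begin

lemmas E_closed = riesz_subspaceD[OF riesz]

lemma one_in_E: "1 \<in> E"
  using unit by (simp add: weak_order_unit_def)

lemma T_in_E: "x \<in> E \<Longrightarrow> T x \<in> E"
  and T_add: "x \<in> E \<Longrightarrow> y \<in> E \<Longrightarrow> T (x + y) = T x + T y"
  and T_scaleR: "x \<in> E \<Longrightarrow> T (c *\<^sub>R x) = c *\<^sub>R T x"
  and T_nonneg: "x \<in> E \<Longrightarrow> 0 \<le> x \<Longrightarrow> 0 \<le> T x"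
  and T_idem: "x \<in> E \<Longrightarrow> T (T x) = T x"
  using ce by (auto simp: conditional_expectation_def)

lemma T_diff: "x \<in> E \<Longrightarrow> y \<in> E \<Longrightarrow> T (x - y) = T x - T y"
  using T_add[of "x - y" y] E_closed by (simp add: algebra_simps)

lemma T_mono: "x \<in> E \<Longrightarrow> y \<in> E \<Longrightarrow> x \<le> y \<Longrightarrow> T x \<le> T y"
  using T_nonneg[of "y - x"] T_diff[of y x] E_closed by simp

definition below :: "'u \<Rightarrow> 'u set" where
  "below f = {d \<in> E. 0 \<le> d \<and> d \<le> f}"

lemma below_directed: "0 \<le> f \<Longrightarrow> upward_directed (below f)"
  unfolding upward_directed_def
proof (intro conjI ballI)
  fix x y assume "x \<in> below f" "y \<in> below f"
  then show "\<exists>z\<in>below f. x \<le> z \<and> y \<le> z"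
    using E_closed by (intro bexI[of _ "sup x y"]) (auto simp: below_def intro: le_supI1)
next
  assume "0 \<le> f"
  then show "below f \<noteq> {}" using E_closed(1) by (auto simp: below_def)
qed

text \<open>If \<open>f \<le> z\<close> fails for an upper bound \<open>z\<close>, order density yields \<open>0 < w \<le> (f - z)\<^sup>+\<close> in \<open>E\<close>, and
  all multiples of \<open>w\<close> are below \<open>f\<close>.\<close>

lemma has_sup_below:
  assumes f: "0 \<le> f"
  shows "has_sup (below f) f"
proof (rule has_supI)
  fix z assume z: "\<And>x. x \<in> below f \<Longrightarrow> x \<le> z"
  show "f \<le> z"
  proof (rule ccontr)
    assume "\<not> f \<le> z"
    then have "pprt (f - z) \<noteq> 0" using le_pprt[of "f - z"] by auto
    then have "0 < pprt (f - z)" using zero_le_pprt by (simp add: order_less_le)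
    then obtain w where w: "w \<in> E" "0 < w" "w \<le> pprt (f - z)"
      using dense unfolding order_dense_def by blast
    have z0: "0 \<le> z" using z[of 0] f E_closed by (simp add: below_def)
    have step: "d + w \<in> below f" if "d \<in> below f" for d
    proof -
      have d: "d \<in> E" "0 \<le> d" "d \<le> z" "d \<le> f" using that z by (auto simp: below_def)
      have "d + w \<le> d + pprt (f - z)" using w by simp
      also have "\<dots> = sup (d + (f - z)) d" by (simp add: pprt_def add_sup_distrib_left)
      also have "\<dots> \<le> f" using d by (simp add: algebra_simps)
      finally show ?thesis using d w E_closed by (simp add: below_def)
    qed
    have "real n *\<^sub>R w \<in> below f" for n
    proof (induction n)
      case 0 then show ?case using f E_closed by (simp add: below_def)
    next
      case (Suc n) then show ?case using step[OF Suc] by (simp add: algebra_simps)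
    qed
    then have "w \<le> 0" by (intro archimedean[of w f]) (auto simp: below_def)
    then show False using w by order
  qed
qed (auto simp: below_def)

text \<open>The supremum \<open>s\<close> of \<open>below u\<close> is formed inside
  \<open>E\<close>, so it might exceed \<open>u\<close>. Order density would then fit a nonzero
  \<open>w\<close> of \<open>E\<close> into the gap, and \<open>s - w\<close> would be a smaller
  upper bound in \<open>E\<close>.\<close>

lemma E_solid_nonneg:
  assumes "0 \<le> u" "u \<le> x" "x \<in> E"
  shows "u \<in> E"
proof -
  have "isUb E (below u) x" using assms by (auto simp: isUb_def setle_def below_def)
  moreover have "0 \<in> below u" using assms E_closed by (simp add: below_def)
  moreover have "below u \<subseteq> E" by (auto simp: below_def)
  ultimately obtain s where s: "isLub E (below u) s"
    using complete unfolding dedekind_complete_def by blast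
  have sE: "s \<in> E" and su: "\<And>d. d \<in> below u \<Longrightarrow> d \<le> s" using s by (auto dest: isLubD1a isLubD2)
  have us: "u \<le> s" by (rule has_sup_least[OF has_sup_below[OF assms(1)] su])
  have "s \<le> u"
  proof (rule ccontr)
    assume "\<not> s \<le> u"
    then have "0 < s - u" using us by (auto simp: less_le)
    then obtain w where w: "w \<in> E" "0 < w" "w \<le> s - u"
      using dense unfolding order_dense_def by blast
    have "d \<le> s - w" if "d \<in> below u" for d
    proof -
      have "d + w \<le> u + (s - u)" using w that by (intro add_mono) (auto simp: below_def)
      then show ?thesis by (simp add: algebra_simps)
    qed
    then have "isUb E (below u) (s - w)" using E_closed(3)[OF sE w(1)] by (auto simp: isUb_def setle_def)
    then have "s \<le> s - w" by (rule isLub_le_isUb[OF s])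
    then show False using w by simp
  qed
  then show ?thesis using us sE by (metis order_antisym)
qed

lemma has_sup_T:
  assumes D: "D \<subseteq> E" "upward_directed D" and d: "has_sup D d" "d \<in> E"
  shows "has_sup (T ` D) (T d)"
proof (rule has_sup_diffI)
  let ?D = "(\<lambda>x. d - x) ` D"
  have nonneg: "0 \<le> d - x" "d - x \<in> E" if "x \<in> D" for x
    using has_sup_upper[OF d(1) that] that D d E_closed by auto
  have dir: "downward_directed ?D"
    unfolding downward_directed_def
  proof (intro conjI ballI)
    fix x y assume "x \<in> ?D" "y \<in> ?D"
    then obtain x' y' where xy: "x = d - x'" "y = d - y'" "x' \<in> D" "y' \<in> D" by auto
    then obtain z where "z \<in> D" "x' \<le> z" "y' \<le> z" using D(2) by (auto simp: upward_directed_def)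
    then show "\<exists>z\<in>?D. z \<le> x \<and> z \<le> y" using xy by (auto intro!: bexI[of _ z])
  qed (use D(2) in \<open>auto simp: upward_directed_def\<close>)
  have "inf_zero_in E ?D"
    unfolding inf_zero_in_def using nonneg E_closed has_sup_diff[OF d(1)] by auto
  moreover have "?D \<subseteq> E" using nonneg by auto
  ultimately have inf0: "inf_zero_in E (T ` ?D)"
    using ce dir unfolding conditional_expectation_def order_continuous_on_def by blast
  fix l assume l: "\<And>y. y \<in> T ` D \<Longrightarrow> l \<le> T d - y"
  have l': "pprt l \<le> T (d - x)" if x: "x \<in> D" for x
  proof (rule pprt_leI)
    have "x \<in> E" using x D by auto
    then show "l \<le> T (d - x)" using l[OF imageI[OF x]] by (simp add: T_diff[OF d(2)])
    show "0 \<le> T (d - x)" by (rule T_nonneg[OF nonneg(2,1)[OF x]])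
  qed
  obtain x0 where x0: "x0 \<in> D" using D(2) by (auto simp: upward_directed_def)
  \<comment> \<open>Order continuity tests lower bounds from \<open>E\<close> only; solidity is what
    brings \<open>pprt l\<close> into \<open>E\<close>.\<close>
  have "pprt l \<in> E"
    using l'[OF x0] T_in_E[OF nonneg(2)[OF x0]] by (auto intro: E_solid_nonneg[of "pprt l" "T (d - x0)"])
  then have "pprt l \<le> 0" using inf0 l' unfolding inf_zero_in_def by auto
  then show "l \<le> 0" using le_pprt order_trans by blast
next
  fix y assume "y \<in> T ` D"
  then show "y \<le> T d" using has_sup_upper[OF d(1)] D d by (auto intro: T_mono)
qed

text \<open>The whole set \<open>below f\<close> serves as canonical approximating net.
  \<open>approximates_iff\<close> and \<open>approximates_below\<close> show that this gives the
  same domain and the same values as arbitrary nets.\<close>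

definition dom_pos :: "'u set" where
  "dom_pos = {f. 0 \<le> f \<and> bdd_above (T ` below f)}"

definition T_ext :: "'u \<Rightarrow> 'u" where
  "T_ext f = Sup (T ` below f)"

lemma dom_pos_nonneg: "f \<in> dom_pos \<Longrightarrow> 0 \<le> f"
  by (simp add: dom_pos_def)

lemma dom_posI: "0 \<le> f \<Longrightarrow> (\<And>d. d \<in> E \<Longrightarrow> 0 \<le> d \<Longrightarrow> d \<le> f \<Longrightarrow> T d \<le> b) \<Longrightarrow> f \<in> dom_pos"
  by (auto simp: dom_pos_def below_def bdd_above_def)

lemma zero_below: "0 \<le> f \<Longrightarrow> 0 \<in> below f"
  using E_closed by (simp add: below_def)

lemma has_sup_T_ext: "f \<in> dom_pos \<Longrightarrow> has_sup (T ` below f) (T_ext f)"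
  unfolding T_ext_def dom_pos_def using zero_below by (auto intro!: has_sup_Sup simp: bdd_above_def)

lemma T_le_T_ext: "f \<in> dom_pos \<Longrightarrow> d \<in> E \<Longrightarrow> 0 \<le> d \<Longrightarrow> d \<le> f \<Longrightarrow> T d \<le> T_ext f"
  by (rule has_sup_upper[OF has_sup_T_ext]) (auto simp: below_def)

lemma T_ext_least: "f \<in> dom_pos \<Longrightarrow> (\<And>d. d \<in> E \<Longrightarrow> 0 \<le> d \<Longrightarrow> d \<le> f \<Longrightarrow> T d \<le> b) \<Longrightarrow> T_ext f \<le> b"
  by (rule has_sup_least[OF has_sup_T_ext]) (auto simp: below_def)

lemma dom_pos_solid:
  assumes "f \<in> dom_pos" "0 \<le> g" "g \<le> f"
  shows "g \<in> dom_pos" "T_ext g \<le> T_ext f"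
proof -
  have le: "T d \<le> T_ext f" if "d \<in> E" "0 \<le> d" "d \<le> g" for d
    using that assms by (intro T_le_T_ext) auto
  then show "g \<in> dom_pos" using assms by (intro dom_posI)
  then show "T_ext g \<le> T_ext f" using le by (rule T_ext_least)
qed

lemma T_ext_nonneg: "f \<in> dom_pos \<Longrightarrow> 0 \<le> T_ext f"
  using T_le_T_ext[of f 0] dom_pos_nonneg[of f] E_closed T_scaleR[of 0 0] by simp

lemma dom_pos_add:
  assumes "f \<in> dom_pos" "g \<in> dom_pos"
  shows "f + g \<in> dom_pos" "T_ext (f + g) = T_ext f + T_ext g"
proof -
  have le: "T d \<le> T_ext f + T_ext g" if d: "d \<in> E" "0 \<le> d" "d \<le> f + g" for d
  proof -
    obtain d1 d2 where dd: "d = d1 + d2" "0 \<le> d1" "d1 \<le> f" "d1 \<le> d" "0 \<le> d2" "d2 \<le> g" "d2 \<le> d"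
      using riesz_decomposition[OF d(2,3)] assms dom_pos_nonneg by metis
    then have "d1 \<in> E" "d2 \<in> E" using d E_solid_nonneg by blast+
    then show ?thesis using dd assms by (auto simp: T_add intro!: add_mono T_le_T_ext)
  qed
  then show fg: "f + g \<in> dom_pos" using assms dom_pos_nonneg by (intro dom_posI) auto
  have "T_ext f + T_ext g \<le> T_ext (f + g)"
  proof (rule has_sup_least[OF has_sup_add_sets[OF has_sup_T_ext has_sup_T_ext]])
    fix w assume "w \<in> {x + y |x y. x \<in> T ` below f \<and> y \<in> T ` below g}"
    then obtain d e where "w = T d + T e" "d \<in> below f" "e \<in> below g" by auto
    then show "w \<le> T_ext (f + g)"
      using T_le_T_ext[OF fg, of "d + e"] E_closed by (auto simp: below_def T_add add_mono)
  qed (use assms in auto)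
  moreover have "T_ext (f + g) \<le> T_ext f + T_ext g" using fg le by (rule T_ext_least)
  ultimately show "T_ext (f + g) = T_ext f + T_ext g" by simp
qed

lemma dom_pos_scaleR:
  assumes "f \<in> dom_pos" "0 < c"
  shows "c *\<^sub>R f \<in> dom_pos" "T_ext (c *\<^sub>R f) = c *\<^sub>R T_ext f"
proof -
  have le: "T d \<le> c *\<^sub>R T_ext f" "c *\<^sub>R f \<in> dom_pos" if f: "f \<in> dom_pos" and c: "0 < c" and d: "d \<in> E" "0 \<le> d" "d \<le> c *\<^sub>R f"
    for c :: real and d f
  proof -
    have *: "T d \<le> c *\<^sub>R T_ext f" if d: "d \<in> E" "0 \<le> d" "d \<le> c *\<^sub>R f" for d
    proof -
      have "d /\<^sub>R c \<le> f" using d c by (simp add: pos_divideR_le_eq)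
      then have "T (d /\<^sub>R c) \<le> T_ext f"
        using d c E_closed f by (intro T_le_T_ext) (auto intro: scaleR_nonneg_nonneg)
      then show ?thesis using d c by (simp add: T_scaleR pos_divideR_le_eq)
    qed
    show "T d \<le> c *\<^sub>R T_ext f" using * d by blast
    show "c *\<^sub>R f \<in> dom_pos" using * f c dom_pos_nonneg by (intro dom_posI) (auto intro: scaleR_nonneg_nonneg)
  qed
  have z: "0 \<le> c *\<^sub>R f" using assms dom_pos_nonneg by (auto intro: scaleR_nonneg_nonneg)
  show cf: "c *\<^sub>R f \<in> dom_pos" using le(2)[OF assms, of 0] z E_closed by auto
  have "T_ext (c *\<^sub>R f) \<le> c *\<^sub>R T_ext f" using cf le(1)[OF assms] by (intro T_ext_least) auto
  moreover have "T_ext f \<le> (1 / c) *\<^sub>R T_ext (c *\<^sub>R f)"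
    using assms le(1)[OF cf, of "1 / c"] by (intro T_ext_least) auto
  then have "c *\<^sub>R T_ext f \<le> c *\<^sub>R ((1 / c) *\<^sub>R T_ext (c *\<^sub>R f))" using assms by (intro scaleR_left_mono) auto
  then have "c *\<^sub>R T_ext f \<le> T_ext (c *\<^sub>R f)" using assms by simp
  ultimately show "T_ext (c *\<^sub>R f) = c *\<^sub>R T_ext f" by simp
qed

lemma T_ext_eq_T:
  assumes "d \<in> E" "0 \<le> d"
  shows "d \<in> dom_pos" "T_ext d = T d"
proof -
  show "d \<in> dom_pos" using assms by (intro dom_posI[of _ "T d"] T_mono) auto
  then show "T_ext d = T d" using assms T_mono by (intro order_antisym T_ext_least T_le_T_ext) auto
qed

text \<open>Independence of the net: for d in \<open>E\<close> below f, the elements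
  \<open>inf d x\<close> with x in \<open>D\<close> increase to d inside \<open>E\<close>, where
  \<open>T\<close> is order continuous, and their images stay below those of
  \<open>D\<close>.\<close>

lemma approximates_iff:
  assumes "approximates E T D f"
  shows "f \<in> dom_pos" "Sup (T ` D) = T_ext f"
proof -
  have D: "D \<subseteq> E" "\<And>x. x \<in> D \<Longrightarrow> 0 \<le> x" "upward_directed D" "has_sup D f" "bdd_above (T ` D)" "D \<noteq> {}"
    using assms by (auto simp: approximates_def upward_directed_def)
  have f0: "0 \<le> f" using D(2,4,6) has_sup_upper order_trans by blast
  have s: "has_sup (T ` D) (Sup (T ` D))" using D by (auto intro!: has_sup_Sup simp: bdd_above_def)
  have le: "T d \<le> Sup (T ` D)" if d: "d \<in> E" "0 \<le> d" "d \<le> f" for d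
  proof -
    have "has_sup (inf d ` D) d" using has_sup_inf[OF D(4), of d] d by (simp add: inf_absorb1)
    then have "has_sup (T ` inf d ` D) (T d)"
      using D d E_closed by (intro has_sup_T upward_directed_image) (auto intro: le_infI2)
    then show ?thesis
    proof (rule has_sup_least)
      fix y assume "y \<in> T ` inf d ` D"
      then obtain x where x: "x \<in> D" "y = T (inf d x)" by auto
      then have "y \<le> T x" using d D E_closed by (auto intro!: T_mono)
      also have "\<dots> \<le> Sup (T ` D)" using has_sup_upper[OF s] x by auto
      finally show "y \<le> Sup (T ` D)" .
    qed
  qed
  then show f: "f \<in> dom_pos" using f0 by (intro dom_posI)
  have "Sup (T ` D) \<le> T_ext f"
    using D has_sup_upper[OF D(4)] f by (intro has_sup_least[OF s]) (auto intro!: T_le_T_ext)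
  then show "Sup (T ` D) = T_ext f" using T_ext_least[OF f le] by simp
qed

lemma approximates_below: "f \<in> dom_pos \<Longrightarrow> approximates E T (below f) f"
  using below_directed has_sup_below by (auto simp: approximates_def dom_pos_def below_def)

section \<open>The extended expectation: linearity, strict positivity and monotone
  convergence\<close>

abbreviation L :: "'u set" where "L \<equiv> L1 E T"
abbreviation \<tau> :: "'u \<Rightarrow> 'u" where "\<tau> \<equiv> cond_ext E T"

lemma L1_eq: "L = {f - g | f g. f \<in> dom_pos \<and> g \<in> dom_pos}"
  unfolding L1_def using approximates_iff(1) approximates_below by blast

text \<open>Two decompositions of the same element are compared after moving the subtracted terms
  across, where additivity of \<open>T_ext\<close> applies; this settles the definite
  description.\<close>

lemma cond_ext_diff:
  assumes "f \<in> dom_pos" "g \<in> dom_pos"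
  shows "\<tau> (f - g) = T_ext f - T_ext g"
  unfolding cond_ext_def
proof (rule the_equality)
  show "\<exists>f1 f2 D1 D2. approximates E T D1 f1 \<and> approximates E T D2 f2 \<and> f - g = f1 - f2 \<and>
      T_ext f - T_ext g = Sup (T ` D1) - Sup (T ` D2)"
    using approximates_below[OF assms(1)] approximates_below[OF assms(2)] by (auto simp: T_ext_def)
next
  fix t assume "\<exists>f1 f2 D1 D2. approximates E T D1 f1 \<and> approximates E T D2 f2 \<and> f - g = f1 - f2 \<and>
      t = Sup (T ` D1) - Sup (T ` D2)"
  then obtain f1 f2 where f: "f1 \<in> dom_pos" "f2 \<in> dom_pos" "f - g = f1 - f2" "t = T_ext f1 - T_ext f2"
    using approximates_iff by metis
  then have "f + f2 = f1 + g" by (simp add: algebra_simps)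
  then have "T_ext f + T_ext f2 = T_ext f1 + T_ext g" using f assms by (metis dom_pos_add(2))
  then have "T_ext f1 = T_ext f + T_ext f2 - T_ext g" by simp
  then show "t = T_ext f - T_ext g" unfolding f(4) by simp
qed

lemma zero_in_dom_pos: "0 \<in> dom_pos" "T_ext 0 = 0"
  using T_ext_eq_T[of 0] E_closed T_scaleR[of 0 0] by auto

lemma L1_nonneg_iff: "0 \<le> f \<Longrightarrow> f \<in> L \<longleftrightarrow> f \<in> dom_pos"
proof
  assume "0 \<le> f" "f \<in> L"
  then obtain f1 f2 where f: "f1 \<in> dom_pos" "f2 \<in> dom_pos" "f = f1 - f2" by (auto simp: L1_eq)
  show "f \<in> dom_pos"
    by (rule dom_pos_solid(1)[OF f(1) \<open>0 \<le> f\<close>]) (use f dom_pos_nonneg in auto)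
next
  assume "f \<in> dom_pos"
  then show "f \<in> L" unfolding L1_eq using zero_in_dom_pos by force
qed

lemma cond_ext_dom_pos: "f \<in> dom_pos \<Longrightarrow> \<tau> f = T_ext f"
  using cond_ext_diff[of f 0] zero_in_dom_pos by simp

lemma L1_solid:
  assumes "g \<in> L" "\<bar>f\<bar> \<le> \<bar>g\<bar>"
  shows "f \<in> L"
proof -
  obtain g1 g2 where g: "g1 \<in> dom_pos" "g2 \<in> dom_pos" "g = g1 - g2" using assms by (auto simp: L1_eq)
  have "\<bar>g\<bar> \<le> g1 + g2" using g dom_pos_nonneg abs_triangle_ineq4[of g1 g2] by simp
  then have "\<bar>f\<bar> \<le> g1 + g2" using assms(2) by order
  then have "pprt f \<le> g1 + g2" "pprt (- f) \<le> g1 + g2" using pprt_le_abs[of f] by auto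
  then have "pprt f \<in> dom_pos" "pprt (- f) \<in> dom_pos" using dom_pos_add(1)[OF g(1,2)] by (auto intro: dom_pos_solid)
  then show ?thesis unfolding L1_eq using pprt_minus_pprt[of f] by blast
qed

lemma L1_solid_nonneg: "g \<in> L \<Longrightarrow> 0 \<le> f \<Longrightarrow> f \<le> g \<Longrightarrow> f \<in> L"
  by (rule L1_solid[of g]) auto

lemma L1_add:
  assumes "f \<in> L" "g \<in> L"
  shows "f + g \<in> L" "\<tau> (f + g) = \<tau> f + \<tau> g"
proof -
  obtain f1 f2 g1 g2 where fg: "f1 \<in> dom_pos" "f2 \<in> dom_pos" "f = f1 - f2" "g1 \<in> dom_pos" "g2 \<in> dom_pos" "g = g1 - g2"
    using assms by (auto simp: L1_eq)
  have e: "f + g = (f1 + g1) - (f2 + g2)" using fg by simp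
  show "f + g \<in> L" unfolding e L1_eq using fg dom_pos_add by blast
  show "\<tau> (f + g) = \<tau> f + \<tau> g" unfolding e using fg by (simp add: cond_ext_diff dom_pos_add)
qed

lemma L1_minus:
  assumes "f \<in> L"
  shows "- f \<in> L" "\<tau> (- f) = - \<tau> f"
proof -
  obtain f1 f2 where f: "f1 \<in> dom_pos" "f2 \<in> dom_pos" "f = f1 - f2" using assms by (auto simp: L1_eq)
  have e: "- f = f2 - f1" using f by simp
  show "- f \<in> L" unfolding e L1_eq using f by blast
  show "\<tau> (- f) = - \<tau> f" unfolding e using f by (simp add: cond_ext_diff)
qed

lemma L1_diff: "f \<in> L \<Longrightarrow> g \<in> L \<Longrightarrow> f - g \<in> L" "f \<in> L \<Longrightarrow> g \<in> L \<Longrightarrow> \<tau> (f - g) = \<tau> f - \<tau> g"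
  using L1_add[of f "- g"] L1_minus[of g] by auto

lemma zero_in_L1: "0 \<in> L" "\<tau> 0 = 0"
  using zero_in_dom_pos cond_ext_dom_pos L1_nonneg_iff by auto

lemma L1_scaleR:
  assumes "f \<in> L"
  shows "c *\<^sub>R f \<in> L" "\<tau> (c *\<^sub>R f) = c *\<^sub>R \<tau> f"
proof -
  have pos: "c *\<^sub>R f \<in> L \<and> \<tau> (c *\<^sub>R f) = c *\<^sub>R \<tau> f" if c: "0 < c" for c
  proof -
    obtain f1 f2 where f: "f1 \<in> dom_pos" "f2 \<in> dom_pos" "f = f1 - f2" using assms by (auto simp: L1_eq)
    have e: "c *\<^sub>R f = c *\<^sub>R f1 - c *\<^sub>R f2" unfolding f(3) by (rule scaleR_right_diff_distrib)
    have "\<tau> (c *\<^sub>R f) = c *\<^sub>R T_ext f1 - c *\<^sub>R T_ext f2"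
      unfolding e using f c by (simp add: cond_ext_diff dom_pos_scaleR)
    also have "\<dots> = c *\<^sub>R \<tau> f" using f by (simp add: cond_ext_diff scaleR_right_diff_distrib)
    finally show ?thesis unfolding L1_eq using e f c dom_pos_scaleR(1) by blast
  qed
  consider "0 < c" | "c = 0" | "0 < - c" by linarith
  then show "c *\<^sub>R f \<in> L" "\<tau> (c *\<^sub>R f) = c *\<^sub>R \<tau> f"
    using pos[of c] pos[of "- c"] zero_in_L1 L1_minus[of "(- c) *\<^sub>R f"] by (cases; simp)+
qed

lemma cond_ext_nonneg: "f \<in> L \<Longrightarrow> 0 \<le> f \<Longrightarrow> 0 \<le> \<tau> f"
  using L1_nonneg_iff T_ext_nonneg by (simp add: cond_ext_dom_pos)

lemma cond_ext_mono: "f \<in> L \<Longrightarrow> g \<in> L \<Longrightarrow> f \<le> g \<Longrightarrow> \<tau> f \<le> \<tau> g"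
  using cond_ext_nonneg[of "g - f"] L1_diff[of g f] by simp

lemma cond_ext_strict:
  assumes "f \<in> L" "0 \<le> f" "\<tau> f \<le> 0"
  shows "f = 0"
proof -
  have f: "f \<in> dom_pos" "T_ext f \<le> 0" using assms by (auto simp: L1_nonneg_iff cond_ext_dom_pos)
  have "f \<le> 0"
  proof (rule has_sup_least[OF has_sup_below[OF assms(2)]])
    fix d assume "d \<in> below f"
    then have d: "d \<in> E" "0 \<le> d" "d \<le> f" by (auto simp: below_def)
    then have "T d = 0" using T_le_T_ext[OF f(1)] f(2) T_nonneg by (meson order_antisym order_trans)
    then show "d \<le> 0" using strict d by (auto simp: strictly_positive_on_def)
  qed
  then show ?thesis using assms by simp
qed

text \<open>For d in \<open>E\<close> below \<open>g\<close>, the elements \<open>inf d x\<close>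
  lie in \<open>E\<close> by solidity and increase to d, so \<open>has_sup_T\<close> applies. The
  inner estimate is stated for an arbitrary bound: \<open>b\<close> puts \<open>g\<close> into
  \<open>L\<close>, and any upper bound of the images yields leastness.\<close>

lemma monotone_convergence:
  assumes G: "G \<subseteq> L" "\<And>x. x \<in> G \<Longrightarrow> 0 \<le> x" "upward_directed G" "has_sup G g"
    and b: "\<And>x. x \<in> G \<Longrightarrow> \<tau> x \<le> b"
  shows "g \<in> L" "has_sup (\<tau> ` G) (\<tau> g)"
proof -
  have GP: "x \<in> dom_pos" if "x \<in> G" for x using G L1_nonneg_iff that by blast
  obtain x0 where x0: "x0 \<in> G" using G(3) by (auto simp: upward_directed_def)
  then have g0: "0 \<le> g" using G(2,4) has_sup_upper order_trans by blast
  have le: "T d \<le> b" if b: "\<And>x. x \<in> G \<Longrightarrow> \<tau> x \<le> b" and d: "d \<in> E" "0 \<le> d" "d \<le> g" for d b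
  proof -
    have iE: "inf d x \<in> E" if "x \<in> G" for x
      using d(2) G(2)[OF that] by (rule E_solid_nonneg[OF le_infI inf_le1 d(1)])
    have "has_sup (inf d ` G) d" using has_sup_inf[OF G(4), of d] d by (simp add: inf_absorb1)
    then have "has_sup (T ` inf d ` G) (T d)"
      using G(3) d iE by (intro has_sup_T upward_directed_image) (auto intro: le_infI2)
    then show ?thesis
    proof (rule has_sup_least)
      fix y assume "y \<in> T ` inf d ` G"
      then obtain x where x: "x \<in> G" "y = T (inf d x)" by auto
      then have "y \<le> T_ext x" using d G iE GP by (auto intro!: T_le_T_ext)
      also have "\<dots> \<le> b" using b[OF x(1)] by (simp add: cond_ext_dom_pos[OF GP[OF x(1)]])
      finally show "y \<le> b" .
    qed
  qed
  have g: "g \<in> dom_pos" using g0 le[OF b] by (intro dom_posI) auto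
  then show gL: "g \<in> L" using g0 L1_nonneg_iff by blast
  show "has_sup (\<tau> ` G) (\<tau> g)"
  proof (rule has_supI)
    fix z assume z: "\<And>x. x \<in> \<tau> ` G \<Longrightarrow> x \<le> z"
    show "\<tau> g \<le> z" unfolding cond_ext_dom_pos[OF g] by (rule T_ext_least[OF g le]) (use z in auto)
  qed (use G gL has_sup_upper[OF G(4)] in \<open>auto intro!: cond_ext_mono\<close>)
qed

section \<open>The range algebra and the module L2\<close>

abbreviation A :: "'u set" where "A \<equiv> range_alg E T"

text \<open>\<open>T (below f)\<close> is itself a net in \<open>E\<close> increasing to \<open>\<tau> f\<close>, and \<open>T\<close> fixes its elements.\<close>

lemma T_ext_idem:
  assumes f: "f \<in> dom_pos"
  shows "T_ext f \<in> dom_pos" "T_ext (T_ext f) = T_ext f"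
proof -
  have TT: "T ` T ` below f = T ` below f"
    unfolding image_image by (rule image_cong) (auto simp: below_def T_idem)
  have "approximates E T (T ` below f) (T_ext f)"
    unfolding approximates_def TT
  proof (intro conjI)
    show "upward_directed (T ` below f)"
      using below_directed[OF dom_pos_nonneg[OF f]] by (rule upward_directed_image) (auto simp: below_def intro: T_mono)
    show "has_sup (T ` below f) (T_ext f)" "bdd_above (T ` below f)"
      using f by (auto simp: dom_pos_def intro: has_sup_T_ext)
    show "T ` below f \<subseteq> {x \<in> E. 0 \<le> x}" using T_in_E T_nonneg by (auto simp: below_def)
  qed
  note ap = approximates_iff[OF this, unfolded TT]
  show "T_ext f \<in> dom_pos" by (rule ap(1))
  show "T_ext (T_ext f) = T_ext f" using ap(2) by (simp only: T_ext_def[of f])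
qed

lemma cond_ext_in_L1:
  assumes "f \<in> L"
  shows "\<tau> f \<in> L" "\<tau> (\<tau> f) = \<tau> f"
proof -
  obtain f1 f2 where f: "f1 \<in> dom_pos" "f2 \<in> dom_pos" "f = f1 - f2" using assms by (auto simp: L1_eq)
  then have e: "\<tau> f = T_ext f1 - T_ext f2" by (simp add: cond_ext_diff)
  show "\<tau> f \<in> L" unfolding e L1_eq using f T_ext_idem by blast
  show "\<tau> (\<tau> f) = \<tau> f" unfolding e using f T_ext_idem by (simp add: cond_ext_diff)
qed

lemma range_alg_iff: "a \<in> A \<longleftrightarrow> a \<in> L \<and> \<tau> a = a"
  unfolding range_alg_def using cond_ext_in_L1 by (metis (no_types, lifting) imageE image_eqI)

lemma cond_ext_in_A: "f \<in> L \<Longrightarrow> \<tau> f \<in> A"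
  by (simp add: range_alg_def)

text \<open>Positivity gives \<open>\<bar>a\<bar> \<le> \<tau> \<bar>a\<bar>\<close>. The difference
  is annihilated by the idempotent \<open>\<tau>\<close>, so it vanishes by strict
  positivity.\<close>

lemma range_alg_abs:
  assumes a: "a \<in> A"
  shows "\<bar>a\<bar> \<in> A"
proof -
  have a': "a \<in> L" "\<tau> a = a" "\<bar>a\<bar> \<in> L" using a L1_solid[of a "\<bar>a\<bar>"] by (auto simp: range_alg_iff)
  have "a \<le> \<tau> \<bar>a\<bar>" using cond_ext_mono[OF a'(1,3)] a'(2) by (simp add: abs_ge_self)
  moreover have "- a \<le> \<tau> \<bar>a\<bar>"
    using cond_ext_mono[OF L1_minus(1)[OF a'(1)] a'(3)] a' by (simp add: L1_minus abs_ge_minus_self)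
  ultimately have "0 \<le> \<tau> \<bar>a\<bar> - \<bar>a\<bar>" by (simp add: abs_le_iff)
  moreover have "\<tau> (\<tau> \<bar>a\<bar> - \<bar>a\<bar>) = 0" using a' by (simp add: L1_diff cond_ext_in_L1)
  ultimately have "\<tau> \<bar>a\<bar> - \<bar>a\<bar> = 0"
    using a' by (intro cond_ext_strict) (auto intro: L1_diff cond_ext_in_L1)
  then show ?thesis using a' by (simp add: range_alg_iff)
qed

lemma range_alg_riesz: "riesz_subspace A"
proof -
  have sub: "subspace A"
    by (rule subspaceI) (auto simp: range_alg_iff zero_in_L1 L1_add L1_scaleR)
  have pp: "pprt x \<in> A" if "x \<in> A" for x
  proof -
    have "\<bar>x\<bar> + x = (pprt x + pprt (- x)) + (pprt x - pprt (- x))"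
      using pprt_minus_pprt[of x] abs_eq_pprt_add[of x] by metis
    then have "\<bar>x\<bar> + x = 2 *\<^sub>R pprt x" by (simp add: scaleR_2)
    then have "pprt x = (1/2) *\<^sub>R (\<bar>x\<bar> + x)" by simp
    then show ?thesis using that range_alg_abs sub by (metis subspace_add subspace_scale)
  qed
  have s: "sup x y \<in> A" if "x \<in> A" "y \<in> A" for x y
  proof -
    have "sup x y = pprt (x - y) + y" by (simp add: pprt_def add_sup_distrib_right)
    then show ?thesis using that pp sub by (metis subspace_add subspace_diff)
  qed
  have "inf x y \<in> A" if "x \<in> A" "y \<in> A" for x y
    using s[of "- x" "- y"] that sub by (metis inf_eq_neg_sup subspace_neg)
  then show ?thesis using sub s by (auto simp: riesz_subspace_def)
qed

lemmas A_closed = riesz_subspaceD[OF range_alg_riesz]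

lemma A_in_L1: "a \<in> A \<Longrightarrow> a \<in> L" and cond_ext_A: "a \<in> A \<Longrightarrow> \<tau> a = a"
  by (simp_all add: range_alg_iff)

lemma one_in_A: "1 \<in> A"
  using T_ext_eq_T[OF one_in_E f_one_nonneg] L1_nonneg_iff[OF f_one_nonneg]
  by (simp add: range_alg_iff cond_ext_dom_pos T_one)

lemma L1_pprt: "f \<in> L \<Longrightarrow> pprt f \<in> L" "f \<in> L \<Longrightarrow> pprt (- f) \<in> L"
  by (rule L1_solid[of f]; use pprt_le_abs[of f] in simp)+

lemma range_alg_has_sup:
  assumes "D \<subseteq> A" "\<And>x. x \<in> D \<Longrightarrow> 0 \<le> x" "upward_directed D" "has_sup D s"
  shows "s \<in> A"
proof -
  have t: "\<tau> x = x" "x \<in> L" if "x \<in> D" for x using assms(1) that cond_ext_A A_in_L1 by auto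
  have im: "\<tau> ` D = D" using t(1) by force
  have "s \<in> L" "has_sup (\<tau> ` D) (\<tau> s)"
    using monotone_convergence[of D s s] assms t has_sup_upper[OF assms(4)] by auto
  then have "\<tau> s = s" unfolding im by (intro has_sup_unique[OF _ assms(4)])
  then show ?thesis using \<open>s \<in> L\<close> by (simp add: range_alg_iff)
qed

text \<open>For \<open>a \<ge> 0\<close> the bound \<open>z \<le> 1\<close> gives
  \<open>\<tau> (a * z) \<le> \<tau> a = a\<close>, so this map of \<open>a\<close> preserves bands
  and can be compared at 1 with multiplication by \<open>\<tau> z\<close>. The next three lemmas
  remove the restriction on \<open>z\<close> by scaling, truncation and splitting into positive
  parts.\<close>

lemma averaging_bounded:
  assumes z: "0 \<le> z" "z \<le> 1" and a: "a \<in> A"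
  shows "a * z \<in> L" "\<tau> (a * z) = a * \<tau> z"
proof -
  have absz: "\<bar>z\<bar> = z" using z by simp
  have zL: "z \<in> L" using z A_in_L1[OF one_in_A] L1_solid_nonneg by blast
  have az: "a * z \<in> L" if "a \<in> A" for a
  proof (rule L1_solid[OF A_in_L1[OF that]])
    have "\<bar>a * z\<bar> \<le> \<bar>a\<bar> * \<bar>z\<bar>" by (rule abs_le_mult)
    also have "\<dots> \<le> \<bar>a\<bar> * 1" unfolding absz using z by (intro mult_left_mono) auto
    finally show "\<bar>a * z\<bar> \<le> \<bar>a\<bar>" by simp
  qed
  show "a * z \<in> L" by (rule az[OF a])
  show "\<tau> (a * z) = a * \<tau> z"
  proof (rule local_operators_agree[OF range_alg_riesz one_in_A _ _ _ a, where F = "\<lambda>a. \<tau> (a * z)"])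
    show "local_operator A (\<lambda>a. \<tau> (a * z))"
      unfolding local_operator_def
    proof (intro conjI ballI allI impI)
      fix x y assume xy: "x \<in> A" "y \<in> A" "inf x y = 0"
      have x0: "0 \<le> x" using xy(3) by (metis inf.cobounded1)
      have "x * z \<le> x * 1" using x0 z by (intro mult_left_mono) auto
      then have "\<tau> (x * z) \<le> x"
        using cond_ext_mono[OF az[OF xy(1)] A_in_L1[OF xy(1)]] cond_ext_A[OF xy(1)] by simp
      moreover have "0 \<le> \<tau> (x * z)" using az[OF xy(1)] x0 z by (intro cond_ext_nonneg) auto
      moreover have "0 \<le> y" using xy(3) by (metis inf.cobounded2)
      ultimately show "inf (\<tau> (x * z)) y = 0" using xy(3) by (intro inf_eq_zero_mono[OF xy(3)]) auto
    qed (use az z L1_add L1_scaleR in \<open>auto simp: algebra_simps intro!: cond_ext_nonneg\<close>)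
    show "local_operator A (\<lambda>a. a * \<tau> z)"
      using z zL cond_ext_nonneg
      by (auto simp: local_operator_def algebra_simps intro!: f_algebra_right mult_nonneg_nonneg)
  qed simp
qed

lemma averaging_truncated:
  assumes z: "0 \<le> z" and a: "a \<in> A"
  shows "a * inf z (real n *\<^sub>R 1) \<in> L" "\<tau> (a * inf z (real n *\<^sub>R 1)) = a * \<tau> (inf z (real n *\<^sub>R 1))"
proof -
  have *: "a * inf z (real n *\<^sub>R 1) \<in> L \<and> \<tau> (a * inf z (real n *\<^sub>R 1)) = a * \<tau> (inf z (real n *\<^sub>R 1))"
  proof (cases "n = 0")
    case True
    then show ?thesis using z by (simp add: inf_absorb2 zero_in_L1)
  next
    case False
    define u where "u = inf z (real n *\<^sub>R 1) /\<^sub>R real n"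
    have "0 \<le> inf z (real n *\<^sub>R 1)" using z by (auto intro!: scaleR_nonneg_nonneg f_one_nonneg)
    then have u: "0 \<le> u" unfolding u_def by (auto intro!: scaleR_nonneg_nonneg)
    have u1: "u \<le> 1" using False by (simp add: u_def pos_divideR_le_eq)
    have e: "inf z (real n *\<^sub>R 1) = real n *\<^sub>R u" using False by (simp add: u_def)
    have uL: "u \<in> L" using L1_solid_nonneg[OF A_in_L1[OF one_in_A] u u1] .
    have "a * (real n *\<^sub>R u) = real n *\<^sub>R (a * u)" by simp
    then show ?thesis
      unfolding e using averaging_bounded[OF u u1 a] uL L1_scaleR by (metis mult_scaleR_right)
  qed
  then show "a * inf z (real n *\<^sub>R 1) \<in> L" "\<tau> (a * inf z (real n *\<^sub>R 1)) = a * \<tau> (inf z (real n *\<^sub>R 1))"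
    by auto
qed

lemma averaging_nonneg:
  assumes z: "z \<in> L" "0 \<le> z" and a: "a \<in> A" "0 \<le> a"
  shows "a * z \<in> L" "\<tau> (a * z) = a * \<tau> z"
proof -
  let ?t = "\<lambda>n::nat. inf z (real n *\<^sub>R 1)"
  have t0: "0 \<le> ?t n" for n using z by (auto intro!: scaleR_nonneg_nonneg f_one_nonneg)
  have tL: "?t n \<in> L" for n using L1_solid_nonneg[OF z(1) t0] by auto
  have dir: "upward_directed (range ?t)" by (intro upward_directed_range_mono truncations_mono)
  have mono: "upward_directed ((*) a ` range ?t)"
    using a by (intro upward_directed_image[OF dir] mult_left_mono)
  have s1: "has_sup (\<tau> ` range ?t) (\<tau> z)"
    using t0 tL dir z by (intro monotone_convergence(2)[of _ z "\<tau> z"] has_sup_truncations)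
      (auto intro: cond_ext_mono)
  have s2: "has_sup ((*) a ` range ?t) (a * z)" by (rule has_sup_mult[OF has_sup_truncations a(2)])
  have b: "\<tau> x \<le> a * \<tau> z" if ran: "x \<in> (*) a ` range ?t" for x
  proof -
    obtain n where x: "x = a * ?t n" using ran by auto
    have "\<tau> x = a * \<tau> (?t n)" unfolding x by (rule averaging_truncated[OF z(2) a(1)])
    also have "\<dots> \<le> a * \<tau> z" using cond_ext_mono[OF tL z(1)] a by (intro mult_left_mono) auto
    finally show ?thesis .
  qed
  have G: "(*) a ` range ?t \<subseteq> L" "\<And>x. x \<in> (*) a ` range ?t \<Longrightarrow> 0 \<le> x"
    using averaging_truncated[OF z(2) a(1)] a t0 by auto
  note mc = monotone_convergence[OF G mono s2 b]
  show "a * z \<in> L" by (rule mc(1))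
  have "\<tau> ` (*) a ` range ?t = (*) a ` \<tau> ` range ?t"
    using averaging_truncated(2)[OF z(2) a(1)] by (auto simp: image_image)
  then show "\<tau> (a * z) = a * \<tau> z"
    using mc(2) has_sup_mult[OF s1 a(2)] has_sup_unique by metis
qed

lemma averaging:
  assumes z: "z \<in> L" and a: "a \<in> A"
  shows "a * z \<in> L" "\<tau> (a * z) = a * \<tau> z"
proof -
  note ps = L1_pprt[OF z] A_closed(8)[OF a] A_closed(8)[OF A_closed(5)[OF a]]
  have "a * z = (pprt a - pprt (- a)) * (pprt z - pprt (- z))"
    using pprt_minus_pprt[of a] pprt_minus_pprt[of z] by simp
  then have e: "a * z = (pprt a * pprt z + pprt (- a) * pprt (- z)) - (pprt a * pprt (- z) + pprt (- a) * pprt z)"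
    by (simp add: algebra_simps)
  show "a * z \<in> L" unfolding e using ps by (intro L1_add L1_diff averaging_nonneg) auto
  have "\<tau> (a * z) = (pprt a * \<tau> (pprt z) + pprt (- a) * \<tau> (pprt (- z)))
      - (pprt a * \<tau> (pprt (- z)) + pprt (- a) * \<tau> (pprt z))"
    unfolding e using ps by (simp add: L1_add L1_diff averaging_nonneg)
  also have "\<dots> = (pprt a - pprt (- a)) * (\<tau> (pprt z) - \<tau> (pprt (- z)))"
    by (simp add: algebra_simps)
  also have "\<tau> (pprt z) - \<tau> (pprt (- z)) = \<tau> z"
    using L1_diff(2)[OF ps(1,2)] pprt_minus_pprt[of z] by simp
  finally show "\<tau> (a * z) = a * \<tau> z" using pprt_minus_pprt[of a] by simp
qed

lemma A_mult: "a \<in> A \<Longrightarrow> b \<in> A \<Longrightarrow> a * b \<in> A"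
  using averaging[of b a] by (simp add: range_alg_iff)

lemma A_support:
  assumes "a \<in> A" "0 \<le> a"
  shows "support a \<in> A"
proof (rule range_alg_has_sup[OF _ _ _ has_sup_support])
  show "upward_directed (range (\<lambda>n::nat. inf 1 (real n *\<^sub>R a)))"
    using assms(2) by (intro upward_directed_range_mono inf_mono scaleR_right_mono) auto
qed (use assms A_closed one_in_A in \<open>auto intro!: scaleR_nonneg_nonneg f_one_nonneg\<close>)

text \<open>The supremum of all subroots up to 1 is again a subroot; any deficit of its square would
  allow a larger one.\<close>

lemma sqrt_exists_le_one:
  assumes b: "b \<in> A" "0 \<le> b" "b \<le> 1"
  obtains r where "r \<in> A" "0 \<le> r" "r * r = b"
proof -
  define R where "R = {r \<in> A. 0 \<le> r \<and> r \<le> 1 \<and> r * r \<le> b}"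
  have prod: "x * y \<le> b" if "x \<in> R" "y \<in> R" for x y
  proof -
    have "x * y + x * y \<le> b + b"
      using two_mult_le[of x y] that add_mono[of "x * x" b "y * y" b] by (auto simp: R_def)
    then have "2 *\<^sub>R (x * y) \<le> 2 *\<^sub>R b" by (simp add: scaleR_2)
    then show ?thesis by (simp add: scaleR_le_cancel_left_pos)
  qed
  have R0: "0 \<in> R" using b A_closed f_one_nonneg by (simp add: R_def)
  have sup: "sup x y \<in> R" if "x \<in> R" "y \<in> R" for x y
  proof -
    have "has_sup {x, y} (sup x y)" by (rule has_supI) auto
    then have "sup x y * sup x y \<le> b"
    proof (rule has_sup_mult_self_le)
      show "u * v \<le> b" if "u \<in> {x, y}" "v \<in> {x, y}" for u v
        using that \<open>x \<in> R\<close> \<open>y \<in> R\<close> prod by blast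
      show "0 \<le> sup x y" using \<open>x \<in> R\<close> by (auto simp: R_def intro: le_supI1)
      show "0 \<le> u" if "u \<in> {x, y}" for u using that \<open>x \<in> R\<close> \<open>y \<in> R\<close> by (auto simp: R_def)
    qed
    then show ?thesis using that A_closed by (auto simp: R_def intro: le_supI1)
  qed
  have dir: "upward_directed R"
    unfolding upward_directed_def
  proof (intro conjI ballI)
    fix x y assume "x \<in> R" "y \<in> R"
    then show "\<exists>z\<in>R. x \<le> z \<and> y \<le> z" using sup by (intro bexI[of _ "sup x y"]) auto
  qed (use R0 in auto)
  define r where "r = Sup R"
  have r: "has_sup R r" unfolding r_def using R0 by (intro has_sup_Sup[of _ 1]) (auto simp: R_def)
  have rA: "r \<in> A" by (rule range_alg_has_sup[OF _ _ dir r]) (auto simp: R_def)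
  have r0: "0 \<le> r" using has_sup_upper[OF r R0] .
  have r1: "r \<le> 1" by (rule has_sup_least[OF r]) (auto simp: R_def)
  have rb: "r * r \<le> b" by (rule has_sup_mult_self_le[OF r r0 _ prod]) (auto simp: R_def)
  \<comment> \<open>Half the deficit can be added to \<open>r\<close>: since \<open>r\<close> and
    \<open>d + r\<close> are at most 1, the square grows by 2dr + d^2 \<le> 2d, which is the whole
    deficit.\<close>
  define d where "d = (1/2) *\<^sub>R (b - r * r)"
  have d0: "0 \<le> d" unfolding d_def using rb by (intro scaleR_nonneg_nonneg) auto
  have dd: "d + d = b - r * r" by (simp add: d_def flip: scaleR_2)
  have dr: "d + r \<le> 1"
  proof -
    have "(d + r) + (d + r) \<le> (1 - r * r) + (r + r)" using dd b by (simp add: add_ac)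
    also have "\<dots> \<le> 1 + 1" using mult_self_nonneg[of "1 - r"] by (simp add: algebra_simps)
    finally have "2 *\<^sub>R (d + r) \<le> 2 *\<^sub>R 1" by (simp only: scaleR_2)
    then show ?thesis by (simp add: scaleR_le_cancel_left_pos)
  qed
  have "0 \<le> d * ((1 - (d + r)) + (1 - r))" using d0 dr r1 by (intro mult_nonneg_nonneg add_nonneg_nonneg) auto
  also have "\<dots> = (d + d) - (d * r + d * r + d * d)" by (simp add: algebra_simps)
  also have "\<dots> = b - (d + r) * (d + r)" unfolding dd by (simp add: algebra_simps)
  finally have "(d + r) * (d + r) \<le> b" by simp
  moreover have "d + r \<in> A" unfolding d_def using b rA A_closed A_mult by auto
  ultimately have "d + r \<in> R" using d0 r0 dr by (auto simp: R_def)
  then have "d + r \<le> r" by (rule has_sup_upper[OF r])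
  then have "d = 0" using d0 by simp
  then have "r * r = b" using dd by simp
  then show ?thesis using rA r0 that by blast
qed

text \<open>Roots of the truncations of \<open>b\<close>, obtained by rescaling to elements below 1,
  are directed because their squares are; the square of their supremum is the supremum of the
  truncations.\<close>

lemma sqrt_exists:
  assumes b: "b \<in> A" "0 \<le> b"
  obtains r where "r \<in> A" "0 \<le> r" "r * r = b"
proof -
  let ?t = "\<lambda>n::nat. inf b (real n *\<^sub>R 1)"
  define R where "R = {r \<in> A. 0 \<le> r \<and> r * r \<in> range ?t}"
  have ex: "\<exists>r\<in>R. r * r = ?t n" for n
  proof (cases "n = 0")
    case True
    have t0: "?t 0 = 0" using b by (simp add: inf_absorb2)
    have "0 \<in> R" unfolding R_def using t0 A_closed(1) by (auto intro: rangeI[of ?t 0, unfolded t0])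
    then show ?thesis using t0 True by (intro bexI[of _ 0]) auto
  next
    case False
    let ?c = "?t n /\<^sub>R real n"
    have "0 \<le> ?t n" using b by (auto intro!: scaleR_nonneg_nonneg f_one_nonneg)
    then have "0 \<le> ?c" by (auto intro!: scaleR_nonneg_nonneg)
    moreover have "?c \<le> 1" using False by (simp add: pos_divideR_le_eq)
    moreover have "?c \<in> A" using b A_closed one_in_A by auto
    ultimately obtain r where r: "r \<in> A" "0 \<le> r" "r * r = ?c" using sqrt_exists_le_one by metis
    have "(sqrt (real n) *\<^sub>R r) * (sqrt (real n) *\<^sub>R r) = real n *\<^sub>R (r * r)" by simp
    then have "(sqrt (real n) *\<^sub>R r) * (sqrt (real n) *\<^sub>R r) = ?t n" using False r(3) by simp
    then show ?thesis using r A_closed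
      by (intro bexI[of _ "sqrt (real n) *\<^sub>R r"]) (auto simp: R_def intro!: scaleR_nonneg_nonneg)
  qed
  have im: "(\<lambda>r. r * r) ` R = range ?t" using ex by (force simp: R_def)
  have dir: "upward_directed R"
    unfolding upward_directed_def
  proof (intro conjI ballI)
    fix x y assume xy: "x \<in> R" "y \<in> R"
    then obtain m n where mn: "x * x = ?t m" "y * y = ?t n" by (auto simp: R_def)
    obtain z where z: "z \<in> R" "z * z = ?t (max m n)" using ex by blast
    have "x * x \<le> z * z" "y * y \<le> z * z" by (simp_all only: mn z(2) truncations_mono max.cobounded1 max.cobounded2)
    then have "x \<le> z" "y \<le> z" using z(1) xy mult_self_le_imp_le by (auto simp: R_def)
    then show "\<exists>z\<in>R. x \<le> z \<and> y \<le> z" using z(1) by blast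
  qed (use ex in auto)
  \<comment> \<open>\<open>1 + b\<close> bounds all roots because its square dominates
    \<open>b\<close>.\<close>
  have bd: "r \<le> 1 + b" if "r \<in> R" for r
  proof (rule mult_self_le_imp_le)
    have "r * r \<le> b" using that by (auto simp: R_def)
    also have "\<dots> \<le> b + (1 + b + b * b)" using b f_one_nonneg by (intro add_increasing2 add_nonneg_nonneg) auto
    also have "\<dots> = (1 + b) * (1 + b)" by (simp add: algebra_simps)
    finally show "r * r \<le> (1 + b) * (1 + b)" .
  qed (use that b f_one_nonneg in \<open>auto simp: R_def intro: add_nonneg_nonneg\<close>)
  define r where "r = Sup R"
  have r: "has_sup R r" unfolding r_def using bd ex by (intro has_sup_Sup[of _ "1 + b"]) auto
  have "r \<in> A" by (rule range_alg_has_sup[OF _ _ dir r]) (auto simp: R_def)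
  moreover have "0 \<le> r" using ex[of 0] has_sup_upper[OF r] by (auto simp: R_def intro: order_trans)
  moreover have "has_sup (range ?t) (r * r)"
    using has_sup_mult_self[OF r _ dir] im by (auto simp: R_def)
  then have "r * r = b" using has_sup_unique has_sup_truncations by blast
  ultimately show ?thesis using that by blast
qed

section \<open>\<open>L2\<close> as a Riesz space and \<open>A\<close>-module, and its
  \<open>A\<close>-valued norm\<close>

abbreviation H :: "'u set" where "H \<equiv> L2 E T"

text \<open>Membership in \<open>L\<close> follows from that of the square because
  \<open>\<bar>x\<bar> \<le> 1 + x * x\<close>.\<close>

lemma L2_iff: "x \<in> H \<longleftrightarrow> x * x \<in> L"
proof -
  have "x \<in> L" if "x * x \<in> L"
  proof (rule L1_solid)
    show "1 + x * x \<in> L" using that A_in_L1[OF one_in_A] L1_add by blast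
    have "\<bar>x\<bar> + \<bar>x\<bar> \<le> 1 + x * x" using two_mult_le[of "\<bar>x\<bar>" 1] by (simp add: abs_mult_self_f add.commute)
    then have "\<bar>x\<bar> \<le> 1 + x * x" by (metis abs_ge_zero add_increasing order_trans add_le_cancel_left le_add_same_cancel1)
    then show "\<bar>x\<bar> \<le> \<bar>1 + x * x\<bar>" using order_trans[OF _ abs_ge_self] by blast
  qed
  then show ?thesis by (auto simp: L2_def power2_eq_square)
qed

lemma L2_mult:
  assumes "x \<in> H" "y \<in> H"
  shows "x * y \<in> L"
proof (rule L1_solid)
  show "x * x + y * y \<in> L" using assms by (auto simp: L2_iff intro: L1_add)
  have "\<bar>x * y\<bar> \<le> \<bar>x\<bar> * \<bar>y\<bar>" by (rule abs_le_mult)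
  also have "\<dots> \<le> \<bar>x\<bar> * \<bar>y\<bar> + \<bar>x\<bar> * \<bar>y\<bar>" by (simp add: add_increasing)
  also have "\<dots> \<le> x * x + y * y" using two_mult_le[of "\<bar>x\<bar>" "\<bar>y\<bar>"] by (simp add: abs_mult_self_f)
  finally show "\<bar>x * y\<bar> \<le> \<bar>x * x + y * y\<bar>" using order_trans[OF _ abs_ge_self] by blast
qed

lemma L2_solid:
  assumes "y \<in> H" "\<bar>x\<bar> \<le> \<bar>y\<bar>"
  shows "x \<in> H"
proof -
  have "\<bar>x\<bar> * \<bar>x\<bar> \<le> \<bar>y\<bar> * \<bar>y\<bar>" using assms by (intro mult_self_mono) auto
  then have "x * x \<le> y * y" by (simp add: abs_mult_self_f)
  then show ?thesis using assms mult_self_nonneg by (auto simp: L2_iff intro: L1_solid_nonneg)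
qed

lemma L2_riesz: "riesz_subspace H"
proof -
  have add: "x + y \<in> H" if "x \<in> H" "y \<in> H" for x y
    using that L2_mult[OF that] by (auto simp: L2_iff algebra_simps intro!: L1_add)
  have sub: "subspace H"
    by (rule subspaceI) (auto simp: add L2_iff zero_in_L1 intro: L1_scaleR add[unfolded L2_iff])
  have abs: "\<bar>x\<bar> \<in> H" if "x \<in> H" for x using that by (rule L2_solid) simp
  have lat: "sup x y \<in> H" "inf x y \<in> H" if "x \<in> H" "y \<in> H" for x y
  proof -
    have "\<bar>x\<bar> + \<bar>y\<bar> \<in> H" using that abs add by blast
    moreover have "\<bar>sup x y\<bar> \<le> \<bar>x\<bar> + \<bar>y\<bar>" "\<bar>inf x y\<bar> \<le> \<bar>x\<bar> + \<bar>y\<bar>"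
    proof -
      have le: "x \<le> \<bar>x\<bar> + \<bar>y\<bar>" "y \<le> \<bar>x\<bar> + \<bar>y\<bar>" "- x \<le> \<bar>x\<bar> + \<bar>y\<bar>" "- y \<le> \<bar>x\<bar> + \<bar>y\<bar>"
        by (rule add_increasing2[OF abs_ge_zero abs_ge_self] add_increasing[OF abs_ge_zero abs_ge_self]
            add_increasing2[OF abs_ge_zero abs_ge_minus_self] add_increasing[OF abs_ge_zero abs_ge_minus_self])+
      show "\<bar>sup x y\<bar> \<le> \<bar>x\<bar> + \<bar>y\<bar>" using le by (simp add: abs_le_iff neg_sup_eq_inf le_infI1)
      show "\<bar>inf x y\<bar> \<le> \<bar>x\<bar> + \<bar>y\<bar>" using le by (simp add: abs_le_iff neg_inf_eq_sup le_infI1)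
    qed
    ultimately show "sup x y \<in> H" "inf x y \<in> H"
      using L2_solid[of "\<bar>x\<bar> + \<bar>y\<bar>"] order_trans[OF _ abs_ge_self] by blast+
  qed
  then show ?thesis using sub by (simp add: riesz_subspace_def)
qed

lemmas H_closed = riesz_subspaceD[OF L2_riesz]

lemma L2_A_mult: "a \<in> A \<Longrightarrow> x \<in> H \<Longrightarrow> a * x \<in> H"
  using averaging(1)[of "x * x" "a * a"] A_mult by (simp add: L2_iff mult_ac)

lemma one_in_H: "1 \<in> H"
  using A_in_L1 one_in_A by (simp add: L2_iff)

lemma L2_in_L1: "x \<in> H \<Longrightarrow> x \<in> L"
  by (simp add: L2_def)

lemma norm_T_spec:
  assumes x: "x \<in> H"
  shows "norm_T E T x \<in> A" "0 \<le> norm_T E T x" "norm_T E T x * norm_T E T x = \<tau> (x * x)"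
proof -
  have xx: "x * x \<in> L" using x by (simp add: L2_iff)
  obtain r where r: "r \<in> A" "0 \<le> r" "r * r = \<tau> (x * x)"
    using sqrt_exists[OF cond_ext_in_A[OF xx] cond_ext_nonneg[OF xx mult_self_nonneg]] .
  have "norm_T E T x = r"
    unfolding norm_T_def
  proof (rule the_equality)
    fix s assume "s \<in> A \<and> 0 \<le> s \<and> s\<^sup>2 = \<tau> (x\<^sup>2)"
    then have s: "0 \<le> s" "s * s = r * r" using r by (auto simp: power2_eq_square)
    then show "s = r" using mult_self_le_imp_le[OF s(1) r(2)] mult_self_le_imp_le[OF r(2) s(1)] by simp
  qed (use r in \<open>auto simp: power2_eq_square\<close>)
  then show "norm_T E T x \<in> A" "0 \<le> norm_T E T x" "norm_T E T x * norm_T E T x = \<tau> (x * x)"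
    using r by auto
qed

text \<open>Removes square roots from operator bounds; from \<open>bounded_ops_iff\<close> on only
  the quadratic form of the estimate is used.\<close>

lemma norm_T_le_iff:
  assumes "x \<in> H" "y \<in> H" "0 \<le> k"
  shows "norm_T E T x \<le> k * norm_T E T y \<longleftrightarrow> \<tau> (x * x) \<le> (k * k) * \<tau> (y * y)"
proof -
  note s = norm_T_spec[OF assms(1)] norm_T_spec[OF assms(2)]
  have p: "0 \<le> k * norm_T E T y" using assms(3) s by simp
  have e: "(k * norm_T E T y) * (k * norm_T E T y) = (k * k) * \<tau> (y * y)"
    unfolding s(6)[symmetric] by (simp add: mult_ac)
  show ?thesis
    using mult_self_mono[OF s(2), of "k * norm_T E T y"] mult_self_le_imp_le[OF s(2) p] e s(3)
    by auto
qed

section \<open>The Levi property\<close>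

text \<open>The truncated suprema \<open>s n = sup (g \<and> n)\<close> over \<open>g \<in> G\<close> can only fail to be jointly bounded on
  the part where \<open>s n = n\<close> for all \<open>n\<close>, which strict positivity rules out. The complementary parts
  \<open>p n\<close>, where \<open>s n < n\<close>, increase to \<open>1\<close>, and on \<open>p (n + 1) - p n\<close> all \<open>s m\<close> are at most \<open>s (n + 1)\<close>;
  these disjoint pieces are glued by lateral completeness.\<close>

lemma levi_property:
  assumes G: "G \<subseteq> L" "\<And>x. x \<in> G \<Longrightarrow> 0 \<le> x" "upward_directed G"
    and b: "\<And>x. x \<in> G \<Longrightarrow> \<tau> x \<le> b"
  shows "\<exists>v. \<forall>x\<in>G. x \<le> v"
proof -
  define N where "N n = real n *\<^sub>R (1::'u)" for n :: nat
  have N_mono: "m \<le> n \<Longrightarrow> N m \<le> N n" for m n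
    unfolding N_def by (intro scaleR_right_mono f_one_nonneg) auto
  have N0: "0 \<le> N n" for n unfolding N_def by (intro scaleR_nonneg_nonneg f_one_nonneg) auto
  define I where "I n = (\<lambda>g. inf (N n) g) ` G" for n
  define s where "s n = Sup (I n)" for n
  obtain g0 where g0: "g0 \<in> G" using G(3) by (auto simp: upward_directed_def)
  have s: "has_sup (I n) (s n)" for n
    unfolding s_def using g0 by (intro has_sup_Sup[of _ "N n"]) (auto simp: I_def)
  have s0: "0 \<le> s n" for n
    using has_sup_upper[OF s, of "inf (N n) g0" n] g0 G(2)[OF g0] N0[of n]
    by (auto simp: I_def intro: order_trans[of 0 "inf (N n) g0"])
  have sN: "s n \<le> N n" for n by (rule has_sup_least[OF s]) (auto simp: I_def)
  have trunc: "inf (N n) (s m) = s n" if "n \<le> m" for n m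
  proof -
    have "inf (N n) ` I m = I n"
      unfolding I_def image_image using N_mono[OF that]
      by (intro image_cong refl) (simp add: inf_absorb1 flip: inf_assoc)
    then show ?thesis
      using has_sup_inf[OF s[of m], of "N n"] by (intro has_sup_unique[OF _ s[of n]]) simp
  qed
  have s_mono: "s n \<le> s m" if "n \<le> m" for n m
    using inf_le2[of "N n" "s m"] unfolding trunc[OF that] .
  have sL: "s n \<in> L \<and> \<tau> (s n) \<le> b" for n
  proof -
    have inL: "inf (N n) x \<in> L" if "x \<in> G" for x
      by (rule L1_solid_nonneg[of x]) (use G that N0 in auto)
    have le: "\<tau> y \<le> b" if y: "y \<in> I n" for y
    proof -
      obtain x where x: "x \<in> G" "y = inf (N n) x" using y by (auto simp: I_def)
      have "\<tau> y \<le> \<tau> x" unfolding x(2) using inL[OF x(1)] x(1) G(1) by (intro cond_ext_mono) auto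
      then show ?thesis using b[OF x(1)] by order
    qed
    have dir: "upward_directed (I n)"
      unfolding I_def by (rule upward_directed_image[OF G(3)]) (auto intro: le_infI2)
    have "s n \<in> L" "has_sup (\<tau> ` I n) (\<tau> (s n))"
      using inL G(2) N0 dir le by (intro monotone_convergence[OF _ _ dir s le]; auto simp: I_def)+
    then show ?thesis using has_sup_least[of "\<tau> ` I n" "\<tau> (s n)" b] le by auto
  qed
  define p where "p n = support (N n - s n)" for n
  have d0: "0 \<le> N n - s n" for n using sN by simp
  note p = support_nonneg[OF d0, folded p_def] support_le_one[OF d0, folded p_def]
    support_idem[OF d0, folded p_def] support_mult_self[OF d0, folded p_def]
    inf_support_compl[OF d0, folded p_def]
  have p_mono: "p n \<le> p m" if "n \<le> m" for n m
    unfolding p_def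
  proof (rule support_mono[OF d0])
    have "s m - s n = pprt (s m - N n)"
      using diff_inf_eq_pprt[of "s m" "N n"] trunc[OF that] by (simp add: inf_commute)
    also have "\<dots> \<le> N m - N n" using sN[of m] N_mono[OF that] by (intro pprt_leI) auto
    finally show "N n - s n \<le> N m - s m" by (simp add: algebra_simps)
  qed
  have p_mult: "p n * p m = p n" if "n \<le> m" for n m
  proof -
    have "(1 - p m) * p n \<le> (1 - p m) * p m" using p(2) p_mono[OF that] by (intro mult_left_mono) auto
    also have "\<dots> = 0" using p(3)[of m] by (simp add: algebra_simps)
    finally have "(1 - p m) * p n = 0" using p by (intro order_antisym mult_nonneg_nonneg) auto
    then show ?thesis by (simp add: algebra_simps)
  qed
  have const: "p n * s m = p n * s n" if "n \<le> m" for n m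
  proof -
    have "N n - s n = pprt (N n - s m)" "s m - s n = pprt (s m - N n)"
      using diff_inf_eq_pprt[of "s m" "N n"] diff_inf_eq_pprt[of "N n" "s m"] trunc[OF that]
      by (simp_all add: inf_commute)
    then have "inf (N n - s n) (s m - s n) = 0" using inf_pprt_pprt[of "N n - s m"] by simp
    then have "p n * (s m - s n) = 0" unfolding p_def by (rule support_mult_disjoint[OF d0])
    then show ?thesis by (simp add: algebra_simps)
  qed
  have p_sup: "has_sup (range p) 1"
  proof (rule has_sup_diffI)
    fix l assume l: "\<And>x. x \<in> range p \<Longrightarrow> l \<le> 1 - x"
    define q where "q = pprt l"
    have q: "0 \<le> q" "q \<le> 1 - p n" for n
      unfolding q_def using l p(2) by (auto intro!: pprt_leI)
    have q1: "q \<le> 1" using q(2)[of 0] p(1)[of 0] by (metis diff_le_eq le_add_same_cancel1 order_trans)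
    \<comment> \<open>On \<open>q\<close>, which lies below every \<open>1 - p n\<close>, each
      truncated supremum has reached its cap n. Hence n times \<open>\<tau> q\<close> stays below
      \<open>b\<close> for all n.\<close>
    have le: "real n *\<^sub>R q \<le> s n" for n
    proof -
      have "q * (N n - s n) \<le> (1 - p n) * (N n - s n)" using q d0 by (intro mult_right_mono) auto
      also have "\<dots> = 0" using p(4)[of n] by (simp add: algebra_simps)
      finally have "real n *\<^sub>R q \<le> q * s n" by (simp add: algebra_simps N_def)
      also have "\<dots> \<le> 1 * s n" using q1 s0 by (intro mult_right_mono)
      finally show ?thesis by simp
    qed
    have qL: "q \<in> L" using L1_solid_nonneg[of "s 1" q] le[of 1] q sL by auto
    have "\<tau> q \<le> 0"
    proof (rule archimedean)
      fix n :: nat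
      have "real n *\<^sub>R \<tau> q \<le> \<tau> (s n)"
        using cond_ext_mono[OF L1_scaleR(1)[OF qL] _ le[of n]] sL L1_scaleR(2)[OF qL] by metis
      then show "real n *\<^sub>R \<tau> q \<le> b" using sL by (meson order_trans)
    qed
    then have "q = 0" using qL q by (intro cond_ext_strict)
    then show "l \<le> 0" using le_pprt[of l] by (simp add: q_def)
  qed (use p in auto)
  define q where "q n = p (Suc n) - p n" for n
  have q: "0 \<le> q n" "q n \<le> p (Suc n)" "q n \<le> 1 - p n" "q n * q n = q n" for n
    using p_mono[of n "Suc n"] p(1,2) p(3)[of n] p(3)[of "Suc n"] p_mult[of n "Suc n"]
    by (auto simp: q_def algebra_simps diff_right_mono)
  define D where "D = range (\<lambda>n. q n * s (Suc n))"
  have disj: "inf (q m * s (Suc m)) (q n * s (Suc n)) = 0" if "m < n" for m n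
  proof -
    have "q m \<le> p n" using q(2)[of m] p_mono[of "Suc m" n] that by auto
    then have "inf (q m) (q n) = 0"
      by (rule inf_eq_zero_mono[OF p(5)[of n] q(1) _ q(1) q(3)])
    then have "inf (q m * s (Suc m)) (q n) = 0" using s0 by (rule f_algebra_right)
    then show ?thesis using f_algebra_right[OF _ s0[of "Suc n"]] by (metis inf_commute)
  qed
  have "bdd_above D"
  proof (rule disjoint_bdd_above)
    fix x y assume xy: "x \<in> D" "y \<in> D" "x \<noteq> y"
    then obtain m n where mn: "x = q m * s (Suc m)" "y = q n * s (Suc n)" by (auto simp: D_def)
    then have "m \<noteq> n" using xy(3) by auto
    then show "inf x y = 0" using disj[of m n] disj[of n m] by (auto simp: mn inf_commute linorder_neq_iff)
  qed (use q s0 in \<open>auto simp: D_def\<close>)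
  then obtain v where v: "\<And>n. q n * s (Suc n) \<le> v" by (auto simp: D_def bdd_above_def)
  have v0: "0 \<le> v" using v[of 0] q(1)[of 0] s0[of 1] by (metis One_nat_def mult_nonneg_nonneg order_trans)
  have qs: "q n * s m \<le> q n * v" for n m
  proof -
    have "q n * s m \<le> q n * s (Suc n)"
    proof (cases "m \<le> Suc n")
      case True
      then show ?thesis using s_mono q by (intro mult_left_mono) auto
    next
      case False
      have "q n * p (Suc n) = q n"
        using p(3)[of "Suc n"] p_mult[of n "Suc n"] by (simp add: q_def algebra_simps)
      then have "q n * x = q n * (p (Suc n) * x)" for x by (metis mult.assoc)
      then show ?thesis using const[of "Suc n" m] False by (metis nat_le_linear order_refl)
    qed
    also have "\<dots> = q n * (q n * s (Suc n))" by (simp add: q(4) flip: mult.assoc)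
    also have "\<dots> \<le> q n * v" using v q by (intro mult_left_mono)
    finally show ?thesis .
  qed
  \<comment> \<open>Telescoping over the pieces \<open>q n\<close>, starting from
    \<open>p 0 = 0\<close> because \<open>N 0\<close> and \<open>s 0\<close> both vanish.\<close>
  have ps: "p n * s m \<le> p n * v" for n m
  proof (induction n)
    case 0
    have "N 0 - s 0 = 0" using sN[of 0] s0[of 0] by (simp add: N_def order_antisym)
    then have "p 0 \<le> 0" unfolding p_def by (intro has_sup_least[OF has_sup_support]) auto
    then have "p 0 = 0" using p(1)[of 0] by (rule order_antisym)
    then show ?case by simp
  next
    case (Suc n)
    have "p (Suc n) * x = p n * x + q n * x" for x by (simp add: q_def algebra_simps)
    then show ?case using add_mono[OF Suc qs[of n m]] by simp
  qed
  have "s m \<le> v" for m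
  proof -
    have "has_sup ((*) (s m) ` range p) (s m)" using has_sup_mult[OF p_sup s0[of m]] by simp
    then show ?thesis
    proof (rule has_sup_least)
      fix x assume "x \<in> (*) (s m) ` range p"
      then obtain n where "x = p n * s m" by (auto simp: mult.commute)
      also have "p n * s m \<le> p n * v" by (rule ps)
      also have "\<dots> \<le> 1 * v" using p v0 by (intro mult_right_mono)
      finally show "x \<le> v" by simp
    qed
  qed
  then have le: "inf g (N n) \<le> v" if "g \<in> G" for g n
    using has_sup_upper[OF s[of n], of "inf (N n) g"] that order_trans by (fastforce simp: I_def inf_commute)
  have "g \<le> v" if "g \<in> G" for g
    by (rule has_sup_least[OF has_sup_truncations]) (use le[OF that] in \<open>auto simp: N_def\<close>)
  then show ?thesis by blast
qed

section \<open>Representation of positive functionals\<close>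

lemma has_sup_truncations_H:
  assumes "x \<in> H" "0 \<le> x"
  shows "inf x (real n *\<^sub>R 1) \<in> H" "0 \<le> inf x (real n *\<^sub>R 1)"
    "upward_directed (range (\<lambda>n::nat. inf x (real n *\<^sub>R 1)))"
  using assms one_in_H H_closed
  by (auto intro!: scaleR_nonneg_nonneg f_one_nonneg upward_directed_range_mono truncations_mono)

text \<open>The representing element is a maximal \<open>h \<ge> 0\<close> with \<open>\<tau> (h x) \<le> f x\<close>. If the remainder
  \<open>v x = f x - \<tau> (h x)\<close> were nonzero, then \<open>v > e \<tau>\<close> somewhere for some \<open>e > 0\<close>; discarding a maximal
  piece \<open>z\<close> on which \<open>v z \<le> e \<tau> z\<close> leaves a piece \<open>p\<close> below which \<open>v \<ge> e \<tau>\<close>, and \<open>h + e p\<close>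
  contradicts maximality.\<close>

lemma riesz_representation:
  assumes f_add: "\<And>x y. x \<in> H \<Longrightarrow> y \<in> H \<Longrightarrow> f (x + y) = f x + f y"
    and f_A: "\<And>a x. a \<in> A \<Longrightarrow> x \<in> H \<Longrightarrow> f (a * x) = a * f x"
    and f_pos: "\<And>x. x \<in> H \<Longrightarrow> 0 \<le> x \<Longrightarrow> 0 \<le> f x"
    and f_in: "\<And>x. x \<in> H \<Longrightarrow> f x \<in> A"
    and f_cont: "\<And>D s. D \<subseteq> H \<Longrightarrow> (\<And>x. x \<in> D \<Longrightarrow> 0 \<le> x) \<Longrightarrow> upward_directed D \<Longrightarrow> has_sup D s \<Longrightarrow>
      s \<in> H \<Longrightarrow> has_sup (f ` D) (f s)"
    and f_bound: "\<And>g. g \<in> H \<Longrightarrow> 0 \<le> g \<Longrightarrow> \<tau> (g * g) \<le> f g \<Longrightarrow> \<tau> (g * g) \<le> c"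
  obtains h where "h \<in> H" "\<And>x. x \<in> H \<Longrightarrow> f x = \<tau> (x * h)"
proof -
  define G where "G = {g \<in> H. 0 \<le> g \<and> (\<forall>x\<in>H. 0 \<le> x \<longrightarrow> \<tau> (x * g) \<le> f x)}"
  have mL: "x * y \<in> L" if "x \<in> H" "y \<in> H" for x y using L2_mult that .
  have scalar: "c *\<^sub>R 1 \<in> A" for c using A_closed one_in_A by blast
  have f_scaleR: "f (c *\<^sub>R x) = c *\<^sub>R f x" if "x \<in> H" for c x
    using f_A[OF scalar that, of c] by simp
  have f0: "f 0 = 0" using f_scaleR[OF H_closed(1), of 0] by simp
  obtain h where h: "h \<in> G" and hmax: "\<And>g. g \<in> G \<Longrightarrow> h \<le> g \<Longrightarrow> g = h"
  proof (rule zorn_directed)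
    have "0 \<in> G" using H_closed f_pos zero_in_L1 by (auto simp: G_def)
    then show "G \<noteq> {}" by blast
    fix C assume C: "C \<subseteq> G" "upward_directed C"
    have CH: "C \<subseteq> H" and C0: "\<And>g. g \<in> C \<Longrightarrow> 0 \<le> g" using C by (auto simp: G_def)
    have Cf: "\<tau> (x * g) \<le> f x" if "g \<in> C" "x \<in> H" "0 \<le> x" for g x using that C by (auto simp: G_def)
    \<comment> \<open>Testing membership of \<open>g\<close> in \<open>G\<close> on x = g produces
      the premise of \<open>f_bound\<close>. The resulting bound on squares puts the supremum
      \<open>k\<close> into \<open>H\<close>.\<close>
    have C2: "\<tau> (g * g) \<le> c" if "g \<in> C" for g
      using f_bound Cf[OF that] CH C0[OF that] that by blast
    \<comment> \<open>Testing on x = 1 bounds the expectations, which the Levi property turns into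
      an order bound for \<open>C\<close>.\<close>
    have "\<tau> g \<le> f 1" if "g \<in> C" for g using Cf[OF that one_in_H f_one_nonneg] by simp
    then obtain u where u: "\<forall>g\<in>C. g \<le> u"
      using levi_property[of C "f 1"] CH L2_in_L1 C0 C(2) by blast
    have "C \<noteq> {}" using C(2) by (auto simp: upward_directed_def)
    then have k: "has_sup C (Sup C)" using u by (intro has_sup_Sup) auto
    define k where "k = Sup C"
    note k = k[folded k_def]
    obtain g0 where g0: "g0 \<in> C" using \<open>C \<noteq> {}\<close> by blast
    have k0: "0 \<le> k" using C0[OF g0] has_sup_upper[OF k g0] by order
    have sq: "upward_directed ((\<lambda>g. g * g) ` C)"
      by (rule upward_directed_image[OF C(2)]) (use C0 in \<open>auto intro: mult_self_mono\<close>)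
    have "k * k \<in> L"
      by (rule monotone_convergence(1)[OF _ _ sq has_sup_mult_self[OF k C0 C(2)], of c])
        (use CH C2 mL mult_self_nonneg in auto)
    then have kH: "k \<in> H" by (simp add: L2_iff)
    have "\<tau> (x * k) \<le> f x" if x: "x \<in> H" "0 \<le> x" for x
    proof -
      have dir: "upward_directed ((*) x ` C)"
        by (rule upward_directed_image[OF C(2)]) (use x in \<open>auto intro: mult_left_mono\<close>)
      have "has_sup (\<tau> ` (*) x ` C) (\<tau> (x * k))"
        by (rule monotone_convergence(2)[OF _ _ dir has_sup_mult[OF k x(2)], of "f x"])
          (use CH C0 Cf[OF _ x] x mL in auto)
      then show ?thesis by (rule has_sup_least) (use Cf[OF _ x] in auto)
    qed
    then have "k \<in> G" using kH k0 by (auto simp: G_def)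
    then show "\<exists>u\<in>G. \<forall>c\<in>C. c \<le> u" using has_sup_upper[OF k] by blast
  qed blast
  have hH: "h \<in> H" and h0: "0 \<le> h" and hf: "\<And>x. x \<in> H \<Longrightarrow> 0 \<le> x \<Longrightarrow> \<tau> (x * h) \<le> f x"
    using h by (auto simp: G_def)
  define v where "v x = f x - \<tau> (x * h)" for x
  have v_add: "v (x + y) = v x + v y" if "x \<in> H" "y \<in> H" for x y
    using that hH mL by (simp add: v_def f_add distrib_right L1_add)
  have v_A: "v (a * x) = a * v x" if "a \<in> A" "x \<in> H" for a x
    using averaging(2)[OF mL[OF that(2) hH] that(1)] that
    by (simp add: v_def f_A right_diff_distrib mult.assoc)
  have v_scaleR: "v (c *\<^sub>R x) = c *\<^sub>R v x" if "x \<in> H" for c x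
    using v_A[OF scalar that, of c] by simp
  have v_pos: "0 \<le> v x" if "x \<in> H" "0 \<le> x" for x using hf[OF that] by (simp add: v_def)
  have v_mono: "v x \<le> v y" if "x \<in> H" "y \<in> H" "x \<le> y" for x y
    using v_pos[of "y - x"] v_add[of x "y - x"] that H_closed(3) by auto
  have v_in: "v x \<in> A" if "x \<in> H" for x
    unfolding v_def using f_in[OF that] cond_ext_in_A[OF mL[OF that hH]] A_closed(3) by blast
  have v1: "v 1 \<le> 0"
  proof (rule archimedean_eps[OF _ f_one_nonneg])
    fix e :: real assume e: "0 < e"
    \<comment> \<open>\<open>b\<close> is the excess of \<open>v 1\<close> over e, and
      \<open>a\<close> below is the component carrying it. Then v a - e a = b, so the goal becomes
      \<open>b \<le> 0\<close>.\<close>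
    define b where "b = pprt (v 1 - e *\<^sub>R 1)"
    have b: "b \<in> A" "0 \<le> b" unfolding b_def using v_in[OF one_in_H] A_closed one_in_A by auto
    define a where "a = support b"
    have a: "a \<in> A" "0 \<le> a" "a \<le> 1" "a * (v 1 - e *\<^sub>R 1) = b"
      using A_support[OF b] support_nonneg[OF b(2)] support_le_one[OF b(2)]
        support_pprt_mult[of "v 1 - e *\<^sub>R 1", folded b_def]
      by (auto simp: a_def)
    have aH: "a \<in> H" using L2_A_mult[OF a(1) one_in_H] by simp
    have va: "v a - e *\<^sub>R a = b" using v_A[OF a(1) one_in_H] a(4) by (simp add: algebra_simps)
    have small: "z \<in> H" if "0 \<le> z" "z \<le> a" for z
      using L2_solid[OF aH, of z] that a by simp
    define Z where "Z = {z. 0 \<le> z \<and> z \<le> a \<and> v z \<le> e *\<^sub>R \<tau> z}"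
    have v0: "v 0 = 0" using v_scaleR[OF H_closed(1), of 0] by simp
    obtain z where z: "z \<in> Z" and zmax: "\<And>y. y \<in> Z \<Longrightarrow> z \<le> y \<Longrightarrow> y = z"
    proof (rule zorn_directed)
      have "0 \<in> Z" using a v0 zero_in_L1 by (auto simp: Z_def)
      then show "Z \<noteq> {}" by blast
      fix C assume C: "C \<subseteq> Z" "upward_directed C"
      have C': "0 \<le> y" "y \<le> a" "v y \<le> e *\<^sub>R \<tau> y" "y \<in> H" if "y \<in> C" for y
        using C that small by (auto simp: Z_def)
      define s where "s = Sup C"
      have "C \<noteq> {}" using C(2) by (auto simp: upward_directed_def)
      then have s: "has_sup C s" unfolding s_def using C' by (intro has_sup_Sup) auto
      obtain y0 where "y0 \<in> C" using \<open>C \<noteq> {}\<close> by blast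
      then have s0: "0 \<le> s" using C'(1) has_sup_upper[OF s] by (meson order_trans)
      have sa: "s \<le> a" by (rule has_sup_least[OF s C'(2)])
      note sH = small[OF s0 sa]
      have "f s \<le> e *\<^sub>R \<tau> s + \<tau> (s * h)"
      proof (rule has_sup_least[OF f_cont[OF _ _ C(2) s sH]])
        fix w assume "w \<in> f ` C"
        then obtain y where y: "y \<in> C" "w = f y" by blast
        have "w = v y + \<tau> (y * h)" using y by (simp add: v_def)
        also have "\<dots> \<le> e *\<^sub>R \<tau> s + \<tau> (s * h)"
        proof (rule add_mono)
          have "\<tau> y \<le> \<tau> s" using y C' sH has_sup_upper[OF s] by (intro cond_ext_mono L2_in_L1) auto
          then have "e *\<^sub>R \<tau> y \<le> e *\<^sub>R \<tau> s" using e by (intro scaleR_left_mono) auto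
          then show "v y \<le> e *\<^sub>R \<tau> s" using C'(3)[OF y(1)] by order
          show "\<tau> (y * h) \<le> \<tau> (s * h)"
            using y C' sH hH h0 has_sup_upper[OF s] by (intro cond_ext_mono mL mult_right_mono) auto
        qed
        finally show "w \<le> e *\<^sub>R \<tau> s + \<tau> (s * h)" .
      qed (use C' in auto)
      then have "s \<in> Z" using s0 sa by (simp add: Z_def v_def algebra_simps)
      then show "\<exists>u\<in>Z. \<forall>c\<in>C. c \<le> u" using has_sup_upper[OF s] by blast
    qed blast
    have z': "0 \<le> z" "z \<le> a" "v z \<le> e *\<^sub>R \<tau> z" "z \<in> H" using z small by (auto simp: Z_def)
    define p where "p = a - z"
    have p: "0 \<le> p" "p \<le> a" "p \<le> 1" "p \<in> H"
      using z' a small[of p] by (auto simp: p_def diff_le_eq add_increasing2)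
    have low: "e *\<^sub>R \<tau> w \<le> v w" if w: "0 \<le> w" "w \<le> p" for w
    proof -
      have wH: "w \<in> H" using small w p by auto
      define t where "t = e *\<^sub>R \<tau> w - v w"
      have tA: "t \<in> A" unfolding t_def
        using A_closed cond_ext_in_A[OF L2_in_L1[OF wH]] v_in[OF wH] by auto
      \<comment> \<open>The component on which e \<tau> w exceeds v w. Adding \<open>q * w\<close>
        to \<open>z\<close> stays in \<open>Z\<close>, so maximality forces
        \<open>q * w = 0\<close>, and with it the excess \<open>pprt t\<close> vanishes.\<close>
      define q where "q = support (pprt t)"
      have q: "q \<in> A" "0 \<le> q" "q \<le> 1" "q * t = pprt t"
        unfolding q_def using A_support[OF A_closed(8)[OF tA] zero_le_pprt] support_pprt_mult[of t]
          support_nonneg[OF zero_le_pprt, of t] support_le_one[OF zero_le_pprt, of t]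
        by auto
      have qw: "0 \<le> q * w" "q * w \<le> w" using q w mult_right_mono[of q 1 w] by auto
      have qwH: "q * w \<in> H" using q wH L2_A_mult by blast
      have e1: "e *\<^sub>R \<tau> (q * w) - v (q * w) = pprt t"
        using q(4) averaging(2)[OF L2_in_L1[OF wH] q(1)] v_A[OF q(1) wH]
        by (simp add: t_def algebra_simps)
      then have "v (q * w) \<le> e *\<^sub>R \<tau> (q * w)" by (metis diff_ge_0_iff_ge zero_le_pprt)
      then have "v (z + q * w) \<le> e *\<^sub>R \<tau> (z + q * w)"
        using z' qwH by (simp add: v_add L1_add L2_in_L1 scaleR_add_right add_mono)
      moreover have "z + q * w \<le> z + p" using qw(2) w(2) by (intro add_left_mono) order
      then have "z + q * w \<le> a" by (simp add: p_def)
      ultimately have "z + q * w \<in> Z" using z' qw by (simp add: Z_def)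
      then have "z + q * w = z" using qw by (intro zmax) auto
      then have "q * w = 0" by simp
      then have "pprt t = 0" using e1 v0 zero_in_L1 by simp
      then show ?thesis using le_pprt[of t] by (simp add: t_def)
    qed
    have step: "e *\<^sub>R \<tau> (x * p) \<le> v x" if x: "x \<in> H" "0 \<le> x" for x
    proof -
      let ?t = "\<lambda>n::nat. inf x (real n *\<^sub>R 1)"
      note t = has_sup_truncations_H[OF x]
      have le: "e *\<^sub>R \<tau> (?t n * p) \<le> v x" for n
      proof (cases "n = 0")
        case True
        then show ?thesis using x v_pos zero_in_L1 by (simp add: inf_absorb2)
      next
        case False
        \<comment> \<open>The scaling by n gives \<open>w \<le> p\<close>, so that
          \<open>low\<close> applies; \<open>p \<le> 1\<close> gives
          \<open>w \<le> ?t n /\<^sub>R real n\<close>, so that \<open>v w\<close> is controlled by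
          \<open>v x\<close>.\<close>
        define w where "w = (?t n /\<^sub>R real n) * p"
        have n: "?t n /\<^sub>R real n \<le> 1" using False by (simp add: pos_divideR_le_eq)
        have n0: "0 \<le> ?t n /\<^sub>R real n" using t(2)[of n] by (intro scaleR_nonneg_nonneg) auto
        have w: "0 \<le> w" "w \<le> p" "w \<le> ?t n /\<^sub>R real n"
          unfolding w_def
          using mult_nonneg_nonneg[OF n0 p(1)] mult_right_mono[OF n p(1)] mult_left_mono[OF p(3) n0]
          by simp_all
        have wH: "w \<in> H" using small w p by auto
        have e: "?t n * p = real n *\<^sub>R w" using False by (simp add: w_def)
        have "e *\<^sub>R \<tau> w \<le> v w" using w by (intro low)
        also have "\<dots> \<le> v (?t n /\<^sub>R real n)" using wH t(1)[of n] H_closed(4) w(3) by (intro v_mono) auto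
        finally have "real n *\<^sub>R (e *\<^sub>R \<tau> w) \<le> real n *\<^sub>R v (?t n /\<^sub>R real n)"
          by (intro scaleR_left_mono) auto
        also have "\<dots> = v (?t n)" using v_scaleR[OF t(1)[of n]] False by simp
        also have "\<dots> \<le> v x" using t(1)[of n] x by (intro v_mono) auto
        finally show ?thesis unfolding e using L1_scaleR[OF L2_in_L1[OF wH]] by (simp add: mult.commute)
      qed
      have "has_sup (\<tau> ` (*) p ` range ?t) (\<tau> (p * x))"
      proof (rule monotone_convergence(2)[OF _ _ _ has_sup_mult[OF has_sup_truncations p(1)], of _ "\<tau> (p * x)"])
        show "upward_directed ((*) p ` range ?t)"
          by (rule upward_directed_image[OF t(3)]) (use p in \<open>auto intro: mult_left_mono\<close>)
      qed (use p x t(1,2) mL in \<open>auto intro!: cond_ext_mono mult_left_mono mult_nonneg_nonneg\<close>)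
      then have "has_sup ((*\<^sub>R) e ` \<tau> ` (*) p ` range ?t) (e *\<^sub>R \<tau> (p * x))"
        using e by (rule has_sup_scaleR)
      then have "e *\<^sub>R \<tau> (p * x) \<le> v x"
        by (rule has_sup_least) (use le in \<open>auto simp: mult.commute\<close>)
      then show ?thesis by (simp add: mult.commute)
    qed
    have "h + e *\<^sub>R p \<in> G"
    proof -
      have "\<tau> (x * (h + e *\<^sub>R p)) \<le> f x" if x: "x \<in> H" "0 \<le> x" for x
      proof -
        have "\<tau> (x * (h + e *\<^sub>R p)) = \<tau> (x * h) + e *\<^sub>R \<tau> (x * p)"
          using mL[OF x(1) hH] mL[OF x(1) p(4)] by (simp add: distrib_left L1_add L1_scaleR)
        then show ?thesis using step[OF x] by (simp add: v_def algebra_simps)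
      qed
      then show ?thesis using hH h0 p e H_closed
        by (auto simp: G_def intro!: add_nonneg_nonneg scaleR_nonneg_nonneg)
    qed
    then have "h + e *\<^sub>R p = h" using p e by (intro hmax) (auto intro: scaleR_nonneg_nonneg)
    \<comment> \<open>Now \<open>z = a\<close>, so \<open>a\<close> itself satisfies the inequality
      defining \<open>Z\<close>, which says \<open>b \<le> 0\<close>.\<close>
    then have "p = 0" using e by simp
    then have "v a \<le> e *\<^sub>R a" using z'(3) cond_ext_A[OF a(1)] by (simp add: p_def)
    then have "b \<le> 0" unfolding va[symmetric] by simp
    then show "v 1 \<le> e *\<^sub>R 1" using le_pprt[of "v 1 - e *\<^sub>R 1", folded b_def]
      by (metis diff_le_0_iff_le order_trans)
  qed
  \<comment> \<open>\<open>v\<close> is monotone and nonpositive at 1, hence nonpositive on every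
    truncation of x; order continuity of \<open>f\<close> passes to x.\<close>
  have fpos: "f x = \<tau> (x * h)" if x: "x \<in> H" "0 \<le> x" for x
  proof -
    let ?t = "\<lambda>n::nat. inf x (real n *\<^sub>R 1)"
    note t = has_sup_truncations_H[OF x]
    have "f x \<le> \<tau> (x * h)"
    proof (rule has_sup_least[OF f_cont[OF _ _ t(3) has_sup_truncations x(1)]])
      fix w assume "w \<in> f ` range ?t"
      then obtain n where w: "w = f (?t n)" by auto
      have "v (?t n) \<le> v (real n *\<^sub>R 1)" using t(1) one_in_H H_closed(4) by (intro v_mono) auto
      also have "\<dots> \<le> 0" using v_scaleR[OF one_in_H] v1 by (simp add: scaleR_nonneg_nonpos)
      finally have "w \<le> \<tau> (?t n * h)" by (simp add: w v_def)
      also have "\<dots> \<le> \<tau> (x * h)" using t(1) x hH h0 by (intro cond_ext_mono mL mult_right_mono) auto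
      finally show "w \<le> \<tau> (x * h)" .
    qed (use t in auto)
    then show ?thesis using hf[OF x] by simp
  qed
  have "f x = \<tau> (x * h)" if x: "x \<in> H" for x
  proof -
    have pp: "pprt x \<in> H" "pprt (- x) \<in> H" using x H_closed by auto
    have "f x + f (pprt (- x)) = f (pprt x)"
      using f_add[OF x pp(2)] pprt_minus_pprt[of x] by (metis diff_add_cancel)
    then have "f x = f (pprt x) - f (pprt (- x))" by (simp only: eq_diff_eq)
    moreover have "x * h = pprt x * h - pprt (- x) * h"
      using pprt_minus_pprt[of x] by (metis left_diff_distrib)
    then have "\<tau> (x * h) = \<tau> (pprt x * h) - \<tau> (pprt (- x) * h)"
      using L1_diff(2)[OF mL[OF pp(1) hH] mL[OF pp(2) hH]] by simp
    ultimately show ?thesis using fpos[OF pp(1)] fpos[OF pp(2)] by simp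
  qed
  then show ?thesis using that hH by blast
qed

section \<open>Bounded operators and adjoints\<close>

text \<open>Tested on x = \<open>pprt (- h)\<close> the product has expectation
  \<open>- \<tau> (x * x)\<close>, so strict positivity gives x = 0. Through the next two lemmas
  this nondegeneracy yields uniqueness of adjoints and order comparison of operators by
  duality.\<close>

lemma L2_nonnegI:
  assumes h: "h \<in> H" and le: "\<And>x. x \<in> H \<Longrightarrow> 0 \<le> x \<Longrightarrow> 0 \<le> \<tau> (x * h)"
  shows "0 \<le> h"
proof -
  let ?n = "pprt (- h)"
  have n: "?n \<in> H" using H_closed(8)[OF H_closed(5)[OF h]] .
  have "?n * h = ?n * (pprt h - ?n)" by (rule arg_cong[OF pprt_minus_pprt])
  also have "\<dots> = - (?n * ?n)" by (simp add: right_diff_distrib pprt_mult_pprt_minus)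
  finally have "\<tau> (?n * h) = - \<tau> (?n * ?n)" using L1_minus(2)[OF L2_mult[OF n n]] by simp
  then have "\<tau> (?n * ?n) \<le> 0" using le[OF n] by simp
  then have "?n * ?n = 0" using L2_mult[OF n n] mult_self_nonneg by (intro cond_ext_strict)
  then have "?n = 0" by (rule mult_self_eq_0_imp)
  then show ?thesis using pprt_minus_pprt[of h] by (metis diff_zero zero_le_pprt)
qed

lemma L2_leI:
  assumes h: "h \<in> H" "k \<in> H" and le: "\<And>x. x \<in> H \<Longrightarrow> 0 \<le> x \<Longrightarrow> \<tau> (x * h) \<le> \<tau> (x * k)"
  shows "h \<le> k"
proof -
  have "0 \<le> k - h"
  proof (rule L2_nonnegI)
    fix x assume x: "x \<in> H" "0 \<le> x"
    show "0 \<le> \<tau> (x * (k - h))"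
      using le[OF x] L1_diff(2)[OF L2_mult[OF x(1) h(2)] L2_mult[OF x(1) h(1)]]
      by (simp add: right_diff_distrib)
  qed (use h H_closed in auto)
  then show ?thesis by simp
qed

lemma L2_eqI:
  assumes "h \<in> H" "k \<in> H" "\<And>x. x \<in> H \<Longrightarrow> \<tau> (x * h) = \<tau> (x * k)"
  shows "h = k"
proof (rule order_antisym)
  show "h \<le> k" by (rule L2_leI) (use assms in auto)
  show "k \<le> h" by (rule L2_leI) (use assms in auto)
qed

abbreviation B :: "('u \<Rightarrow> 'u) set" where "B \<equiv> bounded_ops E T"

lemma bounded_ops_iff:
  "S \<in> B \<longleftrightarrow> S \<in> H \<rightarrow>\<^sub>E H \<and> (\<forall>x\<in>H. \<forall>y\<in>H. S (x + y) = S x + S y) \<and>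
     (\<forall>a\<in>A. \<forall>x\<in>H. S (a * x) = a * S x) \<and>
     (\<exists>k\<in>A. 0 \<le> k \<and> (\<forall>x\<in>H. \<tau> (S x * S x) \<le> (k * k) * \<tau> (x * x)))"
proof -
  have "(\<forall>x\<in>H. norm_T E T (S x) \<le> k * norm_T E T x) \<longleftrightarrow>
      (\<forall>x\<in>H. \<tau> (S x * S x) \<le> (k * k) * \<tau> (x * x))" if "S \<in> H \<rightarrow>\<^sub>E H" "0 \<le> k" for k
    using norm_T_le_iff[OF _ _ that(2)] that(1) by blast
  then show ?thesis unfolding bounded_ops_def by (simp add: conj_assoc) blast
qed

lemma bounded_opsD:
  assumes "S \<in> B"
  shows "S \<in> H \<rightarrow>\<^sub>E H" "x \<in> H \<Longrightarrow> S x \<in> H" "x \<in> H \<Longrightarrow> y \<in> H \<Longrightarrow> S (x + y) = S x + S y"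
    "a \<in> A \<Longrightarrow> x \<in> H \<Longrightarrow> S (a * x) = a * S x"
  using assms by (auto simp: bounded_ops_def)

lemma bounded_ops_scaleR: "S \<in> B \<Longrightarrow> x \<in> H \<Longrightarrow> S (c *\<^sub>R x) = c *\<^sub>R S x"
  using bounded_opsD(4)[of S "c *\<^sub>R 1" x] A_closed(4)[OF one_in_A] by simp

lemma bounded_ops_minus: "S \<in> B \<Longrightarrow> x \<in> H \<Longrightarrow> S (- x) = - S x"
  using bounded_ops_scaleR[of S x "-1"] by simp

lemma bounded_ops_diff: "S \<in> B \<Longrightarrow> x \<in> H \<Longrightarrow> y \<in> H \<Longrightarrow> S (x - y) = S x - S y"
  using bounded_opsD(3)[of S x "- y"] bounded_ops_minus[of S y] H_closed(5) by simp

lemma cond_ext_mult_self_add_le: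
  assumes "u \<in> H" "v \<in> H"
  shows "\<tau> ((u + v) * (u + v)) \<le> 2 *\<^sub>R (\<tau> (u * u) + \<tau> (v * v))"
proof -
  have "(u + v) * (u + v) \<le> 2 *\<^sub>R (u * u + v * v)"
    using two_mult_le[of u v] by (simp add: algebra_simps scaleR_2)
  moreover have "u * u + v * v \<in> L" "(u + v) * (u + v) \<in> L"
    using assms H_closed(2)[OF assms] L2_mult L1_add by auto
  ultimately have "\<tau> ((u + v) * (u + v)) \<le> 2 *\<^sub>R \<tau> (u * u + v * v)"
    using cond_ext_mono L1_scaleR by metis
  then show ?thesis using L1_add[OF L2_mult[OF assms(1,1)] L2_mult[OF assms(2,2)]] by simp
qed

lemma bounded_ops_lincomb:
  assumes R: "R \<in> B" and Q: "Q \<in> B"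
  shows "(\<lambda>x\<in>H. c *\<^sub>R R x + d *\<^sub>R Q x) \<in> B"
proof -
  obtain k where k: "k \<in> A" "0 \<le> k" "\<And>x. x \<in> H \<Longrightarrow> \<tau> (R x * R x) \<le> (k * k) * \<tau> (x * x)"
    using R unfolding bounded_ops_iff by blast
  obtain l where l: "l \<in> A" "0 \<le> l" "\<And>x. x \<in> H \<Longrightarrow> \<tau> (Q x * Q x) \<le> (l * l) * \<tau> (x * x)"
    using Q unfolding bounded_ops_iff by blast
  \<comment> \<open>Any constant whose square dominates both 2 c^2 and 2 d^2 would do; the factors 2
    come from \<open>cond_ext_mult_self_add_le\<close>.\<close>
  define K where "K = 2 * (\<bar>c\<bar> + \<bar>d\<bar>)"
  have "2 * c\<^sup>2 \<le> K * K" "2 * d\<^sup>2 \<le> K * K"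
  proof -
    define q where "q = \<bar>c\<bar> * \<bar>d\<bar>"
    have i: "K * K = 4 * c\<^sup>2 + 8 * q + 4 * d\<^sup>2"
      by (simp add: K_def q_def power2_eq_square algebra_simps)
    have j: "0 \<le> q" "0 \<le> c\<^sup>2" "0 \<le> d\<^sup>2" by (auto simp: q_def)
    show "2 * c\<^sup>2 \<le> K * K" using i j by linarith
    show "2 * d\<^sup>2 \<le> K * K" using i j by linarith
  qed
  note K = this
  define m where "m = K *\<^sub>R (k + l)"
  have m: "m \<in> A" "0 \<le> m" unfolding m_def K_def using k l A_closed
    by (auto intro!: scaleR_nonneg_nonneg add_nonneg_nonneg)
  have mm: "m * m = (K * K) *\<^sub>R (k * k + l * l) + (K * K) *\<^sub>R (k * l + k * l)"
    by (simp add: m_def algebra_simps)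
  have bound: "\<tau> ((c *\<^sub>R R x + d *\<^sub>R Q x) * (c *\<^sub>R R x + d *\<^sub>R Q x)) \<le> (m * m) * \<tau> (x * x)"
    if x: "x \<in> H" for x
  proof -
    have RQ: "R x \<in> H" "Q x \<in> H" using bounded_opsD(2) R Q x by auto
    have xx: "0 \<le> \<tau> (x * x)" using L2_mult[OF x x] mult_self_nonneg by (rule cond_ext_nonneg)
    have sq: "\<tau> ((c *\<^sub>R u) * (c *\<^sub>R u)) = c\<^sup>2 *\<^sub>R \<tau> (u * u)" if "u \<in> H" for c u
      using L1_scaleR(2)[OF L2_mult[OF that that], of "c\<^sup>2"] by (simp add: power2_eq_square)
    have est: "2 *\<^sub>R (c\<^sup>2 *\<^sub>R z) \<le> (K * K) *\<^sub>R ((j * j) * \<tau> (x * x))"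
      if "z \<le> (j * j) * \<tau> (x * x)" "2 * c\<^sup>2 \<le> K * K" "0 \<le> j" for j z and c :: real
    proof -
      have "2 *\<^sub>R (c\<^sup>2 *\<^sub>R z) \<le> (2 * c\<^sup>2) *\<^sub>R ((j * j) * \<tau> (x * x))"
        using that(1) by (simp only: scaleR_scaleR) (intro scaleR_left_mono; simp)
      also have "\<dots> \<le> (K * K) *\<^sub>R ((j * j) * \<tau> (x * x))"
        using that xx by (intro scaleR_right_mono mult_nonneg_nonneg) auto
      finally show ?thesis .
    qed
    have "\<tau> ((c *\<^sub>R R x + d *\<^sub>R Q x) * (c *\<^sub>R R x + d *\<^sub>R Q x))
        \<le> 2 *\<^sub>R (c\<^sup>2 *\<^sub>R \<tau> (R x * R x)) + 2 *\<^sub>R (d\<^sup>2 *\<^sub>R \<tau> (Q x * Q x))"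
      using cond_ext_mult_self_add_le[of "c *\<^sub>R R x" "d *\<^sub>R Q x"] RQ H_closed(4)
      by (simp only: sq scaleR_add_right)
    also have "\<dots> \<le> (K * K) *\<^sub>R ((k * k) * \<tau> (x * x)) + (K * K) *\<^sub>R ((l * l) * \<tau> (x * x))"
      using k l K x by (intro add_mono est) auto
    also have "\<dots> \<le> (m * m) * \<tau> (x * x)"
    proof -
      have "0 \<le> ((K * K) *\<^sub>R (k * l + k * l)) * \<tau> (x * x)"
        using k l xx by (intro mult_nonneg_nonneg[OF scaleR_nonneg_nonneg] add_nonneg_nonneg) auto
      then show ?thesis unfolding mm by (simp add: algebra_simps)
    qed
    finally show ?thesis .
  qed
  show ?thesis
    unfolding bounded_ops_iff
  proof (intro conjI)
    show "(\<lambda>x\<in>H. c *\<^sub>R R x + d *\<^sub>R Q x) \<in> H \<rightarrow>\<^sub>E H"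
      using bounded_opsD(2)[OF R] bounded_opsD(2)[OF Q] H_closed by auto
    show "\<forall>x\<in>H. \<forall>y\<in>H. (\<lambda>x\<in>H. c *\<^sub>R R x + d *\<^sub>R Q x) (x + y) =
        (\<lambda>x\<in>H. c *\<^sub>R R x + d *\<^sub>R Q x) x + (\<lambda>x\<in>H. c *\<^sub>R R x + d *\<^sub>R Q x) y"
      using bounded_opsD(3)[OF R] bounded_opsD(3)[OF Q] H_closed by (auto simp: algebra_simps)
    show "\<forall>a\<in>A. \<forall>x\<in>H. (\<lambda>x\<in>H. c *\<^sub>R R x + d *\<^sub>R Q x) (a * x) = a * (\<lambda>x\<in>H. c *\<^sub>R R x + d *\<^sub>R Q x) x"
      using bounded_opsD(4)[OF R] bounded_opsD(4)[OF Q] L2_A_mult by (auto simp: algebra_simps)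
  qed (use m bound in auto)
qed

text \<open>Young's inequality \<open>2 u (k + 1) y \<le> u\<^sup>2 + (k + 1)\<^sup>2 y\<^sup>2\<close> replaces Cauchy-Schwarz here,
  so that no division in \<open>A\<close> is needed.\<close>

lemma young_bound:
  assumes k: "k \<in> A" "0 \<le> k" and uyg: "u \<in> H" "y \<in> H" "g \<in> H"
    and 1: "\<tau> (u * u) \<le> k * \<tau> (g * g)" and 2: "\<tau> (g * g) \<le> \<tau> (u * y)"
  shows "\<tau> (g * g) \<le> ((k + 1) * (k + 1)) * \<tau> (y * y)"
proof -
  let ?k = "k + 1" and ?X = "\<tau> (g * g)"
  have kA: "?k \<in> A" "0 \<le> ?k" using k one_in_A A_closed f_one_nonneg by (auto intro: add_nonneg_nonneg)
  have X: "0 \<le> ?X" using L2_mult uyg mult_self_nonneg by (intro cond_ext_nonneg) auto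
  have yk: "?k * y \<in> H" using kA uyg L2_A_mult by blast
  have mem: "u * u \<in> L" "u * (?k * y) \<in> L" "(?k * y) * (?k * y) \<in> L"
    using uyg yk L2_mult by auto
  have "\<tau> (u * (?k * y)) = ?k * \<tau> (u * y)"
    using averaging(2)[OF L2_mult[OF uyg(1,2)] kA(1)] by (simp add: mult.left_commute)
  moreover have "\<tau> ((?k * y) * (?k * y)) = (?k * ?k) * \<tau> (y * y)"
    using averaging(2)[OF L2_mult[OF uyg(2,2)] A_mult[OF kA(1,1)]] by (simp add: mult_ac)
  moreover have "\<tau> (u * (?k * y) + u * (?k * y)) \<le> \<tau> (u * u + (?k * y) * (?k * y))"
    using mem two_mult_le by (intro cond_ext_mono L1_add) auto
  ultimately have "?k * \<tau> (u * y) + ?k * \<tau> (u * y) \<le> \<tau> (u * u) + (?k * ?k) * \<tau> (y * y)"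
    using mem by (simp only: L1_add)
  moreover have "?k * ?X + ?k * ?X \<le> ?k * \<tau> (u * y) + ?k * \<tau> (u * y)"
    using 2 kA by (intro add_mono mult_left_mono)
  ultimately have "?k * ?X + ?k * ?X \<le> k * ?X + (?k * ?k) * \<tau> (y * y)"
    using 1 by (meson add_right_mono order_trans)
  \<comment> \<open>The reason for the weight k + 1: subtracting \<open>k * ?X\<close> from twice
    \<open>(k + 1) * ?X\<close> leaves \<open>(k + 2) * ?X\<close>, which dominates
    \<open>?X\<close>.\<close>
  then have "(k * ?X + ?X) + ?X \<le> (?k * ?k) * \<tau> (y * y)" by (simp add: algebra_simps)
  moreover have "0 \<le> k * ?X + ?X" using k X by (intro add_nonneg_nonneg mult_nonneg_nonneg)
  ultimately show ?thesis using X by (meson add_increasing order_refl order_trans)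
qed

text \<open>With u = S (s - x), use 2uy \<le> u^2 / e + e y^2. Strong boundedness estimates the
  expectation of u^2 by that of (s - x)^2, and (s - x)^2 \<le> s^2 - x^2 since 0 \<le> x \<le> s.
  The latter expectations decrease to 0 along \<open>D\<close>, leaving
  \<open>e *\<^sub>R \<tau> (y * y)\<close> for arbitrary e.\<close>

lemma functional_order_continuous:
  assumes S: "S \<in> B" "order_positive H S" and y: "y \<in> H" "0 \<le> y"
    and D: "D \<subseteq> H" "\<And>x. x \<in> D \<Longrightarrow> 0 \<le> x" "upward_directed D" "has_sup D s" "s \<in> H"
  shows "has_sup ((\<lambda>x. \<tau> (S x * y)) ` D) (\<tau> (S s * y))"
proof (rule has_sup_diffI)
  note S' = bounded_opsD[OF S(1)]
  obtain k where k: "k \<in> A" "0 \<le> k" "\<And>x. x \<in> H \<Longrightarrow> \<tau> (S x * S x) \<le> (k * k) * \<tau> (x * x)"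
    using S(1) unfolding bounded_ops_iff by blast
  have kk: "0 \<le> k * k" by (rule mult_self_nonneg)
  have diff: "s - x \<in> H" "0 \<le> s - x" if "x \<in> D" for x
    using that D has_sup_upper[OF D(4)] H_closed(3) by auto
  have f_diff: "\<tau> (S s * y) - \<tau> (S x * y) = \<tau> (S (s - x) * y)" if "x \<in> D" for x
  proof -
    have x: "x \<in> H" using that D by blast
    have "S (s - x) * y = S s * y - S x * y"
      using bounded_ops_diff[OF S(1) D(5) x] by (simp add: left_diff_distrib)
    then show ?thesis
      using L1_diff(2)[OF L2_mult[OF S'(2)[OF D(5)] y(1)] L2_mult[OF S'(2)[OF x] y(1)]] by simp
  qed
  {
    fix z assume "z \<in> (\<lambda>x. \<tau> (S x * y)) ` D"
    then obtain x where x: "x \<in> D" "z = \<tau> (S x * y)" by blast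
    have "0 \<le> S (s - x) * y" using S(2) diff[OF x(1)] y by (auto simp: order_positive_def)
    then have "0 \<le> \<tau> (S (s - x) * y)"
      using L2_mult[OF S'(2)[OF diff(1)[OF x(1)]] y(1)] by (intro cond_ext_nonneg)
    then show "z \<le> \<tau> (S s * y)" unfolding f_diff[OF x(1), symmetric] x(2) by simp
  }
  fix l assume l: "\<And>z. z \<in> (\<lambda>x. \<tau> (S x * y)) ` D \<Longrightarrow> l \<le> \<tau> (S s * y) - z"
  have sq: "has_sup ((\<lambda>x. x * x) ` D) (s * s)" by (rule has_sup_mult_self[OF D(4,2,3)])
  have dir2: "upward_directed ((\<lambda>x. x * x) ` D)"
    by (rule upward_directed_image[OF D(3)]) (use D in \<open>auto intro: mult_self_mono\<close>)
  have "has_sup (\<tau> ` (\<lambda>x. x * x) ` D) (\<tau> (s * s))"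
    by (rule monotone_convergence(2)[OF _ _ dir2 sq, of "\<tau> (s * s)"])
      (use D has_sup_upper[OF sq] L2_mult mult_self_nonneg in \<open>auto intro!: cond_ext_mono\<close>)
  note sup2 = has_sup_mult[OF this]
  have "l + l \<le> 0"
  proof (rule archimedean_eps)
    show yy: "0 \<le> \<tau> (y * y)" using L2_mult[OF y(1,1)] mult_self_nonneg by (rule cond_ext_nonneg)
    fix e :: real assume e: "0 < e"
    define K where "K = (1 / e) *\<^sub>R (k * k)"
    have K: "0 \<le> K" unfolding K_def using e kk by (intro scaleR_nonneg_nonneg) auto
    have "l + l - e *\<^sub>R \<tau> (y * y) \<le> 0"
    proof (rule has_sup_diff[OF sup2[OF K]])
      fix z assume "z \<in> (*) K ` \<tau> ` (\<lambda>x. x * x) ` D"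
      then obtain x where x: "x \<in> D" "z = K * \<tau> (x * x)" by blast
      have xH: "x \<in> H" using x D by blast
      let ?u = "S (s - x)" and ?d = "s - x"
      note uH = S'(2)[OF diff(1)[OF x(1)]]
      have mem: "?u * y \<in> L" "?u * ?u \<in> L" "y * y \<in> L" "x * x \<in> L" "s * s \<in> L" "?d * ?d \<in> L"
        using L2_mult uH y diff[OF x(1)] xH D(5) by auto
      have "l \<le> \<tau> (?u * y)" using l[OF imageI[OF x(1)]] unfolding f_diff[OF x(1)] .
      then have "l + l \<le> \<tau> (?u * y) + \<tau> (?u * y)" by (intro add_mono)
      also have "\<dots> = \<tau> (?u * y + ?u * y)" using mem by (simp add: L1_add)
      also have "\<dots> \<le> \<tau> ((1 / e) *\<^sub>R (?u * ?u) + e *\<^sub>R (y * y))"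
      proof (rule cond_ext_mono)
        have "?u * y + ?u * y \<le> ((1 / sqrt e) *\<^sub>R ?u) * ((1 / sqrt e) *\<^sub>R ?u) + (sqrt e *\<^sub>R y) * (sqrt e *\<^sub>R y)"
          using two_mult_le[of "(1 / sqrt e) *\<^sub>R ?u" "sqrt e *\<^sub>R y"] e by simp
        also have "\<dots> = (1 / e) *\<^sub>R (?u * ?u) + e *\<^sub>R (y * y)" using e by simp
        finally show "?u * y + ?u * y \<le> (1 / e) *\<^sub>R (?u * ?u) + e *\<^sub>R (y * y)" .
      qed (use mem in \<open>auto intro!: L1_add L1_scaleR\<close>)
      also have "\<dots> = (1 / e) *\<^sub>R \<tau> (?u * ?u) + e *\<^sub>R \<tau> (y * y)"
        using mem by (simp add: L1_add L1_scaleR)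
      also have "(1 / e) *\<^sub>R \<tau> (?u * ?u) \<le> (1 / e) *\<^sub>R ((k * k) * \<tau> (?d * ?d))"
        using k(3)[OF diff(1)[OF x(1)]] e by (intro scaleR_left_mono) auto
      also have "(1 / e) *\<^sub>R ((k * k) * \<tau> (?d * ?d)) = K * \<tau> (?d * ?d)" by (simp add: K_def)
      also have "\<dots> \<le> K * \<tau> (s * s - x * x)"
      proof (intro mult_left_mono K cond_ext_mono L1_diff mem)
        have "x * x \<le> s * x" using diff(2)[OF x(1)] D(2)[OF x(1)] by (intro mult_right_mono) auto
        then have "x * x + x * x \<le> s * x + s * x" by (intro add_mono)
        then show "?d * ?d \<le> s * s - x * x" by (simp add: algebra_simps)
      qed
      also have "\<dots> = K * \<tau> (s * s) - z" using mem x by (simp add: L1_diff right_diff_distrib)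
      finally show "l + l - e *\<^sub>R \<tau> (y * y) \<le> K * \<tau> (s * s) - z" by (simp add: diff_le_eq)
    qed
    then show "l + l \<le> e *\<^sub>R \<tau> (y * y)" by simp
  qed
  then show "l \<le> 0" by simp
qed

lemma positive_adjoint_exists:
  assumes S: "S \<in> positive_ops E T"
  obtains R where "R \<in> positive_ops E T" "\<And>x y. x \<in> H \<Longrightarrow> y \<in> H \<Longrightarrow> \<tau> (S x * y) = \<tau> (x * R y)"
proof -
  have SB: "S \<in> B" "order_positive H S" using S by (auto simp: positive_ops_def)
  note S' = bounded_opsD[OF SB(1)]
  obtain k where k: "k \<in> A" "0 \<le> k" "\<And>x. x \<in> H \<Longrightarrow> \<tau> (S x * S x) \<le> (k * k) * \<tau> (x * x)"
    using SB(1) unfolding bounded_ops_iff by blast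
  define K where "K = k * k"
  have K: "K \<in> A" "0 \<le> K" "K + 1 \<in> A" "0 \<le> K + 1"
    unfolding K_def using k A_mult mult_self_nonneg A_closed one_in_A f_one_nonneg by (auto intro: add_nonneg_nonneg)
  note kK = k(3)[folded K_def]
  have SL: "S x * y \<in> L" if "x \<in> H" "y \<in> H" for x y using L2_mult[OF S'(2)[OF that(1)] that(2)] .
  have pos: "\<exists>h\<in>H. \<forall>x\<in>H. \<tau> (S x * y) = \<tau> (x * h)" if y: "y \<in> H" "0 \<le> y" for y
  proof -
    obtain h where "h \<in> H" "\<And>x. x \<in> H \<Longrightarrow> \<tau> (S x * y) = \<tau> (x * h)"
    proof (rule riesz_representation[where f = "\<lambda>x. \<tau> (S x * y)" and c = "((K + 1) * (K + 1)) * \<tau> (y * y)"])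
      show "\<tau> (S (x + x') * y) = \<tau> (S x * y) + \<tau> (S x' * y)" if "x \<in> H" "x' \<in> H" for x x'
        using that SL y(1) S'(3) by (simp add: distrib_right L1_add)
      show "\<tau> (S (a * x) * y) = a * \<tau> (S x * y)" if "a \<in> A" "x \<in> H" for a x
        using averaging(2)[OF SL[OF that(2) y(1)] that(1)] S'(4)[OF that] by (simp add: mult.assoc)
      show "0 \<le> \<tau> (S x * y)" if "x \<in> H" "0 \<le> x" for x
        using that SB(2) y SL by (intro cond_ext_nonneg) (auto simp: order_positive_def)
      show "\<tau> (S x * y) \<in> A" if "x \<in> H" for x using cond_ext_in_A SL that y by blast
      show "has_sup ((\<lambda>x. \<tau> (S x * y)) ` D) (\<tau> (S s * y))"
        if "D \<subseteq> H" "\<And>x. x \<in> D \<Longrightarrow> 0 \<le> x" "upward_directed D" "has_sup D s" "s \<in> H" for D s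
        using functional_order_continuous[OF SB y] that by blast
      show "\<tau> (g * g) \<le> ((K + 1) * (K + 1)) * \<tau> (y * y)"
        if "g \<in> H" "0 \<le> g" "\<tau> (g * g) \<le> \<tau> (S g * y)" for g
        by (rule young_bound[OF K(1,2) S'(2)[OF that(1)] y(1) that(1) kK[OF that(1)] that(3)])
    qed blast
    then show ?thesis by blast
  qed
  have "\<exists>h\<in>H. \<forall>x\<in>H. \<tau> (S x * y) = \<tau> (x * h)" if y: "y \<in> H" for y
  proof -
    have yy: "pprt y \<in> H" "pprt (- y) \<in> H" using y H_closed by auto
    obtain h1 h2 where h: "h1 \<in> H" "h2 \<in> H" "\<And>x. x \<in> H \<Longrightarrow> \<tau> (S x * pprt y) = \<tau> (x * h1)"
      "\<And>x. x \<in> H \<Longrightarrow> \<tau> (S x * pprt (- y)) = \<tau> (x * h2)"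
      using pos[OF yy(1)] pos[OF yy(2)] by auto
    have "\<tau> (S x * y) = \<tau> (x * (h1 - h2))" if x: "x \<in> H" for x
    proof -
      have "S x * y = S x * pprt y - S x * pprt (- y)"
        using pprt_minus_pprt[of y] by (metis right_diff_distrib)
      then have "\<tau> (S x * y) = \<tau> (x * h1) - \<tau> (x * h2)"
        using L1_diff(2)[OF SL[OF x yy(1)] SL[OF x yy(2)]] h x by simp
      then show ?thesis using L1_diff(2)[OF L2_mult[OF x h(1)] L2_mult[OF x h(2)]]
        by (simp add: right_diff_distrib)
    qed
    then show ?thesis using h H_closed(3) by blast
  qed
  then obtain R0 where R0: "\<And>y. y \<in> H \<Longrightarrow> R0 y \<in> H" "\<And>x y. y \<in> H \<Longrightarrow> x \<in> H \<Longrightarrow> \<tau> (S x * y) = \<tau> (x * R0 y)"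
    by metis
  define R where "R = (\<lambda>y\<in>H. R0 y)"
  have R: "R y \<in> H" "\<And>x. x \<in> H \<Longrightarrow> \<tau> (S x * y) = \<tau> (x * R y)" if "y \<in> H" for y
    using R0 that by (auto simp: R_def)
  have "R (y + y') = R y + R y'" if "y \<in> H" "y' \<in> H" for y y'
  proof (rule L2_eqI)
    fix x assume x: "x \<in> H"
    have yy: "y + y' \<in> H" using that H_closed by blast
    have "\<tau> (x * R (y + y')) = \<tau> (S x * y + S x * y')" using R(2)[OF yy x] by (simp add: distrib_left)
    also have "\<dots> = \<tau> (x * (R y + R y'))"
      using SL[OF x] R that x L2_mult[OF x R(1)] by (simp add: L1_add distrib_left)
    finally show "\<tau> (x * R (y + y')) = \<tau> (x * (R y + R y'))" .
  qed (use that R H_closed in auto)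
  moreover have "R (a * y) = a * R y" if "a \<in> A" "y \<in> H" for a y
  proof (rule L2_eqI)
    fix x assume x: "x \<in> H"
    have ay: "a * y \<in> H" using that L2_A_mult by blast
    have "\<tau> (x * R (a * y)) = \<tau> (a * (S x * y))" using R(2)[OF ay x] by (simp add: mult_ac)
    also have "\<dots> = a * \<tau> (x * R y)" using averaging(2)[OF SL[OF x that(2)] that(1)] R(2)[OF that(2) x] by simp
    also have "\<dots> = \<tau> (a * (x * R y))" using averaging(2)[OF L2_mult[OF x R(1)[OF that(2)]] that(1)] by simp
    finally show "\<tau> (x * R (a * y)) = \<tau> (x * (a * R y))" by (simp add: mult_ac)
  qed (use that R L2_A_mult in auto)
  \<comment> \<open>\<open>young_bound\<close> a second time, with g = R y and u = S (R y); its last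
    premise is the adjoint relation at x = R y.\<close>
  moreover have "\<tau> (R y * R y) \<le> ((K + 1) * (K + 1)) * \<tau> (y * y)" if y: "y \<in> H" for y
    by (rule young_bound[OF K(1,2) S'(2)[OF R(1)[OF y]] y R(1)[OF y] kK[OF R(1)[OF y]]])
      (simp add: R[OF y])
  moreover have "R \<in> H \<rightarrow>\<^sub>E H" using R(1) by (auto simp: R_def)
  ultimately have "R \<in> B" unfolding bounded_ops_iff using K by blast
  moreover have "order_positive H R"
    unfolding order_positive_def
  proof (intro ballI impI)
    fix y assume y: "y \<in> H" "0 \<le> y"
    show "0 \<le> R y"
    proof (rule L2_nonnegI)
      fix x assume x: "x \<in> H" "0 \<le> x"
      then have "0 \<le> S x" using SB(2) by (auto simp: order_positive_def)
      then have "0 \<le> \<tau> (S x * y)" by (intro cond_ext_nonneg SL x y mult_nonneg_nonneg)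
      then show "0 \<le> \<tau> (x * R y)" by (simp only: R(2)[OF y(1) x(1)])
    qed (use R y in auto)
  qed
  ultimately have "R \<in> positive_ops E T" by (simp add: positive_ops_def)
  then show ?thesis using R(2) that by blast
qed

section \<open>Regular operators and their moduli\<close>

abbreviation POS :: "('u \<Rightarrow> 'u) set" where "POS \<equiv> positive_ops E T"
abbreviation REG :: "('u \<Rightarrow> 'u) set" where "REG \<equiv> regular_ops E T"

lemma bounded_ops_eqI: "R \<in> B \<Longrightarrow> Q \<in> B \<Longrightarrow> (\<And>x. x \<in> H \<Longrightarrow> R x = Q x) \<Longrightarrow> R = Q"
  by (rule PiE_ext[OF bounded_opsD(1) bounded_opsD(1)])

lemma adj_eqI:
  assumes R: "R \<in> B" "\<And>x y. x \<in> H \<Longrightarrow> y \<in> H \<Longrightarrow> \<tau> (S x * y) = \<tau> (x * R y)"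
  shows "adj E T S = R"
  unfolding adj_def inner_T_def
proof (rule the_equality)
  fix Q assume Q: "Q \<in> B \<and> (\<forall>x\<in>H. \<forall>y\<in>H. \<tau> (S x * y) = \<tau> (x * Q y))"
  show "Q = R"
  proof (rule bounded_ops_eqI)
    fix y assume y: "y \<in> H"
    show "Q y = R y"
      by (rule L2_eqI) (use Q R y bounded_opsD(2) in auto)
  qed (use Q R in auto)
qed (use R in auto)

lemma adj_positive:
  assumes "S \<in> POS"
  shows "adj E T S \<in> POS" "x \<in> H \<Longrightarrow> y \<in> H \<Longrightarrow> \<tau> (S x * y) = \<tau> (x * adj E T S y)"
proof -
  obtain R where R: "R \<in> POS" "\<And>x y. x \<in> H \<Longrightarrow> y \<in> H \<Longrightarrow> \<tau> (S x * y) = \<tau> (x * R y)"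
    using positive_adjoint_exists[OF assms] by blast
  then have "adj E T S = R" by (intro adj_eqI) (auto simp: positive_ops_def)
  then show "adj E T S \<in> POS" "x \<in> H \<Longrightarrow> y \<in> H \<Longrightarrow> \<tau> (S x * y) = \<tau> (x * adj E T S y)"
    using R by auto
qed

lemma positive_opsD:
  assumes "S \<in> POS"
  shows "S \<in> B" "x \<in> H \<Longrightarrow> 0 \<le> x \<Longrightarrow> 0 \<le> S x"
  using assms by (auto simp: positive_ops_def order_positive_def)

lemma positive_ops_abs_le:
  assumes "S \<in> POS" "x \<in> H"
  shows "\<bar>S x\<bar> \<le> S \<bar>x\<bar>"
  by (rule abs_additive_le[where V = H])
    (use assms positive_opsD(2)[OF assms(1)] bounded_opsD(3)[OF positive_opsD(1)[OF assms(1)]] H_closed in auto)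

lemma regular_opsE:
  assumes "S \<in> REG"
  obtains R Q where "R \<in> POS" "Q \<in> POS" "S = (\<lambda>x\<in>H. R x - Q x)"
  using assms unfolding regular_ops_def by blast

lemma bounded_ops_sub: "R \<in> B \<Longrightarrow> Q \<in> B \<Longrightarrow> (\<lambda>x\<in>H. R x - Q x) \<in> B"
  using bounded_ops_lincomb[of R Q 1 "-1"] by simp

lemma regular_in_bounded: "S \<in> REG \<Longrightarrow> S \<in> B"
  using bounded_ops_sub positive_opsD(1) by (auto elim!: regular_opsE)

lemma adj_regular:
  assumes "S \<in> REG"
  shows "adj E T S \<in> REG" "x \<in> H \<Longrightarrow> y \<in> H \<Longrightarrow> \<tau> (S x * y) = \<tau> (x * adj E T S y)"
proof -
  obtain R Q where RQ: "R \<in> POS" "Q \<in> POS" "S = (\<lambda>x\<in>H. R x - Q x)" using regular_opsE[OF assms] .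
  let ?A = "\<lambda>x\<in>H. adj E T R x - adj E T Q x"
  note pos = adj_positive(1)[OF RQ(1)] adj_positive(1)[OF RQ(2)]
  note bdd = pos[THEN positive_opsD(1)] RQ(1,2)[THEN positive_opsD(1)]
  have e: "\<tau> (S x * y) = \<tau> (x * ?A y)" if "x \<in> H" "y \<in> H" for x y
  proof -
    have "\<tau> (S x * y) = \<tau> (R x * y) - \<tau> (Q x * y)"
      using RQ(3) that L2_mult bdd(3,4)[THEN bounded_opsD(2)] by (simp add: L1_diff left_diff_distrib)
    also have "\<dots> = \<tau> (x * adj E T R y) - \<tau> (x * adj E T Q y)"
      using that adj_positive(2) RQ by simp
    also have "\<dots> = \<tau> (x * ?A y)"
      using that L2_mult bdd(1,2)[THEN bounded_opsD(2)] by (simp add: L1_diff right_diff_distrib)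
    finally show ?thesis .
  qed
  have "adj E T S = ?A" using bounded_ops_sub[OF bdd(1,2)] e by (rule adj_eqI)
  then show "adj E T S \<in> REG" "x \<in> H \<Longrightarrow> y \<in> H \<Longrightarrow> \<tau> (S x * y) = \<tau> (x * adj E T S y)"
    using e pos unfolding regular_ops_def by auto
qed

lemma adj_adj:
  assumes "S \<in> REG"
  shows "adj E T (adj E T S) = S"
proof (rule adj_eqI[OF regular_in_bounded[OF assms]])
  fix x y assume "x \<in> H" "y \<in> H"
  then show "\<tau> (adj E T S x * y) = \<tau> (x * S y)"
    using adj_regular(2)[OF assms, of y x] by (simp add: mult.commute)
qed

lemma positive_regular_eq: "positive_regular_ops E T = POS"
proof -
  have "S \<in> REG" if S: "S \<in> POS" for S
  proof -
    have zero: "(\<lambda>x\<in>H. 0) \<in> POS"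
      using bounded_ops_lincomb[OF positive_opsD(1) positive_opsD(1), OF S S, of 0 0]
      by (simp add: positive_ops_def order_positive_def)
    have "S = (\<lambda>x\<in>H. S x - (\<lambda>x\<in>H. 0) x)"
      using bounded_opsD(1)[OF positive_opsD(1)[OF S]]
      by (intro ext) (auto simp: PiE_def extensional_def)
    then show ?thesis unfolding regular_ops_def using S zero by blast
  qed
  then show ?thesis
    unfolding positive_regular_ops_def
    using regular_in_bounded by (auto simp: positive_ops_def)
qed

section \<open>The modulus of a regular operator\<close>

abbreviation modulus :: "('u \<Rightarrow> 'u) \<Rightarrow> 'u \<Rightarrow> 'u" where "modulus S \<equiv> op_modulus H S"

context
  fixes S :: "'u \<Rightarrow> 'u"
  assumes S: "S \<in> REG"
begin

text \<open>\<open>S u\<close> can replace its absolute value because the index set is symmetric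
  under u \<mapsto> - u, and the expression becomes linear in u.\<close>

definition modulus_pos :: "'u \<Rightarrow> 'u" where
  "modulus_pos x = Sup {S u | u. u \<in> H \<and> \<bar>u\<bar> \<le> x}"

lemma regular_dominated:
  obtains W where "W \<in> POS" "\<And>u. u \<in> H \<Longrightarrow> \<bar>S u\<bar> \<le> W \<bar>u\<bar>"
proof -
  obtain R Q where RQ: "R \<in> POS" "Q \<in> POS" "S = (\<lambda>x\<in>H. R x - Q x)" using regular_opsE[OF S] .
  show ?thesis
  proof (rule that)
    show "(\<lambda>x\<in>H. 1 *\<^sub>R R x + 1 *\<^sub>R Q x) \<in> POS"
      using bounded_ops_lincomb[OF RQ(1,2)[THEN positive_opsD(1)], of 1 1]
        positive_opsD(2)[OF RQ(1)] positive_opsD(2)[OF RQ(2)]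
      by (simp add: positive_ops_def order_positive_def)
    fix u assume u: "u \<in> H"
    have "\<bar>R u - Q u\<bar> \<le> \<bar>R u\<bar> + \<bar>Q u\<bar>" by (rule abs_triangle_ineq4)
    also have "\<dots> \<le> R \<bar>u\<bar> + Q \<bar>u\<bar>" using RQ u by (intro add_mono positive_ops_abs_le)
    finally show "\<bar>S u\<bar> \<le> (\<lambda>x\<in>H. 1 *\<^sub>R R x + 1 *\<^sub>R Q x) \<bar>u\<bar>"
      using u H_closed(9)[OF u] RQ(3) by simp
  qed
qed

lemmas S_bdd = regular_in_bounded[OF S]

lemma L2_absI: "x \<in> H \<Longrightarrow> \<bar>u\<bar> \<le> x \<Longrightarrow> u \<in> H"
  using L2_solid[of x u] abs_ge_zero[of u] by (metis abs_of_nonneg order_trans)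

lemma dominated_mono:
  assumes W: "W \<in> POS" "\<And>u. u \<in> H \<Longrightarrow> \<bar>S u\<bar> \<le> W \<bar>u\<bar>" and x: "x \<in> H" and u: "\<bar>u\<bar> \<le> x"
  shows "\<bar>S u\<bar> \<le> W x"
proof -
  have uH: "u \<in> H" using x u by (rule L2_absI)
  note a = H_closed(9)[OF uH]
  have "0 \<le> W (x - \<bar>u\<bar>)" using u x a H_closed(3) by (intro positive_opsD(2)[OF W(1)]) auto
  then have "W \<bar>u\<bar> \<le> W x" using bounded_ops_diff[OF positive_opsD(1)[OF W(1)] x a] by simp
  then show ?thesis using W(2)[OF uH] by order
qed

text \<open>Domination by \<open>W x\<close> puts the supremum into the solid set \<open>H\<close>.
  The supremum in the whole space is therefore also the one relative to \<open>H\<close> that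
  \<open>modulus_cone\<close> asks for.\<close>

lemma modulus_pos_props:
  assumes x: "x \<in> H" "0 \<le> x"
  shows "has_sup {S u | u. u \<in> H \<and> \<bar>u\<bar> \<le> x} (modulus_pos x)" "0 \<le> modulus_pos x" "modulus_pos x \<in> H"
    "\<bar>u\<bar> \<le> x \<Longrightarrow> \<bar>S u\<bar> \<le> modulus_pos x" "modulus_cone H S x = modulus_pos x"
proof -
  obtain W where W: "W \<in> POS" "\<And>u. u \<in> H \<Longrightarrow> \<bar>S u\<bar> \<le> W \<bar>u\<bar>" using regular_dominated by blast
  let ?N = "{S u | u. u \<in> H \<and> \<bar>u\<bar> \<le> x}"
  have le: "S u \<le> W x" if "\<bar>u\<bar> \<le> x" for u
    using dominated_mono[OF W x(1) that] by (simp add: abs_le_iff)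
  have S0: "S 0 = 0" using bounded_ops_scaleR[OF S_bdd H_closed(1), of 0] by simp
  have zero: "0 \<in> ?N" using H_closed(1) x S0 by (auto intro!: exI[of _ 0])
  show s: "has_sup ?N (modulus_pos x)"
    unfolding modulus_pos_def using zero le by (intro has_sup_Sup[of _ "W x"]) auto
  show m0: "0 \<le> modulus_pos x" by (rule has_sup_upper[OF s zero])
  have mW: "modulus_pos x \<le> W x" by (rule has_sup_least[OF s]) (use le in auto)
  have "W x \<in> H" using W x positive_opsD bounded_opsD by blast
  then show mH: "modulus_pos x \<in> H" using L2_absI[of "W x" "modulus_pos x"] m0 mW by simp
  have up: "\<bar>S u\<bar> \<le> modulus_pos x" if u: "\<bar>u\<bar> \<le> x" for u
  proof (rule abs_leI)
    have uH: "u \<in> H" using L2_absI x u by blast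
    show "S u \<le> modulus_pos x" by (rule has_sup_upper[OF s]) (use u uH in auto)
    have "S (- u) \<le> modulus_pos x" using u uH H_closed(5) by (intro has_sup_upper[OF s]) auto
    then show "- S u \<le> modulus_pos x" using bounded_ops_minus[OF S_bdd uH] by simp
  qed
  then show "\<bar>u\<bar> \<le> x \<Longrightarrow> \<bar>S u\<bar> \<le> modulus_pos x" .
  have lub: "isLub H {\<bar>S u\<bar> | u. u \<in> H \<and> \<bar>u\<bar> \<le> x} (modulus_pos x)"
    unfolding isLub_def leastP_def isUb_def setle_def setge_def
  proof (intro conjI ballI)
    fix z assume "z \<in> Collect (\<lambda>z. (\<forall>y\<in>{\<bar>S u\<bar> |u. u \<in> H \<and> \<bar>u\<bar> \<le> x}. y \<le> z) \<and> z \<in> H)"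
    then have "\<bar>S u\<bar> \<le> z" if "u \<in> H" "\<bar>u\<bar> \<le> x" for u using that by auto
    then have "S u \<le> z" if "u \<in> H" "\<bar>u\<bar> \<le> x" for u using that abs_le_D1 by blast
    then show "modulus_pos x \<le> z" by (intro has_sup_least[OF s]) auto
  qed (use up mH in auto)
  show "modulus_cone H S x = modulus_pos x"
    unfolding modulus_cone_def
  proof (rule the_equality)
    show "isLub H {\<bar>S u\<bar> | u. u \<in> H \<and> \<bar>u\<bar> \<le> x} (modulus_pos x)" by (rule lub)
    fix t assume t: "isLub H {\<bar>S u\<bar> | u. u \<in> H \<and> \<bar>u\<bar> \<le> x} t"
    show "t = modulus_pos x"
      using isLub_le_isUb[OF t isLub_isUb[OF lub]] isLub_le_isUb[OF lub isLub_isUb[OF t]] by simp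
  qed
qed

lemma modulus_pos_least:
  assumes "x \<in> H" "0 \<le> x" "\<And>u. u \<in> H \<Longrightarrow> \<bar>u\<bar> \<le> x \<Longrightarrow> S u \<le> z"
  shows "modulus_pos x \<le> z"
  by (rule has_sup_least[OF modulus_pos_props(1)[OF assms(1,2)]]) (use assms(3) in auto)

lemma modulus_pos_add:
  assumes x: "x \<in> H" "0 \<le> x" and y: "y \<in> H" "0 \<le> y"
  shows "modulus_pos (x + y) = modulus_pos x + modulus_pos y"
proof (rule order_antisym)
  have xy: "x + y \<in> H" "0 \<le> x + y" using x y H_closed(2) by auto
  show "modulus_pos (x + y) \<le> modulus_pos x + modulus_pos y"
  proof (rule modulus_pos_least[OF xy])
    fix u assume u: "u \<in> H" "\<bar>u\<bar> \<le> x + y"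
    obtain u1 u2 where uu: "u = u1 + u2" "\<bar>u1\<bar> \<le> x" "\<bar>u2\<bar> \<le> y"
      using riesz_decomposition_abs[OF u(2) x(2) y(2)] .
    have "S u = S u1 + S u2"
      unfolding uu(1) using L2_absI uu x y by (intro bounded_opsD(3)[OF S_bdd]) auto
    also have "\<dots> \<le> modulus_pos x + modulus_pos y"
      using modulus_pos_props(4)[OF x uu(2)] modulus_pos_props(4)[OF y uu(3)] by (intro add_mono) (auto dest: abs_le_D1)
    finally show "S u \<le> modulus_pos x + modulus_pos y" .
  qed
  show "modulus_pos x + modulus_pos y \<le> modulus_pos (x + y)"
  proof (rule has_sup_least[OF has_sup_add_sets[OF modulus_pos_props(1)[OF x] modulus_pos_props(1)[OF y]]])
    fix w assume "w \<in> {a + b |a b. a \<in> {S u |u. u \<in> H \<and> \<bar>u\<bar> \<le> x} \<and> b \<in> {S u |u. u \<in> H \<and> \<bar>u\<bar> \<le> y}}"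
    then obtain u v where uv: "w = S u + S v" "u \<in> H" "\<bar>u\<bar> \<le> x" "v \<in> H" "\<bar>v\<bar> \<le> y" by auto
    have "\<bar>u + v\<bar> \<le> x + y" using abs_triangle_ineq[of u v] add_mono[OF uv(3,5)] by order
    then have "\<bar>S (u + v)\<bar> \<le> modulus_pos (x + y)" by (rule modulus_pos_props(4)[OF xy])
    then show "w \<le> modulus_pos (x + y)" using bounded_opsD(3)[OF S_bdd uv(2,4)] uv(1) by (simp add: abs_le_iff)
  qed
qed

lemma modulus_pos_scaleR:
  assumes x: "x \<in> H" "0 \<le> x" and c: "0 < c"
  shows "modulus_pos (c *\<^sub>R x) = c *\<^sub>R modulus_pos x"
proof -
  have ge: "c *\<^sub>R modulus_pos x \<le> modulus_pos (c *\<^sub>R x)" if x: "x \<in> H" "0 \<le> x" and c: "0 < c" for c x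
  proof (rule has_sup_least[OF has_sup_scaleR[OF modulus_pos_props(1)[OF x] c]])
    have cx: "c *\<^sub>R x \<in> H" "0 \<le> c *\<^sub>R x" using x c H_closed(4) by (auto intro: scaleR_nonneg_nonneg)
    fix w assume "w \<in> (*\<^sub>R) c ` {S u |u. u \<in> H \<and> \<bar>u\<bar> \<le> x}"
    then obtain u where u: "w = c *\<^sub>R S u" "u \<in> H" "\<bar>u\<bar> \<le> x" by auto
    have "\<bar>c *\<^sub>R u\<bar> \<le> c *\<^sub>R x" using u c by (simp add: abs_scaleR_lattice scaleR_left_mono)
    from modulus_pos_props(4)[OF cx this] show "w \<le> modulus_pos (c *\<^sub>R x)"
      using u bounded_ops_scaleR[OF S_bdd u(2)] by (simp add: abs_le_iff)
  qed
  have "(1 / c) *\<^sub>R modulus_pos (c *\<^sub>R x) \<le> modulus_pos x"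
    using ge[of "c *\<^sub>R x" "1 / c"] x c H_closed(4) by (simp add: scaleR_nonneg_nonneg)
  then have "c *\<^sub>R ((1 / c) *\<^sub>R modulus_pos (c *\<^sub>R x)) \<le> c *\<^sub>R modulus_pos x" using c by (intro scaleR_left_mono) auto
  then show ?thesis using ge[OF x c] c by simp
qed

text \<open>Additivity on the cone permits any representation as a difference of positive elements,
  as the proof of linearity requires.\<close>

lemma modulus_eq:
  assumes "p \<in> H" "0 \<le> p" "q \<in> H" "0 \<le> q"
  shows "modulus S (p - q) = modulus_pos p - modulus_pos q"
proof -
  let ?x = "p - q"
  have xH: "?x \<in> H" using assms H_closed(3) by blast
  have pp: "pprt ?x \<in> H" "pprt (- ?x) \<in> H" using H_closed(8)[OF xH] H_closed(8)[OF H_closed(5)[OF xH]] .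
  have "modulus S ?x = modulus_pos (pprt ?x) - modulus_pos (pprt (- ?x))"
    unfolding op_modulus_def using xH modulus_pos_props(5)[OF pp(1)] modulus_pos_props(5)[OF pp(2)] by (simp add: pprt_def)
  moreover have "p + pprt (- ?x) = pprt ?x + q"
    using pprt_minus_pprt[of ?x] by (metis add.commute add_diff_eq diff_add_cancel diff_add_eq)
  then have "modulus_pos p + modulus_pos (pprt (- ?x)) = modulus_pos (pprt ?x) + modulus_pos q"
    using assms pp by (metis modulus_pos_add zero_le_pprt)
  then have "modulus_pos (pprt ?x) = modulus_pos p + modulus_pos (pprt (- ?x)) - modulus_pos q" by simp
  ultimately show ?thesis by simp
qed

lemma modulus_pos_zero: "modulus_pos 0 = 0"
  using modulus_pos_add[of 0 0] H_closed(1) by simp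

lemma modulus_cone: "x \<in> H \<Longrightarrow> 0 \<le> x \<Longrightarrow> modulus S x = modulus_pos x"
  using modulus_eq[of x 0] H_closed(1) modulus_pos_zero by simp

lemma modulus_add:
  assumes "x \<in> H" "y \<in> H"
  shows "modulus S (x + y) = modulus S x + modulus S y"
proof -
  note pp = H_closed(8)[OF assms(1)] H_closed(8)[OF H_closed(5)[OF assms(1)]]
    H_closed(8)[OF assms(2)] H_closed(8)[OF H_closed(5)[OF assms(2)]]
  have "x + y = (pprt x - pprt (- x)) + (pprt y - pprt (- y))"
    using pprt_minus_pprt by metis
  also have "\<dots> = (pprt x + pprt y) - (pprt (- x) + pprt (- y))" by simp
  finally have "modulus S (x + y) = modulus_pos (pprt x + pprt y) - modulus_pos (pprt (- x) + pprt (- y))"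
    using pp H_closed(2) by (simp add: modulus_eq)
  also have "\<dots> = (modulus_pos (pprt x) - modulus_pos (pprt (- x))) + (modulus_pos (pprt y) - modulus_pos (pprt (- y)))"
    using pp by (simp add: modulus_pos_add)
  also have "\<dots> = modulus S x + modulus S y"
    using modulus_eq[OF pp(1) _ pp(2)] modulus_eq[OF pp(3) _ pp(4)] pprt_minus_pprt[of x] pprt_minus_pprt[of y]
    by simp
  finally show ?thesis .
qed

lemma modulus_in_H:
  assumes "x \<in> H" shows "modulus S x \<in> H"
proof -
  note pp = H_closed(8)[OF assms] H_closed(8)[OF H_closed(5)[OF assms]]
  have "modulus S x = modulus_pos (pprt x) - modulus_pos (pprt (- x))"
    using modulus_eq[OF pp(1) _ pp(2)] pprt_minus_pprt[of x] by simp
  then show ?thesis using modulus_pos_props(3)[OF pp(1)] modulus_pos_props(3)[OF pp(2)] H_closed(3) by simp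
qed

lemma modulus_minus: "x \<in> H \<Longrightarrow> modulus S (- x) = - modulus S x"
  using modulus_add[of x "- x"] modulus_cone[OF H_closed(1)] modulus_pos_zero H_closed(5) by (simp add: eq_neg_iff_add_eq_0 add.commute)

lemma modulus_scaleR:
  assumes x: "x \<in> H"
  shows "modulus S (c *\<^sub>R x) = c *\<^sub>R modulus S x"
proof -
  note pp = H_closed(8)[OF x] H_closed(8)[OF H_closed(5)[OF x]]
  have e: "modulus S x = modulus_pos (pprt x) - modulus_pos (pprt (- x))"
    using modulus_eq[OF pp(1) _ pp(2)] pprt_minus_pprt[of x] by simp
  have pos: "modulus S (c *\<^sub>R x) = c *\<^sub>R modulus S x" if c: "0 < c" for c
  proof -
    have "c *\<^sub>R x = c *\<^sub>R pprt x - c *\<^sub>R pprt (- x)"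
      using pprt_minus_pprt[of x] by (metis scaleR_right_diff_distrib)
    then have "modulus S (c *\<^sub>R x) = modulus_pos (c *\<^sub>R pprt x) - modulus_pos (c *\<^sub>R pprt (- x))"
      using pp H_closed(4) c by (simp add: modulus_eq scaleR_nonneg_nonneg)
    then show ?thesis using e pp c by (simp add: modulus_pos_scaleR scaleR_right_diff_distrib)
  qed
  consider "0 < c" | "c = 0" | "0 < - c" by linarith
  then show ?thesis
  proof cases
    case 2
    then show ?thesis using modulus_cone[OF H_closed(1)] modulus_pos_zero by simp
  next
    case 3
    then show ?thesis using pos[OF 3] modulus_minus[OF H_closed(4)[OF x], of c] by simp
  qed (use pos in auto)
qed

lemma modulus_nonneg: "x \<in> H \<Longrightarrow> 0 \<le> x \<Longrightarrow> 0 \<le> modulus S x"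
  using modulus_cone modulus_pos_props(2) by simp

lemma modulus_le:
  assumes W: "W \<in> POS" "\<And>u. u \<in> H \<Longrightarrow> \<bar>S u\<bar> \<le> W \<bar>u\<bar>" and x: "x \<in> H" "0 \<le> x"
  shows "modulus S x \<le> W x"
  unfolding modulus_cone[OF x]
  by (rule modulus_pos_least[OF x]) (use dominated_mono[OF W x(1)] in \<open>auto dest: abs_le_D1\<close>)

text \<open>Band preservation in \<open>a\<close> is inherited from a dominating positive operator:
  for \<open>a \<ge> 0\<close> the modulus at \<open>a * x\<close> is at most
  \<open>W (a * x) = a * W x\<close>, which stays disjoint from whatever \<open>a\<close> is
  disjoint from.\<close>

lemma modulus_A_nonneg:
  assumes a: "a \<in> A" and x: "x \<in> H" "0 \<le> x"
  shows "modulus S (a * x) = a * modulus S x"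
proof (rule local_operators_agree[OF range_alg_riesz one_in_A _ _ _ a, where F = "\<lambda>a. modulus S (a * x)"])
  obtain W where W: "W \<in> POS" "\<And>u. u \<in> H \<Longrightarrow> \<bar>S u\<bar> \<le> W \<bar>u\<bar>" using regular_dominated by blast
  have ax: "a * x \<in> H" if "a \<in> A" for a using L2_A_mult[OF that x(1)] .
  show "local_operator A (\<lambda>a. modulus S (a * x))"
    unfolding local_operator_def
  proof (intro conjI ballI allI impI)
    fix a b assume ab: "a \<in> A" "b \<in> A" "inf a b = 0"
    have ab0: "0 \<le> a" "0 \<le> b" using ab(3) by (metis inf.cobounded1 inf.cobounded2)+
    have "modulus S (a * x) \<le> W (a * x)" using ab0 x by (intro modulus_le[OF W ax[OF ab(1)]]) auto
    also have "\<dots> = a * W x" using W ab x positive_opsD(1) bounded_opsD(4) by blast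
    finally have le: "modulus S (a * x) \<le> a * W x" .
    have "inf (a * W x) b = 0" using ab(3) positive_opsD(2)[OF W(1) x] by (rule f_algebra_right)
    then show "inf (modulus S (a * x)) b = 0"
      by (rule inf_eq_zero_mono) (use le ab0 ab x ax modulus_nonneg in auto)
  qed (use ax x modulus_nonneg in \<open>auto simp: distrib_right modulus_add modulus_scaleR\<close>)
  show "local_operator A (\<lambda>a. a * modulus S x)"
    using modulus_nonneg[OF x] by (auto simp: local_operator_def algebra_simps intro!: f_algebra_right mult_nonneg_nonneg)
qed simp

lemma modulus_abs_le:
  assumes x: "x \<in> H"
  shows "\<bar>modulus S x\<bar> \<le> modulus S \<bar>x\<bar>"
  by (rule abs_additive_le[where V = H]) (use x modulus_add modulus_nonneg H_closed in auto)

text \<open>The dominating operator \<open>W\<close> supplies the bound: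
  \<open>\<bar>modulus S x\<bar> \<le> W \<bar>x\<bar>\<close>, and squaring does not see the
  absolute value of x.\<close>

lemma modulus_positive_op: "modulus S \<in> POS"
proof -
  obtain W where W: "W \<in> POS" "\<And>u. u \<in> H \<Longrightarrow> \<bar>S u\<bar> \<le> W \<bar>u\<bar>" using regular_dominated by blast
  have WB: "W \<in> B" by (rule positive_opsD(1)[OF W(1)])
  obtain k where k: "k \<in> A" "0 \<le> k" "\<And>x. x \<in> H \<Longrightarrow> \<tau> (W x * W x) \<le> (k * k) * \<tau> (x * x)"
    using WB unfolding bounded_ops_iff by blast
  have bound: "\<tau> (modulus S x * modulus S x) \<le> (k * k) * \<tau> (x * x)" if x: "x \<in> H" for x
  proof -
    note a = H_closed(9)[OF x]
    have "modulus S \<bar>x\<bar> \<le> W \<bar>x\<bar>" by (rule modulus_le[OF W a abs_ge_zero])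
    then have "\<bar>modulus S x\<bar> \<le> W \<bar>x\<bar>" using modulus_abs_le[OF x] by order
    then have "\<bar>modulus S x\<bar> * \<bar>modulus S x\<bar> \<le> W \<bar>x\<bar> * W \<bar>x\<bar>" by (intro mult_self_mono) auto
    then have "modulus S x * modulus S x \<le> W \<bar>x\<bar> * W \<bar>x\<bar>" by (simp only: abs_mult_self_f)
    then have "\<tau> (modulus S x * modulus S x) \<le> \<tau> (W \<bar>x\<bar> * W \<bar>x\<bar>)"
      using modulus_in_H[OF x] bounded_opsD(2)[OF WB a] by (intro cond_ext_mono L2_mult)
    also have "\<dots> \<le> (k * k) * \<tau> (\<bar>x\<bar> * \<bar>x\<bar>)" by (rule k(3)[OF a])
    finally show ?thesis by (simp only: abs_mult_self_f)
  qed
  have hom: "modulus S (a * x) = a * modulus S x" if "a \<in> A" "x \<in> H" for a x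
  proof -
    note pp = H_closed(8)[OF that(2)] H_closed(8)[OF H_closed(5)[OF that(2)]]
    have sub: "modulus S (y - z) = modulus S y - modulus S z" if "y \<in> H" "z \<in> H" for y z
      using modulus_add[of y "- z"] modulus_minus[of z] that H_closed(5) by simp
    have "a * x = a * pprt x - a * pprt (- x)"
      using pprt_minus_pprt[of x] by (metis right_diff_distrib)
    then have "modulus S (a * x) = a * modulus S (pprt x) - a * modulus S (pprt (- x))"
      using pp that by (simp add: sub L2_A_mult modulus_A_nonneg)
    also have "\<dots> = a * modulus S (pprt x - pprt (- x))" using sub[OF pp] by (simp add: right_diff_distrib)
    finally show ?thesis using pprt_minus_pprt[of x] by simp
  qed
  have "modulus S \<in> H \<rightarrow>\<^sub>E H" using modulus_in_H by (auto simp: op_modulus_def)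
  then have "modulus S \<in> B"
    unfolding bounded_ops_iff
    by (intro conjI ballI bexI[of _ k]) (simp_all only: modulus_add hom bound k)
  then show ?thesis using modulus_nonneg by (simp add: positive_ops_def order_positive_def)
qed

lemma modulus_ge:
  assumes "x \<in> H" "\<bar>u\<bar> \<le> x"
  shows "\<bar>S u\<bar> \<le> modulus S x"
proof -
  have x0: "0 \<le> x" using order_trans[OF abs_ge_zero assms(2)] .
  show ?thesis unfolding modulus_cone[OF assms(1) x0] by (rule modulus_pos_props(4)[OF assms(1) x0 assms(2)])
qed

lemma modulus_least:
  "x \<in> H \<Longrightarrow> 0 \<le> x \<Longrightarrow> (\<And>u. u \<in> H \<Longrightarrow> \<bar>u\<bar> \<le> x \<Longrightarrow> S u \<le> z) \<Longrightarrow> modulus S x \<le> z"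
  using modulus_pos_least modulus_cone by metis

end

text \<open>Paired with \<open>y \<ge> 0\<close>, the adjoint at u becomes
  \<open>\<tau> (S y * u)\<close>, and \<open>S y * u\<close> is at most
  \<open>op_modulus H S y * x\<close> whenever \<open>\<bar>u\<bar> \<le> x\<close>.\<close>

lemma modulus_adj_le:
  assumes S: "S \<in> REG" and x: "x \<in> H" "0 \<le> x"
  shows "op_modulus H (adj E T S) x \<le> adj E T (op_modulus H S) x"
proof (rule modulus_least[OF adj_regular(1)[OF S] x])
  note M = modulus_positive_op[OF S]
  note MB = positive_opsD(1)[OF M] and MB' = positive_opsD(1)[OF adj_positive(1)[OF M]]
  note SB = regular_in_bounded[OF S] and SB' = regular_in_bounded[OF adj_regular(1)[OF S]]
  fix u assume u: "u \<in> H" "\<bar>u\<bar> \<le> x"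
  show "adj E T S u \<le> adj E T (op_modulus H S) x"
  proof (rule L2_leI)
    fix y assume y: "y \<in> H" "0 \<le> y"
    have "S y * u \<le> \<bar>S y * u\<bar>" by (rule abs_ge_self)
    also have "\<dots> \<le> \<bar>S y\<bar> * \<bar>u\<bar>" by (rule abs_le_mult)
    also have "\<dots> \<le> op_modulus H S y * x"
      using modulus_ge[OF S y(1), of y] y u modulus_nonneg[OF S y] by (intro mult_mono) auto
    finally have "\<tau> (S y * u) \<le> \<tau> (op_modulus H S y * x)"
      using u x y bounded_opsD(2)[OF SB] bounded_opsD(2)[OF MB] by (intro cond_ext_mono L2_mult) auto
    then show "\<tau> (y * adj E T S u) \<le> \<tau> (y * adj E T (op_modulus H S) x)"
      using adj_regular(2)[OF S y(1) u(1)] adj_positive(2)[OF M y(1) x(1)] by simp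
  qed (use u x bounded_opsD(2)[OF SB'] bounded_opsD(2)[OF MB'] in auto)
qed

text \<open>The inequality \<open>|S\<^sup>*| \<le> |S|\<^sup>*\<close> applied to \<open>S\<^sup>*\<close> gives \<open>|S| \<le> |S\<^sup>*|\<^sup>*\<close>, whose adjoint is the
  converse inequality.\<close>

lemma modulus_adj:
  assumes S: "S \<in> REG"
  shows "op_modulus H (adj E T S) = adj E T (op_modulus H S)"
proof -
  let ?N = "op_modulus H (adj E T S)" and ?M = "op_modulus H S"
  note S' = adj_regular(1)[OF S]
  note M = modulus_positive_op[OF S] and N = modulus_positive_op[OF S']
  note NB = positive_opsD(1)[OF N] and MB' = positive_opsD(1)[OF adj_positive(1)[OF M]]
    and NB' = positive_opsD(1)[OF adj_positive(1)[OF N]] and MB = positive_opsD(1)[OF M]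
  have cone: "?N y = adj E T ?M y" if y: "y \<in> H" "0 \<le> y" for y
  proof (rule order_antisym[OF modulus_adj_le[OF S y]])
    show "adj E T ?M y \<le> ?N y"
    proof (rule L2_leI)
      fix x assume x: "x \<in> H" "0 \<le> x"
      have "?M x \<le> adj E T ?N x" using modulus_adj_le[OF S' x] by (simp add: adj_adj[OF S])
      then have "?M x * y \<le> adj E T ?N x * y" using y by (intro mult_right_mono)
      then have "\<tau> (?M x * y) \<le> \<tau> (adj E T ?N x * y)"
        using x y bounded_opsD(2)[OF MB] bounded_opsD(2)[OF NB'] by (intro cond_ext_mono L2_mult) auto
      then show "\<tau> (x * adj E T ?M y) \<le> \<tau> (x * ?N y)"
        using adj_positive(2)[OF M x(1) y(1)] adj_positive(2)[OF N y(1) x(1)] by (simp add: mult.commute)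
    qed (use y bounded_opsD(2)[OF NB] bounded_opsD(2)[OF MB'] in auto)
  qed
  show ?thesis
  proof (rule bounded_ops_eqI[OF NB MB'])
    fix x assume x: "x \<in> H"
    note pp = H_closed(8)[OF x] H_closed(8)[OF H_closed(5)[OF x]]
    have "?N (pprt x - pprt (- x)) = adj E T ?M (pprt x - pprt (- x))"
      using bounded_ops_diff[OF NB pp] bounded_ops_diff[OF MB' pp] cone[OF pp(1)] cone[OF pp(2)] by simp
    then show "?N x = adj E T ?M x" using pprt_minus_pprt[of x] by simp
  qed
qed

section \<open>The product identity and positivity of the parts\<close>

lemma adj_modulus_identity:
  assumes S: "S \<in> REG"
  defines "S' \<equiv> adj E T S" and "M \<equiv> op_modulus H S" and "M' \<equiv> adj E T (op_modulus H S)"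
  assumes x: "x \<in> H"
  shows "M' (M x) - S' (S x) =
    2 *\<^sub>R (op_pos_part H S' (op_neg_part H S x) + op_neg_part H S' (op_pos_part H S x))"
proof -
  note M = modulus_positive_op[OF S, folded M_def]
  have B: "M \<in> B" "M' \<in> B" "S \<in> B" "S' \<in> B"
    using positive_opsD(1)[OF M] positive_opsD(1)[OF adj_positive(1)[OF M]] S adj_regular(1)[OF S]
      regular_in_bounded by (auto simp: M'_def M_def S'_def)
  have mem: "M x \<in> H" "S x \<in> H" "M x - S x \<in> H" "M x + S x \<in> H"
    using B x bounded_opsD(2) H_closed(2,3) by auto
  have N: "op_modulus H S' = M'" unfolding S'_def M'_def by (rule modulus_adj[OF S])
  have "op_pos_part H S' (op_neg_part H S x) = (1/2) *\<^sub>R (1/2) *\<^sub>R (M' (M x - S x) + S' (M x - S x))"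
    using x mem H_closed(4) B
    by (simp add: op_pos_part_def op_neg_part_def N bounded_ops_scaleR flip: M_def scaleR_add_right)
  moreover have "op_neg_part H S' (op_pos_part H S x) = (1/2) *\<^sub>R (1/2) *\<^sub>R (M' (M x + S x) - S' (M x + S x))"
    using x mem H_closed(4) B
    by (simp add: op_pos_part_def op_neg_part_def N bounded_ops_scaleR flip: M_def scaleR_right_diff_distrib)
  ultimately have "2 *\<^sub>R (op_pos_part H S' (op_neg_part H S x) + op_neg_part H S' (op_pos_part H S x)) =
      (1/2) *\<^sub>R ((M' (M x - S x) + S' (M x - S x)) + (M' (M x + S x) - S' (M x + S x)))"
    by (simp add: scaleR_add_right)
  \<comment> \<open>The mixed terms \<open>M' (S x)\<close> and \<open>S' (M x)\<close> cancel
    between the two summands.\<close>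
  also have "\<dots> = (1/2) *\<^sub>R (2 *\<^sub>R (M' (M x) - S' (S x)))"
    using bounded_ops_diff[OF B(2) mem(1,2)] bounded_ops_diff[OF B(4) mem(1,2)]
      bounded_opsD(3)[OF B(2) mem(1,2)] bounded_opsD(3)[OF B(4) mem(1,2)]
    by (simp add: scaleR_2)
  finally show ?thesis by simp
qed

lemma modulus_parts_positive:
  assumes S: "S \<in> REG"
  shows "op_pos_part H S \<in> POS" "op_neg_part H S \<in> POS"
proof -
  note M = positive_opsD(1)[OF modulus_positive_op[OF S]] and SB = regular_in_bounded[OF S]
  have "op_pos_part H S = (\<lambda>x\<in>H. (1/2) *\<^sub>R op_modulus H S x + (1/2) *\<^sub>R S x)"
    "op_neg_part H S = (\<lambda>x\<in>H. (1/2) *\<^sub>R op_modulus H S x + (- 1/2) *\<^sub>R S x)"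
    by (simp_all add: op_pos_part_def op_neg_part_def algebra_simps)
  then have "op_pos_part H S \<in> B" "op_neg_part H S \<in> B"
    using bounded_ops_lincomb[OF M SB] by metis+
  moreover have "0 \<le> op_modulus H S x + S x" "0 \<le> op_modulus H S x - S x" if x: "x \<in> H" "0 \<le> x" for x
  proof -
    have "\<bar>S x\<bar> \<le> op_modulus H S x" using modulus_ge[OF S x(1), of x] x(2) by simp
    then have "0 \<le> op_modulus H S x - (- S x)" "0 \<le> op_modulus H S x - S x"
      by (simp_all only: diff_ge_0_iff_ge abs_le_iff)
    then show "0 \<le> op_modulus H S x + S x" "0 \<le> op_modulus H S x - S x" by simp_all
  qed
  ultimately show "op_pos_part H S \<in> POS" "op_neg_part H S \<in> POS"
    by (auto simp: positive_ops_def order_positive_def op_pos_part_def op_neg_part_def intro!: scaleR_nonneg_nonneg)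
qed

end

theorem theorem11p3:
  fixes E :: "'u::universally_complete_f_algebra set"
    and T S :: "'u \<Rightarrow> 'u"
  assumes "riesz_subspace E" and "order_dense E" and "dedekind_complete E"
    and "weak_order_unit E 1"
    and "conditional_expectation E T" and "T 1 = 1" and "strictly_positive_on E T"
    and "S \<in> regular_ops E T"
  shows "let H = L2 E T; S' = adj E T S; M = op_modulus H S; M' = adj E T M in
    S' \<in> regular_ops E T \<and>
    M \<in> positive_regular_ops E T \<and> positive_regular_ops E T = positive_ops E T \<and>
    (\<forall>x\<in>H. M' (M x) - S' (S x) =
       2 *\<^sub>R (op_pos_part H S' (op_neg_part H S x) + op_neg_part H S' (op_pos_part H S x))) \<and>
    op_le H (S' \<circ> S) (M' \<circ> M) \<and>
    ((\<forall>x\<in>H. S' (S x) = M' (M x)) \<longleftrightarrow>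
       (\<forall>x\<in>H. op_pos_part H S' (op_neg_part H S x) = 0) \<and>
       (\<forall>x\<in>H. op_neg_part H S' (op_pos_part H S x) = 0))"
proof -
  interpret cond_exp E T by unfold_locales (use assms in auto)
  note S = \<open>S \<in> regular_ops E T\<close>
  define S' M M' where "S' = adj E T S" and "M = op_modulus H S" and "M' = adj E T M"
  define P N P' N' where "P = op_pos_part H S" and "N = op_neg_part H S"
    and "P' = op_pos_part H S'" and "N' = op_neg_part H S'"
  have S': "S' \<in> regular_ops E T" unfolding S'_def by (rule adj_regular(1)[OF S])
  have pos: "P \<in> POS" "N \<in> POS" "P' \<in> POS" "N' \<in> POS"
    unfolding P_def N_def P'_def N'_def by (intro modulus_parts_positive S S')+
  have id: "M' (M x) - S' (S x) = 2 *\<^sub>R (P' (N x) + N' (P x))" if "x \<in> H" for x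
    using adj_modulus_identity[OF S that]
    by (simp only: S'_def M_def M'_def P_def N_def P'_def N'_def)
  have comp: "0 \<le> Q (R x)" if "Q \<in> POS" "R \<in> POS" "x \<in> H" "0 \<le> x" for Q R x
    using that positive_opsD bounded_opsD(2) by metis
  have le: "op_le H (S' \<circ> S) (M' \<circ> M)"
    unfolding op_le_def order_positive_def
    using id comp pos by (auto intro!: scaleR_nonneg_nonneg add_nonneg_nonneg)
  have eq: "(\<forall>x\<in>H. S' (S x) = M' (M x)) \<longleftrightarrow> (\<forall>x\<in>H. P' (N x) = 0) \<and> (\<forall>x\<in>H. N' (P x) = 0)"
  proof
    assume *: "\<forall>x\<in>H. S' (S x) = M' (M x)"
    \<comment> \<open>A vanishing sum splits only where both terms are nonnegative, hence first on
      the cone; \<open>ext\<close> below extends this to \<open>H\<close> by linearity.\<close>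
    have cone: "P' (N x) = 0" "N' (P x) = 0" if x: "x \<in> H" "0 \<le> x" for x
    proof -
      have "P' (N x) + N' (P x) = 0" using id[OF x(1)] * x(1) by simp
      then show "P' (N x) = 0" "N' (P x) = 0"
        using comp[OF pos(3,2) x] comp[OF pos(4,1) x] by (simp_all add: add_nonneg_eq_0_iff)
    qed
    have ext: "Q (R x) = 0"
      if "Q \<in> POS" "R \<in> POS" and z: "\<And>x. x \<in> H \<Longrightarrow> 0 \<le> x \<Longrightarrow> Q (R x) = 0" and x: "x \<in> H" for Q R x
    proof -
      note QB = positive_opsD(1)[OF that(1)] and RB = positive_opsD(1)[OF that(2)]
      note pp = H_closed(8)[OF x] H_closed(8)[OF H_closed(5)[OF x]]
      have "Q (R (pprt x - pprt (- x))) = Q (R (pprt x)) - Q (R (pprt (- x)))"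
        using bounded_ops_diff[OF RB pp] bounded_ops_diff[OF QB] bounded_opsD(2)[OF RB] pp by simp
      then show ?thesis using z pp pprt_minus_pprt[of x] by simp
    qed
    show "(\<forall>x\<in>H. P' (N x) = 0) \<and> (\<forall>x\<in>H. N' (P x) = 0)"
      using ext[OF pos(3,2)] ext[OF pos(4,1)] cone by blast
  next
    assume "(\<forall>x\<in>H. P' (N x) = 0) \<and> (\<forall>x\<in>H. N' (P x) = 0)"
    then have "M' (M x) - S' (S x) = 0" if "x \<in> H" for x using id[OF that] that by simp
    then show "\<forall>x\<in>H. S' (S x) = M' (M x)" by simp
  qed
  have M: "M \<in> positive_regular_ops E T"
    unfolding M_def positive_regular_eq by (rule modulus_positive_op[OF S])
  show ?thesis
    unfolding Let_def
    using S' M positive_regular_eq id le eq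
    unfolding P_def N_def P'_def N'_def M'_def M_def S'_def by blast
qed

end
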